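(* Let $H_1:\mathbb{R}^2\to\mathbb{R}$ satisfy: $H_1\in C^{0,\alpha}$ for some $\alpha\in(0,1)$; $H_1(p+n)=H_1(p)$ for all $p\in\mathbb{R}^2$, $n\in\mathbb{Z}^2$; $\sup|H_1-[H_1]|<2\sqrt2$, where $[H_1]=\int_{[0,1]^2}H_1$. Let $H_2:\mathbb{R}^2\to\mathbb{R}$ satisfy: $H_2\in C^{0,\alpha'}$ for some $\alpha'\in(0,1)$; $H_2(p)\to H_2^\infty\in\mathbb{R}$ as $|p|\to\infty$; $|H_2-H_2^\infty|_{(2,1)}<(2/\pi)^{3/2}$; there exist nonempty open $\omega_+,\omega_-\subset\mathbb{S}^1$ with $\pm(H_2(sp)-H_2^\infty)<0$ for all $p\in\omega_\pm$, $s>0$. Assume moreover $$\frac{\sqrt2}{4}\sup|H_1-[H_1]|+\Big(\frac{\pi}{2}\Big)^{3/2}|H_2-H_2^\infty|_{(2,1)}<1.$$ Then for every $0<\tau_0<\tau_1$ there exists $\varepsilon_0\in(0,1]$ such that for every $\varepsilon\in(0,\varepsilon_0]$ and every $\tau$ with $|\tau|\in[\tau_0,\tau_1]$ there exists $(u,\lambda)\in C^2(\mathbb{R}/\mathbb{Z};\mathbb{R}^2)\times\mathbb{R}$ with $\mathcal{A}(u)=\tau$ and $\mathcal{K}(u)(t)=\varepsilon H_1(u(t))+H_2(u(t))-\lambda$ for all $t\in\mathbb{R}$.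
   Context: Identify $\mathbb{R}^2$ with $\mathbb{C}$: $ip$ is the counterclockwise rotation of $p$ by $\pi/2$. For $U\in C^2$ with $\dot U\neq0$, $\mathcal{K}(U)=\frac{i\dot U\cdot\ddot U}{|\dot U|^3}$; for a $1$-periodic $u$, $\mathcal{A}(u)=\frac12\int_0^1u\cdot i\dot u\,dt$. $C^2(\mathbb{R}/\mathbb{Z};\mathbb{R}^2)$ denotes $1$-periodic $C^2$ maps. $|f|_{(2,1)}=\int_0^\infty f^*(t)t^{-1/2}dt$ with $f^*$ the decreasing rearrangement of $|f|$. *)

theory Defs
  imports "HOL-Analysis.Analysis"
begin

text \<open>R^2 is identified with the complex plane; i*p is rotation by pi/2,
  the dot product is the inner product on complex.\<close>

definition holder_C0 :: "real \<Rightarrow> (complex \<Rightarrow> real) \<Rightarrow> bool" where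
  "holder_C0 \<alpha> f \<longleftrightarrow> bounded (range f) \<and>
     (\<exists>C. \<forall>p q. \<bar>f p - f q\<bar> \<le> C * (dist p q) powr \<alpha>)"

definition decr_rearr :: "(complex \<Rightarrow> real) \<Rightarrow> real \<Rightarrow> ennreal" where
  "decr_rearr f t = Inf {s::ennreal. emeasure lborel {p. ennreal \<bar>f p\<bar> > s} \<le> ennreal t}"

definition lorentz21 :: "(complex \<Rightarrow> real) \<Rightarrow> ennreal" where
  "lorentz21 f = (\<integral>\<^sup>+ t. indicator {0<..} t * decr_rearr f t * ennreal (t powr (-1/2)) \<partial>lborel)"

definition vd :: "(real \<Rightarrow> complex) \<Rightarrow> real \<Rightarrow> complex" where
  "vd u t = vector_derivative u (at t)"

definition C2_periodic :: "(real \<Rightarrow> complex) \<Rightarrow> bool" where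
  "C2_periodic u \<longleftrightarrow> (\<forall>t. u (t + 1) = u t) \<and>
     (\<exists>u' u''. (\<forall>t. (u has_vector_derivative u' t) (at t)) \<and>
               (\<forall>t. (u' has_vector_derivative u'' t) (at t)) \<and>
               continuous_on UNIV u'')"

definition curvature :: "(real \<Rightarrow> complex) \<Rightarrow> real \<Rightarrow> real" where
  "curvature u t = ((\<i> * vd u t) \<bullet> vd (vd u) t) / (norm (vd u t)) ^ 3"

definition area :: "(real \<Rightarrow> complex) \<Rightarrow> real" where
  "area u = (1/2) * integral {0..1} (\<lambda>t. u t \<bullet> (\<i> * vd u t))"

definition mean_square :: "(complex \<Rightarrow> real) \<Rightarrow> real" where
  "mean_square H = integral (cbox 0 (1 + \<i>)) H"

end

theory Submission
  imports Defs "HOL-Complex_Analysis.Great_Picard"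
begin

text \<open>
  After subtracting the limit of H2 at infinity, solutions are critical points of length plus flux at fixed area, where the
  flux of f through a loop is the integral of f weighted by the winding number; it is written as a line integral of a
  primitive of f, and its first variation involves only f itself. The bound on the Lorentz norm controls the flux by
  half of the length. Loops far from the origin have almost the energy of a circle, by the isoperimetric inequality, while
  a circle inside the cone where the perturbation has a favourable sign does strictly better; hence minimisers exist once
  the periodic term is small. The minimisation is carried out among trigonometric polynomials of degree n, where
  the isoperimetric inequality is a comparison of Fourier coefficients. Testing the Euler-Lagrange equation with the second
  derivative gives bounds uniform in n, and the limit of the minimisers solves the equation weakly, hence classically.
\<close>

section \<open>Flux of a function through a closed curve\<close>

text \<open>The functional contains the square root of the Dirichlet energy in place of the length.
  The two agree at constant speed, but the energy is a diagonal quadratic form in the Fourier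
  coefficients and removes the freedom of reparametrisation. Constant speed returns at the end,
  because the limit equation makes the acceleration orthogonal to the velocity. The obstacle is
  translation: a minimising sequence may drift to infinity. A strict gap prevents this, namely
  |\<tau>| m, the flux gained by a circle lying where the sign is favourable by at least m. As
  \<epsilon> H1 does not decay, it may spend at most an eighth of that gap, and this is one source
  of \<epsilon>0. The circle uses two Fourier modes, so the gap and the bounds derived from it are
  the same for every degree. The averaging argument yields the crude constant 4 / (3 sqrt pi), which
  still suffices for half of the length under the given bound on the Lorentz norm.\<close>

definition loop :: "(real \<Rightarrow> complex) \<Rightarrow> (real \<Rightarrow> complex) \<Rightarrow> bool" where
  "loop u v \<longleftrightarrow> (\<forall>t. (u has_vector_derivative v t) (at t)) \<and> continuous_on UNIV v \<and> u 1 = u 0"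

text \<open>Loops are passed together with their derivative: in loop u v, v is the derivative of u. The flux is the line integral of the
  field (hprim f, 0), whose divergence is f, against i v.\<close>

definition hprim :: "(complex \<Rightarrow> real) \<Rightarrow> complex \<Rightarrow> real" where
  "hprim f p = Re p * integral {0..1} (\<lambda>r. f (Complex (r * Re p) (Im p)))"

definition flux :: "(complex \<Rightarrow> real) \<Rightarrow> (real \<Rightarrow> complex) \<Rightarrow> (real \<Rightarrow> complex) \<Rightarrow> real" where
  "flux f u v = - integral {0..1} (\<lambda>t. hprim f (u t) * Im (v t))"

text \<open>The first variation of \<open>flux f\<close> at u in the direction \<phi>: it sees the
  normal component of \<phi> and no primitive of f. For f = 1 and \<phi> = u it is twice the
  area.\<close>

definition dflux :: "(complex \<Rightarrow> real) \<Rightarrow> (real \<Rightarrow> complex) \<Rightarrow> (real \<Rightarrow> complex) \<Rightarrow> (real \<Rightarrow> complex) \<Rightarrow> real" where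
  "dflux f u v \<phi> = integral {0..1} (\<lambda>t. f (u t) * (\<phi> t \<bullet> (\<i> * v t)))"

lemma loopD:
  assumes "loop u v"
  shows "(u has_vector_derivative v t) (at t)" "continuous_on S v" "continuous_on S u" "u 1 = u 0"
proof -
  show *: "(u has_vector_derivative v t) (at t)" "u 1 = u 0" for t
    using assms by (auto simp: loop_def)
  show "continuous_on S v"
    using assms continuous_on_subset by (auto simp: loop_def)
  show "continuous_on S u"
    using * continuous_at_imp_continuous_on has_vector_derivative_continuous by blast
qed

lemma loop_lincomb:
  assumes "loop u v" "loop \<phi> \<psi>"
  shows "loop (\<lambda>t. u t + s *\<^sub>R \<phi> t) (\<lambda>t. v t + s *\<^sub>R \<psi> t)"
  unfolding loop_def
  by (auto intro!: derivative_eq_intros continuous_intros loopD[OF assms(1)] loopD[OF assms(2)]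
      simp: loopD(4)[OF assms(1)] loopD(4)[OF assms(2)])

lemma inner_times_i: "a \<bullet> (\<i> * b) = Im a * Re b - Re a * Im b"
  by (simp add: inner_complex_def algebra_simps)

lemma norm_inner_times_i: "\<bar>a \<bullet> (\<i> * b)\<bar> \<le> norm a * norm b"
  using Cauchy_Schwarz_ineq2[of a "\<i> * b"] by (simp add: norm_mult)

lemma continuous_on_Complex [continuous_intros]:
  assumes "continuous_on S f" "continuous_on S g"
  shows "continuous_on S (\<lambda>x. Complex (f x) (g x))"
  unfolding complex_eq using assms by (intro continuous_intros)

lemma continuous_on_compose_UNIV:
  "continuous_on UNIV f \<Longrightarrow> continuous_on S g \<Longrightarrow> continuous_on S (\<lambda>x. f (g x))"
  by (rule continuous_on_compose2) auto

lemma continuous_on_hprim: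
  assumes "continuous_on UNIV f"
  shows "continuous_on S (hprim f)"
proof -
  have "continuous_on UNIV (\<lambda>p. integral (cbox 0 1) (\<lambda>r. f (Complex (r * Re p) (Im p))))"
    by (rule integral_continuous_on_param)
       (auto simp: case_prod_beta intro!: continuous_intros continuous_on_compose_UNIV[OF assms])
  then have "continuous_on UNIV (hprim f)"
    unfolding hprim_def by (intro continuous_intros) auto
  then show ?thesis using continuous_on_subset by blast
qed

lemma hprim_add:
  assumes "continuous_on UNIV f" "continuous_on UNIV g"
  shows "hprim (\<lambda>p. f p + g p) p = hprim f p + hprim g p"
  unfolding hprim_def
  by (subst integral_add)
     (auto simp: algebra_simps intro!: integrable_continuous_real continuous_intros
       continuous_on_compose_UNIV[OF assms(1)] continuous_on_compose_UNIV[OF assms(2)])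

lemma hprim_cmult: "hprim (\<lambda>p. c * f p) p = c * hprim f p"
  unfolding hprim_def by simp

lemma flux_cmult: "flux (\<lambda>p. c * f p) u v = c * flux f u v"
  by (simp add: flux_def hprim_cmult mult.assoc)

lemma flux_integrable:
  assumes "continuous_on UNIV f" "loop u v"
  shows "(\<lambda>t. hprim f (u t) * Im (v t)) integrable_on {0..1}"
  by (intro integrable_continuous_real continuous_intros loopD[OF assms(2)]
      continuous_on_compose2[OF continuous_on_hprim[OF assms(1), of UNIV]]) auto

lemma dflux_continuous:
  assumes "continuous_on UNIV f" "loop u v" "continuous_on S \<phi>"
  shows "continuous_on S (\<lambda>t. f (u t) * (\<phi> t \<bullet> (\<i> * v t)))"
  by (intro continuous_intros loopD[OF assms(2)] continuous_on_compose_UNIV[OF assms(1)] assms(3))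

lemma flux_add:
  assumes "continuous_on UNIV f" "continuous_on UNIV g" "loop u v"
  shows "flux (\<lambda>p. f p + g p) u v = flux f u v + flux g u v"
  unfolding flux_def hprim_add[OF assms(1,2)] distrib_right
  by (subst integral_add) (auto intro!: flux_integrable assms)

lemma dflux_add:
  assumes "continuous_on UNIV f" "continuous_on UNIV g" "loop u v" "continuous_on {0..1} \<phi>"
  shows "dflux (\<lambda>p. f p + g p) u v \<phi> = dflux f u v \<phi> + dflux g u v \<phi>"
  unfolding dflux_def distrib_right
  by (subst integral_add) (auto intro!: integrable_continuous_real dflux_continuous assms)

lemma continuous_on_dflux_param:
  assumes "continuous_on UNIV f" "loop u v" "loop \<phi> \<psi>"
  shows "continuous_on S (\<lambda>s. dflux f (\<lambda>t. u t + s *\<^sub>R \<phi> t) (\<lambda>t. v t + s *\<^sub>R \<psi> t) \<phi>)"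
proof -
  have "continuous_on S (\<lambda>s. integral (cbox 0 1) (\<lambda>t. f (u t + s *\<^sub>R \<phi> t) * (\<phi> t \<bullet> (\<i> * (v t + s *\<^sub>R \<psi> t)))))"
    by (rule integral_continuous_on_param)
       (auto simp: case_prod_beta intro!: continuous_intros continuous_on_compose_UNIV[OF assms(1)]
         continuous_on_compose_UNIV[OF loopD(3)[OF assms(2)]] continuous_on_compose_UNIV[OF loopD(2)[OF assms(2)]]
         continuous_on_compose_UNIV[OF loopD(3)[OF assms(3)]] continuous_on_compose_UNIV[OF loopD(2)[OF assms(3)]])
  then show ?thesis unfolding dflux_def by simp
qed

section \<open>The homotopy formula for the flux\<close>

text \<open>Sums of monomials, because \<open>hprim\<close> of a monomial is explicit and both sides
  of the homotopy formula are linear in f.\<close>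

inductive bivariate_poly :: "(complex \<Rightarrow> real) \<Rightarrow> bool" where
  monomial: "bivariate_poly (\<lambda>p. c * Re p ^ a * Im p ^ b)"
| add: "bivariate_poly f \<Longrightarrow> bivariate_poly g \<Longrightarrow> bivariate_poly (\<lambda>p. f p + g p)"

lemma bivariate_poly_continuous: "bivariate_poly f \<Longrightarrow> continuous_on S f"
  by (induction rule: bivariate_poly.induct) (auto intro!: continuous_intros)

lemma bivariate_poly_mult_monomial:
  "bivariate_poly g \<Longrightarrow> bivariate_poly (\<lambda>p. (c * Re p ^ a * Im p ^ b) * g p)"
proof (induction rule: bivariate_poly.induct)
  case (monomial d k l)
  have "(\<lambda>p. c * Re p ^ a * Im p ^ b * (d * Re p ^ k * Im p ^ l)) =
     (\<lambda>p. (c * d) * Re p ^ (a + k) * Im p ^ (b + l))" by (auto simp: power_add)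
  then show ?case by (simp only: bivariate_poly.monomial)
next
  case (add f g)
  then show ?case by (simp add: distrib_left bivariate_poly.add)
qed

lemma bivariate_poly_mult:
  "bivariate_poly f \<Longrightarrow> bivariate_poly g \<Longrightarrow> bivariate_poly (\<lambda>p. f p * g p)"
  by (induction rule: bivariate_poly.induct)
     (simp_all add: bivariate_poly_mult_monomial distrib_right bivariate_poly.add)

text \<open>Bridge to the Stone-Weierstrass theorem, whose \<open>real_polynomial_function\<close>
  is generated from linear maps rather than from coordinates.\<close>

lemma bivariate_poly_of_real_polynomial:
  fixes f :: "complex \<Rightarrow> real"
  shows "real_polynomial_function f \<Longrightarrow> bivariate_poly f"
proof (induction rule: real_polynomial_function.induct)
  case (linear f)
  then interpret bounded_linear f .
  have "f p = f 1 * Re p ^ 1 * Im p ^ 0 + f \<i> * Re p ^ 0 * Im p ^ 1" for p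
  proof -
    have "p = Re p *\<^sub>R 1 + Im p *\<^sub>R \<i>" by (simp add: complex_eq_iff)
    then have "f p = f (Re p *\<^sub>R 1 + Im p *\<^sub>R \<i>)" by simp
    also have "\<dots> = Re p * f 1 + Im p * f \<i>" by (subst add, subst (1 2) scaleR) simp
    finally show ?thesis by (simp add: mult.commute)
  qed
  then have "f = (\<lambda>p. f 1 * Re p ^ 1 * Im p ^ 0 + f \<i> * Re p ^ 0 * Im p ^ 1)" (is "f = ?g") by blast
  moreover have "bivariate_poly ?g"
    by (rule bivariate_poly.add; rule bivariate_poly.monomial)
  ultimately show ?case by simp
next
  case (const c)
  show ?case using bivariate_poly.monomial[of c 0 0] by simp
qed (auto intro: bivariate_poly.add bivariate_poly_mult)

lemma hprim_monomial:
  "hprim (\<lambda>p. c * Re p ^ a * Im p ^ b) p = c * (Re p ^ Suc a / real (Suc a)) * Im p ^ b"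
proof -
  have "((\<lambda>r. r ^ a) has_integral (1 ^ Suc a / real (Suc a) - 0 ^ Suc a / real (Suc a))) {0..1::real}"
    by (rule fundamental_theorem_of_calculus)
       (auto intro!: derivative_eq_intros simp: has_real_derivative_iff_has_vector_derivative[symmetric] simp del: of_nat_Suc power_Suc)
  then have "integral {0..1} (\<lambda>r::real. r ^ a) = 1 / real (Suc a)"
    by (auto simp: integral_unique)
  then show ?thesis
    by (simp add: hprim_def power_mult_distrib)
qed

text \<open>Green's formula on the (s, t) square: the s-derivative of the flux integrand is the
  integrand F of \<open>dflux\<close> plus an exact term D, the t-derivative of -g(X, Y) Im \<phi>.
  Over a closed loop D integrates to zero, and Fubini exchanges s and t.\<close>

lemma flux_homotopy_monomial:
  assumes u: "loop u v" and \<phi>: "loop \<phi> \<psi>"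
    and f_def: "f = (\<lambda>p. c * Re p ^ a * Im p ^ b)"
  shows "flux f (\<lambda>t. u t + \<phi> t) (\<lambda>t. v t + \<psi> t) - flux f u v =
    integral {0..1} (\<lambda>s. dflux f (\<lambda>t. u t + s *\<^sub>R \<phi> t) (\<lambda>t. v t + s *\<^sub>R \<psi> t) \<phi>)"
proof -
  have cf: "continuous_on S f" for S unfolding f_def by (intro continuous_intros)
  define X where "X s t = Re (u t) + s * Re (\<phi> t)" for s t
  define Y where "Y s t = Im (u t) + s * Im (\<phi> t)" for s t
  define X' where "X' s t = Re (v t) + s * Re (\<psi> t)" for s t
  define Y' where "Y' s t = Im (v t) + s * Im (\<psi> t)" for s t
  define g where "g x y = c * (x ^ Suc a / real (Suc a)) * y ^ b" for x y :: real
  define gx where "gx x y = c * x ^ a * y ^ b" for x y :: real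
  \<comment> \<open>For b = 0 the truncated exponent b - 1 is harmless, as the factor
    \<open>real b\<close> vanishes.\<close>
  define gy where "gy x y = c * (x ^ Suc a / real (Suc a)) * (real b * y ^ (b - 1))" for x y :: real
  have [continuous_intros]: "continuous_on S (\<lambda>z. g (h z) (k z))" "continuous_on S (\<lambda>z. gx (h z) (k z))"
    "continuous_on S (\<lambda>z. gy (h z) (k z))"
    if "continuous_on S h" "continuous_on S k" for S and h k :: "real \<times> real \<Rightarrow> real"
    unfolding g_def gx_def gy_def using that by (auto intro!: continuous_intros simp del: of_nat_Suc power_Suc)
  have dg: "((\<lambda>s. g (h s) (k s)) has_real_derivative (gx (h s) (k s) * h' + gy (h s) (k s) * k')) (at s within S)"
    if "(h has_real_derivative h') (at s within S)" "(k has_real_derivative k') (at s within S)" for h k h' k' S s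
    unfolding g_def gx_def gy_def
    by (rule DERIV_cong[OF DERIV_mult[OF DERIV_cmult[OF DERIV_cdivide[OF DERIV_power[OF that(1)]]] DERIV_power[OF that(2)]]])
       (simp add: algebra_simps del: of_nat_Suc power_Suc)
  have dRe: "((\<lambda>t. Re (w t)) has_real_derivative Re w') (at t within S)"
       and dIm: "((\<lambda>t. Im (w t)) has_real_derivative Im w') (at t within S)"
    if "(w has_vector_derivative w') (at t)" for w w' t S
    using has_vector_derivative_at_within[OF that, of S]
    by (auto intro: bounded_linear.has_vector_derivative[OF bounded_linear_Re]
        bounded_linear.has_vector_derivative[OF bounded_linear_Im]
        simp: has_real_derivative_iff_has_vector_derivative)
  note du = loopD(1)[OF u] and d\<phi> = loopD(1)[OF \<phi>]
  have dX: "((\<lambda>t. X s t) has_real_derivative X' s t) (at t within S)"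
   and dY: "((\<lambda>t. Y s t) has_real_derivative Y' s t) (at t within S)" for s t S
    unfolding X_def Y_def X'_def Y'_def
    by (rule DERIV_add[OF dRe[OF du] DERIV_cmult[OF dRe[OF d\<phi>]]] DERIV_add[OF dIm[OF du] DERIV_cmult[OF dIm[OF d\<phi>]]])+
  have dsX: "((\<lambda>s. X s t) has_real_derivative Re (\<phi> t)) (at s within S)"
   and dsY: "((\<lambda>s. Y s t) has_real_derivative Im (\<phi> t)) (at s within S)"
   and dsY': "((\<lambda>s. Y' s t) has_real_derivative Im (\<psi> t)) (at s within S)" for s t S
    unfolding X_def Y_def Y'_def by (auto intro!: derivative_eq_intros)
  define D where "D s t = - (gx (X s t) (Y s t) * X' s t + gy (X s t) (Y s t) * Y' s t) * Im (\<phi> t)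
        - g (X s t) (Y s t) * Im (\<psi> t)" for s t
  define F where "F s t = gx (X s t) (Y s t) * (Im (\<phi> t) * X' s t - Re (\<phi> t) * Y' s t)" for s t
  have flux_eq: "flux f (\<lambda>t. u t + s *\<^sub>R \<phi> t) (\<lambda>t. v t + s *\<^sub>R \<psi> t) =
     integral {0..1} (\<lambda>t. - (g (X s t) (Y s t) * Y' s t))" for s
    unfolding flux_def f_def hprim_monomial g_def X_def Y_def Y'_def by simp
  have dflux_eq: "dflux f (\<lambda>t. u t + s *\<^sub>R \<phi> t) (\<lambda>t. v t + s *\<^sub>R \<psi> t) \<phi> = integral {0..1} (F s)" for s
    unfolding dflux_def f_def inner_times_i F_def gx_def X_def Y_def X'_def Y'_def by simp
  have c2: "continuous_on S (\<lambda>z. X (fst z) (snd z))" "continuous_on S (\<lambda>z. Y (fst z) (snd z))"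
     "continuous_on S (\<lambda>z. X' (fst z) (snd z))" "continuous_on S (\<lambda>z. Y' (fst z) (snd z))"
     "continuous_on S (\<lambda>z. \<phi> (snd z))" "continuous_on S (\<lambda>z. \<psi> (snd z))" for S :: "(real \<times> real) set"
    unfolding X_def Y_def X'_def Y'_def
    by (auto intro!: continuous_intros
         continuous_on_compose_UNIV[OF loopD(3)[OF u]] continuous_on_compose_UNIV[OF loopD(2)[OF u]]
         continuous_on_compose_UNIV[OF loopD(3)[OF \<phi>]] continuous_on_compose_UNIV[OF loopD(2)[OF \<phi>]])
  have cD: "continuous_on S (\<lambda>z. D (fst z) (snd z))" and cF: "continuous_on S (\<lambda>z. F (fst z) (snd z))"
    for S :: "(real \<times> real) set"
    unfolding D_def F_def by (intro continuous_intros c2)+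
  have cDF: "continuous_on S (\<lambda>z. D (fst z) (snd z) + F (fst z) (snd z))" for S :: "(real \<times> real) set"
    by (intro continuous_intros cD cF)
  have slice: "continuous_on S (\<lambda>t. K s t)" if "\<And>S. continuous_on S (\<lambda>z. K (fst z) (snd z))"
    for K :: "real \<Rightarrow> real \<Rightarrow> real" and s S
  proof -
    have "continuous_on S (\<lambda>t. (s, t))" by (intro continuous_intros)
    from continuous_on_compose2[OF that[of UNIV] this] show ?thesis by simp
  qed
  have s1: "((\<lambda>s. D s t + F s t) has_integral (- (g (X 1 t) (Y 1 t) * Y' 1 t) - - (g (X 0 t) (Y 0 t) * Y' 0 t))) {0..1}" for t
  proof (rule fundamental_theorem_of_calculus)
    show "((\<lambda>s. - (g (X s t) (Y s t) * Y' s t)) has_vector_derivative D s t + F s t) (at s within {0..1})" for s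
      unfolding has_real_derivative_iff_has_vector_derivative[symmetric]
      by (rule DERIV_cong[OF DERIV_minus[OF DERIV_mult[OF dg[OF dsX dsY] dsY']]])
         (simp add: D_def F_def algebra_simps)
  qed auto
  have s2: "(D s has_integral (- (g (X s 1) (Y s 1) * Im (\<phi> 1)) - - (g (X s 0) (Y s 0) * Im (\<phi> 0)))) {0..1}" for s
  proof (rule fundamental_theorem_of_calculus)
    show "((\<lambda>t. - (g (X s t) (Y s t) * Im (\<phi> t))) has_vector_derivative D s t) (at t within {0..1})" for t
      unfolding has_real_derivative_iff_has_vector_derivative[symmetric]
      by (rule DERIV_cong[OF DERIV_minus[OF DERIV_mult[OF dg[OF dX dY] dIm[OF d\<phi>]]]])
         (simp add: D_def algebra_simps)
  qed auto
  have "- (g (X s 1) (Y s 1) * Im (\<phi> 1)) - - (g (X s 0) (Y s 0) * Im (\<phi> 0)) = 0" for s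
    using loopD(4)[OF u] loopD(4)[OF \<phi>] by (simp add: X_def Y_def)
  with s2 have D0: "integral {0..1} (D s) = 0" for s by (metis integral_unique)
  have intDF: "integral {0..1} (\<lambda>t. D s t + F s t) = integral {0..1} (F s)" for s
  proof -
    have "D s integrable_on {0..1}" "F s integrable_on {0..1}"
      by (rule integrable_continuous_real, rule slice, rule cD cF)+
    then show ?thesis by (subst integral_add) (auto simp: D0)
  qed
  have int1: "(\<lambda>t. - (g (X s t) (Y s t) * Y' s t)) integrable_on {0..1}" for s
    by (rule integrable_continuous_real, rule slice) (intro continuous_intros c2)
  have "flux f (\<lambda>t. u t + \<phi> t) (\<lambda>t. v t + \<psi> t) - flux f u v =
     integral {0..1} (\<lambda>t. - (g (X 1 t) (Y 1 t) * Y' 1 t)) - integral {0..1} (\<lambda>t. - (g (X 0 t) (Y 0 t) * Y' 0 t))"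
    using flux_eq[of 1] flux_eq[of 0] by simp
  also have "\<dots> = integral {0..1} (\<lambda>t. - (g (X 1 t) (Y 1 t) * Y' 1 t) - - (g (X 0 t) (Y 0 t) * Y' 0 t))"
    by (rule integral_diff[symmetric]) (rule int1)+
  also have "\<dots> = integral {0..1} (\<lambda>t. integral {0..1} (\<lambda>s. D s t + F s t))"
    using s1 by (metis (no_types, lifting) integral_unique)
  also have "\<dots> = integral {0..1} (\<lambda>s. integral {0..1} (\<lambda>t. D s t + F s t))"
    using integral_swap_continuous[of 0 0 1 1 "\<lambda>s t. D s t + F s t"] cDF
    by (simp add: case_prod_beta)
  also have "\<dots> = integral {0..1} (\<lambda>s. dflux f (\<lambda>t. u t + s *\<^sub>R \<phi> t) (\<lambda>t. v t + s *\<^sub>R \<psi> t) \<phi>)"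
    by (simp add: intDF dflux_eq)
  finally show ?thesis .
qed

lemma integral_abs_le:
  fixes h :: "real \<Rightarrow> real"
  assumes "continuous_on {0..1} h" "\<And>t. t \<in> {0..1} \<Longrightarrow> \<bar>h t\<bar> \<le> K"
  shows "\<bar>integral {0..1} h\<bar> \<le> K"
  using integral_bound[of 0 1 h K] assms by auto

lemma hprim_bound:
  assumes "continuous_on UNIV f" "\<And>p. norm p \<le> R \<Longrightarrow> \<bar>f p\<bar> \<le> K" "norm p \<le> R"
  shows "\<bar>hprim f p\<bar> \<le> R * K"
proof -
  have "\<bar>integral {0..1} (\<lambda>r. f (Complex (r * Re p) (Im p)))\<bar> \<le> K"
  proof (rule integral_abs_le)
    show "continuous_on {0..1} (\<lambda>r. f (Complex (r * Re p) (Im p)))"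
      by (intro continuous_intros continuous_on_compose_UNIV[OF assms(1)])
    fix r :: real assume r: "r \<in> {0..1}"
    have "norm (Complex (r * Re p) (Im p)) \<le> norm p"
      unfolding cmod_def using r
      by (intro real_sqrt_le_mono add_mono) (auto simp: power_mult_distrib intro!: mult_left_le_one_le power_le_one)
    with assms show "\<bar>f (Complex (r * Re p) (Im p))\<bar> \<le> K" by simp
  qed
  moreover have "\<bar>Re p\<bar> \<le> R" using abs_Re_le_cmod[of p] assms(3) by simp
  ultimately show ?thesis unfolding hprim_def abs_mult by (intro mult_mono) auto
qed

text \<open>Linearity in K is the point: the bound estimates the error of polynomial approximation
  on a fixed ball.\<close>

lemma flux_bound_ball:
  assumes f: "continuous_on UNIV f" and u: "loop u v"
    and K: "\<And>p. norm p \<le> R \<Longrightarrow> \<bar>f p\<bar> \<le> K" and "\<And>t. t \<in> {0..1} \<Longrightarrow> norm (u t) \<le> R"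
    and "\<And>t. t \<in> {0..1} \<Longrightarrow> norm (v t) \<le> C"
  shows "\<bar>flux f u v\<bar> \<le> R * K * C"
  unfolding flux_def abs_minus
proof (rule integral_abs_le)
  show "continuous_on {0..1} (\<lambda>t. hprim f (u t) * Im (v t))"
    by (intro continuous_intros loopD[OF u] continuous_on_compose2[OF continuous_on_hprim[OF f, of UNIV]]) auto
  fix t :: real assume t: "t \<in> {0..1}"
  have "\<bar>hprim f (u t)\<bar> \<le> R * K" by (rule hprim_bound[OF f K]) (use assms t in auto)
  moreover have "\<bar>Im (v t)\<bar> \<le> C" using abs_Im_le_cmod[of "v t"] assms(5)[OF t] by simp
  ultimately show "\<bar>hprim f (u t) * Im (v t)\<bar> \<le> R * K * C"
    unfolding abs_mult by (intro mult_mono) auto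
qed

lemma dflux_bound:
  assumes f: "continuous_on UNIV f" and u: "loop u v" and "continuous_on {0..1} \<phi>"
    and K: "\<And>t. t \<in> {0..1} \<Longrightarrow> \<bar>f (u t)\<bar> \<le> K" and "\<And>t. t \<in> {0..1} \<Longrightarrow> norm (\<phi> t) \<le> P"
  shows "\<bar>dflux f u v \<phi>\<bar> \<le> K * P * integral {0..1} (\<lambda>t. norm (v t))"
proof -
  have c: "continuous_on {0..1} (\<lambda>t. f (u t) * (\<phi> t \<bullet> (\<i> * v t)))" by (rule dflux_continuous) fact+
  have c': "continuous_on {0..1} (\<lambda>t. norm (v t))" by (intro continuous_intros loopD[OF u])
  have K0: "0 \<le> K" using K[of 0] by simp
  have "norm (integral {0..1} (\<lambda>t. f (u t) * (\<phi> t \<bullet> (\<i> * v t)))) \<le> integral {0..1} (\<lambda>t. (K * P) * norm (v t))"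
  proof (rule integral_norm_bound_integral)
    fix t :: real assume t: "t \<in> {0..1}"
    have "\<bar>\<phi> t \<bullet> (\<i> * v t)\<bar> \<le> P * norm (v t)"
      using norm_inner_times_i[of "\<phi> t" "v t"] mult_right_mono[OF assms(5)[OF t], of "norm (v t)"] by simp
    then have "\<bar>f (u t)\<bar> * \<bar>\<phi> t \<bullet> (\<i> * v t)\<bar> \<le> K * (P * norm (v t))"
      using K[OF t] K0 by (intro mult_mono) auto
    then show "norm (f (u t) * (\<phi> t \<bullet> (\<i> * v t))) \<le> (K * P) * norm (v t)"
      by (simp add: abs_mult mult.assoc)
  qed (auto intro!: integrable_continuous_real c continuous_intros c')
  then show ?thesis by (simp add: dflux_def)
qed

lemma loop_bounded:
  assumes "loop u v"
  obtains R where "R > 0" "\<And>t. t \<in> {0..1} \<Longrightarrow> norm (u t) \<le> R" "\<And>t. t \<in> {0..1} \<Longrightarrow> norm (v t) \<le> R"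
proof -
  have "bounded (u ` {0..1})" "bounded (v ` {0..1})"
    by (auto intro!: compact_imp_bounded compact_continuous_image loopD[OF assms])
  then obtain a b where "\<forall>t\<in>{0..1}. norm (u t) \<le> a" "\<forall>t\<in>{0..1}. norm (v t) \<le> b"
    by (auto simp: bounded_iff)
  then show ?thesis by (intro that[of "max 1 (max a b)"]) fastforce+
qed

text \<open>For continuous f the field is not differentiable, so the formula is proved for polynomials and extended by density.\<close>

theorem flux_homotopy:
  assumes f: "continuous_on UNIV f" and u: "loop u v" and \<phi>: "loop \<phi> \<psi>"
  shows "flux f (\<lambda>t. u t + \<phi> t) (\<lambda>t. v t + \<psi> t) - flux f u v =
    integral {0..1} (\<lambda>s. dflux f (\<lambda>t. u t + s *\<^sub>R \<phi> t) (\<lambda>t. v t + s *\<^sub>R \<psi> t) \<phi>)"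
proof -
  let ?D = "\<lambda>f s. dflux f (\<lambda>t. u t + s *\<^sub>R \<phi> t) (\<lambda>t. v t + s *\<^sub>R \<psi> t) \<phi>"
  define \<Delta> where "\<Delta> f = flux f (\<lambda>t. u t + \<phi> t) (\<lambda>t. v t + \<psi> t) - flux f u v -
    integral {0..1} (\<lambda>s. ?D f s)" for f
  have l: "loop (\<lambda>t. u t + s *\<^sub>R \<phi> t) (\<lambda>t. v t + s *\<^sub>R \<psi> t)" for s by (rule loop_lincomb[OF u \<phi>])
  have l1: "loop (\<lambda>t. u t + \<phi> t) (\<lambda>t. v t + \<psi> t)" using l[of 1] by simp
  have \<Delta>_add: "\<Delta> (\<lambda>p. f p + g p) = \<Delta> f + \<Delta> g" if "continuous_on UNIV f" "continuous_on UNIV g" for f g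
  proof -
    have "integral {0..1} (\<lambda>s. ?D (\<lambda>p. f p + g p) s) =
       integral {0..1} (\<lambda>s. ?D f s) +
       integral {0..1} (\<lambda>s. ?D g s)"
      unfolding dflux_add[OF that l loopD(3)[OF \<phi>]]
      by (intro integral_add integrable_continuous_real continuous_on_dflux_param u \<phi> that)
    then show ?thesis by (simp add: \<Delta>_def flux_add[OF that u] flux_add[OF that l1])
  qed
  have \<Delta>_poly: "\<Delta> g = 0" if "bivariate_poly g" for g
    using that
  proof (induction rule: bivariate_poly.induct)
    case (monomial c a b)
    then show ?case by (simp add: \<Delta>_def flux_homotopy_monomial[OF u \<phi> refl])
  next
    case (add f g)
    then show ?case by (simp add: \<Delta>_add bivariate_poly_continuous)
  qed
  obtain A where A: "A > 0" "\<And>t. t \<in> {0..1} \<Longrightarrow> norm (u t) \<le> A" "\<And>t. t \<in> {0..1} \<Longrightarrow> norm (v t) \<le> A"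
    by (rule loop_bounded[OF u]) blast
  obtain B where B: "B > 0" "\<And>t. t \<in> {0..1} \<Longrightarrow> norm (\<phi> t) \<le> B" "\<And>t. t \<in> {0..1} \<Longrightarrow> norm (\<psi> t) \<le> B"
    by (rule loop_bounded[OF \<phi>]) blast
  define R where "R = A + B"
  have R: "R > 0" "B \<le> R" using A B by (auto simp: R_def)
  have bd: "norm (u t + s *\<^sub>R \<phi> t) \<le> R" "norm (v t + s *\<^sub>R \<psi> t) \<le> R" if "s \<in> {0..1}" "t \<in> {0..1}" for s t
  proof -
    have "norm (s *\<^sub>R \<phi> t) \<le> B" "norm (s *\<^sub>R \<psi> t) \<le> B"
      using that B mult_mono[of s 1 "norm (\<phi> t)" B] mult_mono[of s 1 "norm (\<psi> t)" B] by auto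
    then show "norm (u t + s *\<^sub>R \<phi> t) \<le> R" "norm (v t + s *\<^sub>R \<psi> t) \<le> R"
      using A(2,3)[OF that(2)] norm_triangle_ineq[of "u t" "s *\<^sub>R \<phi> t"] norm_triangle_ineq[of "v t" "s *\<^sub>R \<psi> t"]
      unfolding R_def by linarith+
  qed
  \<comment> \<open>The defect \<Delta> is linear in f and vanishes on polynomials, so it equals the
    defect of the approximation error h. Each of its three terms is at most R e R, as R bounds all
    curves of the homotopy and their velocities.\<close>
  have "\<bar>\<Delta> f\<bar> \<le> (3 * R * R) * e" if e: "e > 0" for e
  proof -
    obtain g where g: "real_polynomial_function g" "\<And>x. x \<in> cball 0 R \<Longrightarrow> \<bar>f x - g x\<bar> < e"
      by (rule Stone_Weierstrass_real_polynomial_function[of "cball 0 R" f e])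
         (use f e in \<open>auto intro: continuous_on_subset\<close>)
    have bp: "bivariate_poly g" using g(1) by (rule bivariate_poly_of_real_polynomial)
    have cg: "continuous_on UNIV g" by (rule bivariate_poly_continuous[OF bp])
    define h where "h = (\<lambda>p. f p - g p)"
    have ch: "continuous_on UNIV h" unfolding h_def by (intro continuous_intros f cg)
    have h: "\<bar>h p\<bar> \<le> e" if "norm p \<le> R" for p
      using g(2)[of p] that by (simp add: h_def)
    have "\<Delta> f = \<Delta> (\<lambda>p. h p + g p)" by (simp add: h_def)
    also have "\<dots> = \<Delta> h" by (simp add: \<Delta>_add[OF ch cg] \<Delta>_poly[OF bp])
    finally have \<Delta>f: "\<Delta> f = \<Delta> h" .
    have f1: "\<bar>flux h (\<lambda>t. u t + \<phi> t) (\<lambda>t. v t + \<psi> t)\<bar> \<le> R * e * R"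
      by (rule flux_bound_ball[OF ch l1 h]) (use bd[of 1] in auto)
    have f0: "\<bar>flux h u v\<bar> \<le> R * e * R"
      by (rule flux_bound_ball[OF ch u h]) (use bd[of 0] in auto)
    have "\<bar>integral {0..1} (\<lambda>s. ?D h s)\<bar> \<le> R * e * R"
    proof (rule integral_abs_le[OF continuous_on_dflux_param[OF ch u \<phi>]])
      fix s :: real assume s: "s \<in> {0..1}"
      have "\<bar>?D h s\<bar> \<le>
          e * R * integral {0..1} (\<lambda>t. norm (v t + s *\<^sub>R \<psi> t))"
        by (rule dflux_bound[OF ch l loopD(3)[OF \<phi>]]) (use h bd[OF s] order_trans[OF B(2) R(2)] in auto)
      also have "\<dots> \<le> e * R * R"
      proof (rule mult_left_mono)
        have "\<bar>integral {0..1} (\<lambda>t. norm (v t + s *\<^sub>R \<psi> t))\<bar> \<le> R"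
          by (rule integral_abs_le) (auto intro!: continuous_intros loopD[OF u] loopD[OF \<phi>] bd s)
        then show "integral {0..1} (\<lambda>t. norm (v t + s *\<^sub>R \<psi> t)) \<le> R" by simp
      qed (use e R in auto)
      finally show "\<bar>?D h s\<bar> \<le> R * e * R" by (simp add: mult.commute)
    qed
    with f0 f1 have "\<bar>\<Delta> h\<bar> \<le> R * e * R + R * e * R + R * e * R" unfolding \<Delta>_def by linarith
    also have "\<dots> = (3 * R * R) * e" by (simp add: algebra_simps)
    finally show ?thesis using \<Delta>f by simp
  qed
  note small = this
  have "\<Delta> f = 0"
  proof (rule ccontr)
    assume "\<Delta> f \<noteq> 0"
    then have "\<bar>\<Delta> f\<bar> > 0" by simp
    then have "\<bar>\<Delta> f\<bar> \<le> (3 * R * R) * (\<bar>\<Delta> f\<bar> / (6 * R * R))" using R by (intro small) auto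
    with R \<open>\<bar>\<Delta> f\<bar> > 0\<close> show False by simp
  qed
  then show ?thesis by (simp add: \<Delta>_def)
qed

section \<open>Bounds for the flux by values of f near the curve\<close>

lemma integral_mean_value:
  fixes k :: "real \<Rightarrow> real"
  assumes "continuous_on {0..1} k"
  shows "\<exists>s\<in>{0..1}. integral {0..1} k = k s"
proof -
  have "\<exists>s\<in>{0<..<1}. integral {0..1} k - integral {0..0} k = (1 - 0) *\<^sub>R k s"
  proof (rule mvt_simple)
    fix x :: real assume "0 \<le> x" "x \<le> 1"
    then have "((\<lambda>x. integral {0..x} k) has_vector_derivative k x) (at x within {0..1})"
      by (intro integral_has_vector_derivative assms) auto
    then show "((\<lambda>x. integral {0..x} k) has_derivative (\<lambda>h. h *\<^sub>R k x)) (at x within {0..1})"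
      by (simp add: has_vector_derivative_def)
  qed simp
  then obtain s where "s \<in> {0<..<1}" "integral {0..1} k = k s" by auto
  then show ?thesis by (auto intro!: bexI[of _ s])
qed

text \<open>Writes an increment as a single \<open>dflux\<close> at an intermediate loop, so that
  bounds and derivatives of the flux reduce to those of \<open>dflux\<close>.\<close>

lemma flux_mean_value:
  assumes "continuous_on UNIV f" "loop u v" "loop \<phi> \<psi>"
  shows "\<exists>s\<in>{0..1}. flux f (\<lambda>t. u t + \<phi> t) (\<lambda>t. v t + \<psi> t) - flux f u v =
    dflux f (\<lambda>t. u t + s *\<^sub>R \<phi> t) (\<lambda>t. v t + s *\<^sub>R \<psi> t) \<phi>"
  unfolding flux_homotopy[OF assms]
  by (rule integral_mean_value[OF continuous_on_dflux_param[OF assms]])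

lemma loop_const: "loop (\<lambda>t. p) (\<lambda>t. 0)"
  by (auto simp: loop_def)

lemma loop_diff_const: "loop u v \<Longrightarrow> loop (\<lambda>t. u t - p) v"
  using loop_lincomb[of u v "\<lambda>t. p" "\<lambda>t. 0" "-1"] loop_const by simp

lemma flux_const: "flux f (\<lambda>t. p) (\<lambda>t. 0) = 0"
  by (simp add: flux_def)

text \<open>Contraction of the loop to the point p, where the flux vanishes; the cone swept out
  stands in for the area integral weighted by the winding number.\<close>

lemma flux_cone:
  assumes f: "continuous_on UNIV f" and u: "loop u v"
  shows "flux f u v = integral {0..1} (\<lambda>s. dflux f (\<lambda>t. p + s *\<^sub>R (u t - p)) (\<lambda>t. s *\<^sub>R v t) (\<lambda>t. u t - p))"
  using flux_homotopy[OF f loop_const[of p] loop_diff_const[OF u, of p]] by (simp add: flux_const)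

definition len :: "(real \<Rightarrow> complex) \<Rightarrow> real" where
  "len v = integral {0..1} (\<lambda>t. norm (v t))"

lemma len_nonneg: "0 \<le> len v"
  unfolding len_def
  by (cases "(\<lambda>t. norm (v t)) integrable_on {0..1}") (auto simp: integral_nonneg not_integrable_integral)

text \<open>During the contraction to p the loop stays within r of p and its length does not exceed
  \<open>len v\<close>. Thus only values of f near p enter, although \<open>hprim f\<close> depends
  on f all the way from the vertical axis.\<close>

lemma flux_bound:
  assumes f: "continuous_on UNIV f" and u: "loop u v"
    and K: "\<And>x. norm (x - p) \<le> r \<Longrightarrow> \<bar>f x\<bar> \<le> K" and r: "\<And>t. t \<in> {0..1} \<Longrightarrow> norm (u t - p) \<le> r"
  shows "\<bar>flux f u v\<bar> \<le> K * r * len v"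
proof -
  have lp: "loop (\<lambda>t. p + s *\<^sub>R (u t - p)) (\<lambda>t. s *\<^sub>R v t)" for s
    using loop_lincomb[OF loop_const loop_diff_const[OF u]] by simp
  have r0: "r \<ge> 0" using r[of 0] norm_ge_zero[of "u 0 - p"] by (smt (verit) atLeastAtMost_iff)
  have K0: "K \<ge> 0" using K[of p] r0 by simp
  obtain s where s: "s \<in> {0..1}" and eq: "flux f u v = dflux f (\<lambda>t. p + s *\<^sub>R (u t - p)) (\<lambda>t. s *\<^sub>R v t) (\<lambda>t. u t - p)"
    using flux_mean_value[OF f loop_const[of p] loop_diff_const[OF u, of p]] by (auto simp: flux_const)
  have "\<bar>flux f u v\<bar> \<le> K * r * integral {0..1} (\<lambda>t. norm (s *\<^sub>R v t))"
    unfolding eq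
  proof (rule dflux_bound[OF f lp])
    fix t :: real assume t: "t \<in> {0..1}"
    have "norm (s *\<^sub>R (u t - p)) \<le> r" using s r[OF t] mult_mono[of s 1 "norm (u t - p)" r] by auto
    then show "\<bar>f (p + s *\<^sub>R (u t - p))\<bar> \<le> K" by (intro K) simp
  qed (use r in \<open>auto intro!: continuous_intros loopD[OF u]\<close>)
  also have "integral {0..1} (\<lambda>t. norm (s *\<^sub>R v t)) = s * len v" using s by (simp add: len_def)
  also have "K * r * (s * len v) \<le> K * r * (1 * len v)"
    by (intro mult_left_mono mult_right_mono) (use s r0 K0 len_nonneg in auto)
  finally show ?thesis by simp
qed

lemma loop_has_integral:
  assumes "loop u v" "s \<le> t"
  shows "(v has_integral (u t - u s)) {s..t}"
  by (rule fundamental_theorem_of_calculus)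
     (use assms in \<open>auto intro: has_vector_derivative_at_within loopD\<close>)

lemma loop_displacement:
  assumes u: "loop u v" and t: "t \<in> {0..1}"
  shows "norm (u t - u 0) \<le> len v"
proof -
  have "(v has_integral (u t - u 0)) {0..t}" by (rule loop_has_integral[OF u]) (use t in simp)
  then have "norm (u t - u 0) = norm (integral {0..t} v)" by (simp add: integral_unique)
  also have "\<dots> \<le> integral {0..t} (\<lambda>t. norm (v t))"
    by (rule integral_norm_bound_integral) (auto intro!: integrable_continuous_real continuous_intros loopD[OF u])
  also have "\<dots> \<le> len v" unfolding len_def
    by (rule integral_subset_le) (use t in \<open>auto intro!: integrable_continuous_real continuous_intros loopD[OF u]\<close>)
  finally show ?thesis .
qed

text \<open>Quadratic in the length, hence useful where K or a prefactor is small: for \<epsilon> H1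
  and for loops far from the origin.\<close>

lemma flux_bound_len:
  assumes f: "continuous_on UNIV f" and u: "loop u v"
    and K: "\<And>x. norm (x - u 0) \<le> len v \<Longrightarrow> \<bar>f x\<bar> \<le> K"
  shows "\<bar>flux f u v\<bar> \<le> K * (len v)\<^sup>2"
  using flux_bound[OF f u K loop_displacement[OF u]] by (simp add: power2_eq_square mult.assoc)

section \<open>Coercivity from the Lorentz norm\<close>

text \<open>The weight of the Lorentz norm, integrated up to the measure M of a superlevel
  set.\<close>

lemma nn_integral_inverse_sqrt:
  assumes "0 \<le> M"
  shows "(\<integral>\<^sup>+t. indicator {0..M} t * ennreal (t powr (-1/2)) \<partial>lborel) = ennreal (2 * sqrt M)"
proof -
  have "((\<lambda>x. x powr (-1/2)) has_integral (M powr (-1/2+1) / (-1/2+1))) {0..M}"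
    by (rule has_integral_powr_from_0) (use assms in auto)
  then have *: "((\<lambda>x. x powr (-1/2)) has_integral 2 * sqrt M) {0..M}"
    using assms by (simp add: powr_half_sqrt mult.commute)
  show ?thesis
    using nn_integral_has_integral_lebesgue'[OF _ *] by (simp add: mult.commute)
qed

section \<open>Distribution function and decreasing rearrangement\<close>

text \<open>The distribution function of |f|, whose generalised inverse is
  \<open>decr_rearr f\<close>.\<close>

definition superlevel :: "(complex \<Rightarrow> real) \<Rightarrow> real \<Rightarrow> ennreal" where
  "superlevel f s = emeasure lborel {p. s < \<bar>f p\<bar>}"

lemma superlevel_measurable [measurable]:
  assumes [measurable]: "f \<in> borel_measurable borel"
  shows "superlevel f \<in> borel_measurable borel"
proof -
  \<comment> \<open>As a parametrised integral the distribution function is measurable by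
    Tonelli.\<close>
  have "superlevel f s = (\<integral>\<^sup>+p. indicator {x. fst x < \<bar>f (snd x)\<bar>} (s, p) \<partial>lborel)" for s
  proof -
    have "(\<integral>\<^sup>+p. indicator {x. fst x < \<bar>f (snd x)\<bar>} (s, p) \<partial>lborel) = (\<integral>\<^sup>+p. indicator {p. s < \<bar>f p\<bar>} p \<partial>lborel)"
      by (rule nn_integral_cong) (simp add: indicator_def)
    also have "\<dots> = emeasure lborel {p. s < \<bar>f p\<bar>}" by (rule nn_integral_indicator) measurable
    finally show ?thesis by (simp add: superlevel_def)
  qed
  then show ?thesis by (subst measurable_cong[where g="\<lambda>s. \<integral>\<^sup>+p. indicator {x. fst x < \<bar>f (snd x)\<bar>} (s, p) \<partial>lborel"]) auto
qed

text \<open>One half of the Galois connection between the rearrangement and the distribution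
  function.\<close>

lemma decr_rearr_ge:
  assumes f: "f \<in> borel_measurable borel" and s: "0 \<le> s" and t: "ennreal t < superlevel f s"
  shows "ennreal s \<le> decr_rearr f t"
  unfolding decr_rearr_def
proof (rule Inf_greatest)
  fix z assume "z \<in> {z. emeasure lborel {p. z < ennreal \<bar>f p\<bar>} \<le> ennreal t}"
  then have z: "emeasure lborel {p. z < ennreal \<bar>f p\<bar>} \<le> ennreal t" by simp
  show "ennreal s \<le> z"
  proof (rule ccontr)
    assume "\<not> ennreal s \<le> z"
    then have zs: "z < ennreal s" by simp
    have "superlevel f s \<le> emeasure lborel {p. z < ennreal \<bar>f p\<bar>}"
      unfolding superlevel_def
    proof (rule emeasure_mono)
      show "{p. s < \<bar>f p\<bar>} \<subseteq> {p. z < ennreal \<bar>f p\<bar>}"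
        using zs s by (auto intro: less_trans simp: ennreal_less_iff)
    qed (use f in auto)
    with z t show False by simp
  qed
qed

text \<open>Tonelli on the region t < \<open>superlevel f s\<close> with weight t^(-1/2):
  integrating in t first gives twice the root of the distribution function, integrating in s first
  gives at most \<open>decr_rearr f t\<close>.\<close>

lemma lorentz21_ge_layers:
  assumes f[measurable]: "f \<in> borel_measurable borel"
    and fin: "\<And>s. 0 < s \<Longrightarrow> superlevel f s < \<infinity>"
  shows "(\<integral>\<^sup>+s. indicator {0<..} s * ennreal (2 * sqrt (enn2real (superlevel f s))) \<partial>lborel) \<le> lorentz21 f"
proof -
  let ?K = "\<lambda>s t. indicator {0<..} s * (indicator {x. 0 < snd x \<and> ennreal (snd x) < superlevel f (fst x)} (s, t) * ennreal (t powr (-1/2)))"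
  have "(\<integral>\<^sup>+s. indicator {0<..} s * ennreal (2 * sqrt (enn2real (superlevel f s))) \<partial>lborel) = (\<integral>\<^sup>+s. \<integral>\<^sup>+t. ?K s t \<partial>lborel \<partial>lborel)"
  proof (rule nn_integral_cong)
    fix s :: real
    show "indicator {0<..} s * ennreal (2 * sqrt (enn2real (superlevel f s))) = (\<integral>\<^sup>+t. ?K s t \<partial>lborel)"
    proof (cases "0 < s")
      case True
      define M where "M = enn2real (superlevel f s)"
      have M: "superlevel f s = ennreal M" "0 \<le> M" using fin[OF True] by (auto simp: M_def)
      have "(\<integral>\<^sup>+t. ?K s t \<partial>lborel) = (\<integral>\<^sup>+t. indicator {0..M} t * ennreal (t powr (-1/2)) \<partial>lborel)"
      proof (rule nn_integral_cong_AE)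
        have "AE t in lborel. t \<noteq> 0 \<and> t \<noteq> M"
          by (intro AE_conjI AE_lborel_singleton)
        then show "AE t in lborel. ?K s t = indicator {0..M} t * ennreal (t powr (-1/2))"
          by eventually_elim (use True M in \<open>auto simp: indicator_def ennreal_less_iff\<close>)
      qed
      with True show ?thesis unfolding nn_integral_inverse_sqrt[OF M(2)] M_def[symmetric] by simp
    qed simp
  qed
  also have "\<dots> = (\<integral>\<^sup>+t. \<integral>\<^sup>+s. ?K s t \<partial>lborel \<partial>lborel)"
    by (rule lborel_pair.Fubini') measurable
  also have "\<dots> \<le> lorentz21 f"
    unfolding lorentz21_def
  proof (rule nn_integral_mono)
    fix t :: real
    show "(\<integral>\<^sup>+s. ?K s t \<partial>lborel) \<le> indicator {0<..} t * decr_rearr f t * ennreal (t powr (-1/2))"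
    proof (cases "0 < t")
      case True
      have "(\<integral>\<^sup>+s. ?K s t \<partial>lborel) = (\<integral>\<^sup>+s. ennreal (t powr (-1/2)) * indicator {s. 0 < s \<and> ennreal t < superlevel f s} s \<partial>lborel)"
        using True by (intro nn_integral_cong) (auto simp: indicator_def)
      also have "\<dots> = ennreal (t powr (-1/2)) * emeasure lborel {s. 0 < s \<and> ennreal t < superlevel f s}"
        by (subst nn_integral_cmult) auto
      finally have eq: "(\<integral>\<^sup>+s. ?K s t \<partial>lborel) = ennreal (t powr (-1/2)) * emeasure lborel {s. 0 < s \<and> ennreal t < superlevel f s}" .
      have "emeasure lborel {s. 0 < s \<and> ennreal t < superlevel f s} \<le> decr_rearr f t"
      proof (cases "decr_rearr f t")
        case (real r)
        have "{s. 0 < s \<and> ennreal t < superlevel f s} \<subseteq> {0..r}"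
          using decr_rearr_ge[OF f, of _ t] real by (auto simp: ennreal_le_iff)
        then have "emeasure lborel {s. 0 < s \<and> ennreal t < superlevel f s} \<le> emeasure lborel {0..r}"
          by (rule emeasure_mono) auto
        then show ?thesis using real by simp
      qed simp
      from mult_left_mono[OF this, of "ennreal (t powr (-1/2))"] True show ?thesis
        unfolding eq by (simp add: mult.commute)
    qed (simp add: indicator_def)
  qed
  finally show ?thesis .
qed

text \<open>Tailored to N y, the area of the part of a disc of radius R that dilation by y carries
  into a set of measure M: it is bounded by the area of the disc and, by scaling, by M /
  y^2.\<close>

lemma nn_integral_truncated_inverse_square:
  assumes "0 < R" "0 \<le> M" and [measurable]: "N \<in> borel_measurable borel"
    and N: "\<And>y. N y \<le> ennreal (pi * R\<^sup>2)" "\<And>y. 0 < y \<Longrightarrow> N y \<le> ennreal (M / y\<^sup>2)"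
  shows "(\<integral>\<^sup>+y. indicator {0..1} y * N y \<partial>lborel) \<le> ennreal (2 * sqrt pi * R * sqrt M)"
proof (cases "M = 0")
  case True
  have "(\<integral>\<^sup>+y. indicator {0..1} y * N y \<partial>lborel) = (\<integral>\<^sup>+y. 0 \<partial>(lborel :: real measure))"
  proof (rule nn_integral_cong_AE)
    show "AE y in lborel. indicator {0..1} y * N y = 0"
      using AE_lborel_singleton[of 0] by eventually_elim (use True N(2) in \<open>force simp: indicator_def\<close>)
  qed
  then show ?thesis by simp
next
  case False
  with assms have M: "M > 0" by simp
  \<comment> \<open>The two bounds on N agree at a, and the two pieces of the integral then
    contribute the same amount \<open>sqrt pi * R * sqrt M\<close>.\<close>
  define a where "a = sqrt M / (sqrt pi * R)"
  have a: "a > 0" using M assms(1) by (simp add: a_def)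
  have tail: "(\<integral>\<^sup>+y. ennreal (M / y\<^sup>2) * indicator {a..} y \<partial>lborel) = ennreal (0 - (- M / a))"
  proof (rule nn_integral_FTC_atLeast)
    fix x assume "a \<le> x"
    then show "((\<lambda>x. - M / x) has_real_derivative M / x\<^sup>2) (at x)"
      using a by (auto intro!: derivative_eq_intros simp: field_simps power2_eq_square)
    show "0 \<le> M / x\<^sup>2" using M by simp
  next
    show "((\<lambda>x. - M / x) \<longlongrightarrow> 0) at_top"
      by (rule tendsto_divide_0[OF tendsto_const filterlim_at_top_imp_at_infinity[OF filterlim_ident]])
  qed auto
  have "(\<integral>\<^sup>+y. indicator {0..1} y * N y \<partial>lborel) \<le>
     (\<integral>\<^sup>+y. ennreal (pi * R\<^sup>2) * indicator {0..a} y + ennreal (M / y\<^sup>2) * indicator {a..} y \<partial>lborel)"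
    by (rule nn_integral_mono) (use N a in \<open>auto simp: indicator_def intro: add_increasing2\<close>)
  also have "\<dots> = ennreal (pi * R\<^sup>2) * ennreal a + ennreal (M / a)"
    using a by (subst nn_integral_add) (auto simp: tail nn_integral_cmult_indicator)
  also have "\<dots> = ennreal (pi * R\<^sup>2 * a + M / a)"
    using a M assms(1) by (simp add: ennreal_mult[symmetric] ennreal_plus[symmetric] del: ennreal_plus)
  also have "pi * R\<^sup>2 * a + M / a = 2 * sqrt pi * R * sqrt M"
  proof -
    have "pi * R\<^sup>2 * a = sqrt pi * R * sqrt M"
      using assms(1) by (simp add: a_def power2_eq_square field_simps)
    moreover have "M / a = sqrt pi * R * sqrt M"
      using assms(1) M by (simp add: a_def field_simps)
    ultimately show ?thesis by simp
  qed
  finally show ?thesis .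
qed

lemma emeasure_lborel_scaled_preimage:
  fixes A :: "complex set"
  assumes [measurable]: "A \<in> sets borel" and c: "0 < c"
  shows "emeasure lborel {h. p + c *\<^sub>R h \<in> A} = emeasure lborel A / ennreal (c\<^sup>2)"
proof -
  have "emeasure lborel A = emeasure (density (distr lborel borel (\<lambda>x. p + c *\<^sub>R x)) (\<lambda>_. ennreal (\<bar>c\<bar>^DIM(complex)))) A"
    using lborel_affine[of c p] c by simp
  also have "\<dots> = ennreal (c\<^sup>2) * emeasure lborel {h. p + c *\<^sub>R h \<in> A}"
    using c by (simp add: emeasure_density nn_integral_cmult_indicator emeasure_distr vimage_def)
  finally have "emeasure lborel A = emeasure lborel {h. p + c *\<^sub>R h \<in> A} * ennreal (c\<^sup>2)"
    by (simp add: mult.commute)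
  then show ?thesis using c by (simp add: ennreal_mult_divide_eq)
qed

text \<open>The substitution x = p + a h shows that the left-hand side is at most R times the
  integral of |f x| / |x - p|, so this is the pairing of L(2,1) with a function in weak L2. It is
  carried out one superlevel set at a time, and the layers are summed by
  \<open>lorentz21_ge_layers\<close>.\<close>

lemma lorentz21_segment_bound:
  fixes f :: "complex \<Rightarrow> real"
  assumes f[measurable]: "f \<in> borel_measurable borel"
    and fin: "\<And>s. 0 < s \<Longrightarrow> superlevel f s < \<infinity>" and R: "0 < R"
  shows "(\<integral>\<^sup>+a. \<integral>\<^sup>+h. indicator {0..1} a * (indicator (cball 0 R) h * ennreal \<bar>f (p + a *\<^sub>R h)\<bar>) \<partial>lborel \<partial>lborel)
     \<le> ennreal (sqrt pi * R) * lorentz21 f"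
proof -
  let ?w = "\<lambda>s. indicator {0<..} s * ennreal (2 * sqrt (enn2real (superlevel f s)))"
  have [measurable]: "cball (0::complex) R \<in> sets borel" by simp
  let ?I = "\<lambda>s a h. indicator {0..1::real} a * (indicator (cball 0 R) h * (if 0 < s \<and> s < \<bar>f (p + a *\<^sub>R h)\<bar> then 1 else 0)) :: ennreal"
  have layer: "ennreal \<bar>y\<bar> = (\<integral>\<^sup>+s. indicator {s. 0 < s \<and> s < \<bar>y\<bar>} s \<partial>lborel)" for y :: real
  proof -
    have "{s. 0 < s \<and> s < \<bar>y\<bar>} = {0<..<\<bar>y\<bar>}" by auto
    then show ?thesis by simp
  qed
  have "(\<integral>\<^sup>+a. \<integral>\<^sup>+h. indicator {0..1} a * (indicator (cball 0 R) h * ennreal \<bar>f (p + a *\<^sub>R h)\<bar>) \<partial>lborel \<partial>lborel)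
      = (\<integral>\<^sup>+a. \<integral>\<^sup>+h. \<integral>\<^sup>+s. ?I s a h \<partial>lborel \<partial>lborel \<partial>lborel)"
  proof (intro nn_integral_cong)
    fix a h
    show "indicator {0..1} a * (indicator (cball 0 R) h * ennreal \<bar>f (p + a *\<^sub>R h)\<bar>) = (\<integral>\<^sup>+s. ?I s a h \<partial>lborel)"
    proof -
      have "(\<integral>\<^sup>+s. ?I s a h \<partial>lborel) = indicator {0..1} a * (indicator (cball 0 R) h *
          (\<integral>\<^sup>+s. (if 0 < s \<and> s < \<bar>f (p + a *\<^sub>R h)\<bar> then 1 else 0) \<partial>lborel))"
        by (simp add: nn_integral_cmult)
      also have "(\<integral>\<^sup>+s. (if 0 < s \<and> s < \<bar>f (p + a *\<^sub>R h)\<bar> then 1 else 0) \<partial>lborel) =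
          ennreal \<bar>f (p + a *\<^sub>R h)\<bar>"
        unfolding layer by (rule nn_integral_cong) (simp add: indicator_def)
      finally show ?thesis by simp
    qed
  qed
  also have "\<dots> = (\<integral>\<^sup>+a. \<integral>\<^sup>+s. \<integral>\<^sup>+h. ?I s a h \<partial>lborel \<partial>lborel \<partial>lborel)"
    by (intro nn_integral_cong lborel_pair.Fubini') measurable
  also have "\<dots> = (\<integral>\<^sup>+s. \<integral>\<^sup>+a. \<integral>\<^sup>+h. ?I s a h \<partial>lborel \<partial>lborel \<partial>lborel)"
    by (rule lborel_pair.Fubini') measurable
  also have "\<dots> \<le> (\<integral>\<^sup>+s. ennreal (sqrt pi * R) * (?w s) \<partial>lborel)"
  proof (rule nn_integral_mono)
    fix s :: real
    show "(\<integral>\<^sup>+a. \<integral>\<^sup>+h. ?I s a h \<partial>lborel \<partial>lborel) \<le> ennreal (sqrt pi * R) * (?w s)"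
    proof (cases "0 < s")
      case True
      define M where "M = enn2real (superlevel f s)"
      have M: "superlevel f s = ennreal M" "0 \<le> M" using fin[OF True] by (auto simp: M_def)
      define N where "N a = (\<integral>\<^sup>+h. indicator (cball 0 R) h * (if s < \<bar>f (p + a *\<^sub>R h)\<bar> then 1 else 0) \<partial>lborel)" for a
      have [measurable]: "N \<in> borel_measurable borel" unfolding N_def by measurable
      have "(\<integral>\<^sup>+a. \<integral>\<^sup>+h. ?I s a h \<partial>lborel \<partial>lborel) = (\<integral>\<^sup>+a. indicator {0..1} a * N a \<partial>lborel)"
      proof (rule nn_integral_cong)
        fix a
        show "(\<integral>\<^sup>+h. ?I s a h \<partial>lborel) = indicator {0..1} a * N a"
          unfolding N_def using True
          by (subst nn_integral_cmult[symmetric]) (auto simp: indicator_def intro!: nn_integral_cong)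
      qed
      also have "\<dots> \<le> ennreal (2 * sqrt pi * R * sqrt M)"
      proof (rule nn_integral_truncated_inverse_square[OF R M(2)])
        show "N a \<le> ennreal (pi * R\<^sup>2)" for a
        proof -
          have "N a \<le> (\<integral>\<^sup>+h. indicator (cball (0::complex) R) h \<partial>lborel)"
            unfolding N_def by (intro nn_integral_mono) (auto simp: indicator_def)
          also have "\<dots> = ennreal (pi * R\<^sup>2)" using R by (simp add: emeasure_cball unit_ball_vol_2)
          finally show ?thesis .
        qed
        show "N a \<le> ennreal (M / a\<^sup>2)" if "0 < a" for a
        proof -
          have "N a \<le> (\<integral>\<^sup>+h. indicator {h. p + a *\<^sub>R h \<in> {x. s < \<bar>f x\<bar>}} h \<partial>lborel)"
            unfolding N_def by (intro nn_integral_mono) (auto simp: indicator_def)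
          also have "\<dots> = emeasure lborel {h. p + a *\<^sub>R h \<in> {x. s < \<bar>f x\<bar>}}"
            by (rule nn_integral_indicator) measurable
          also have "\<dots> = superlevel f s / ennreal (a\<^sup>2)"
            unfolding superlevel_def by (rule emeasure_lborel_scaled_preimage) (use that in auto)
          also have "\<dots> = ennreal (M / a\<^sup>2)" using M that by (simp add: divide_ennreal)
          finally show ?thesis .
        qed
      qed measurable
      also have "\<dots> = ennreal (sqrt pi * R) * (?w s)"
        using True R M by (simp add: M_def[symmetric] ennreal_mult[symmetric] algebra_simps)
      finally show ?thesis .
    qed (simp add: indicator_def)
  qed
  also have "\<dots> = ennreal (sqrt pi * R) * (\<integral>\<^sup>+s. ?w s \<partial>lborel)"
    by (rule nn_integral_cmult) measurable
  also have "\<dots> \<le> ennreal (sqrt pi * R) * lorentz21 f"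
    by (intro mult_left_mono lorentz21_ge_layers[OF f fin]) auto
  finally show ?thesis .
qed

section \<open>Comparison of a loop with its translates\<close>

lemma nn_integral_continuous_01:
  fixes k :: "real \<Rightarrow> real"
  assumes "continuous_on {0..1} k" "\<And>t. t \<in> {0..1} \<Longrightarrow> 0 \<le> k t"
  shows "(\<integral>\<^sup>+t. indicator {0..1} t * ennreal (k t) \<partial>lborel) = ennreal (integral {0..1} k)"
  using nn_integral_has_integral_lebesgue'[OF assms(2) integrable_integral[OF integrable_continuous_real[OF assms(1)]]]
  by (simp add: mult.commute)

text \<open>The homotopy formula along the straight translation by h. It is phrased with
  \<open>nn_integral\<close> so that it can be averaged over h and rearranged by Tonelli.\<close>

lemma flux_translation:
  assumes f: "continuous_on UNIV f" and u: "loop u v"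
  shows "ennreal \<bar>flux f u v\<bar> \<le> ennreal \<bar>flux f (\<lambda>t. u t + h) v\<bar> +
    (\<integral>\<^sup>+a. \<integral>\<^sup>+t. indicator {0..1} a * (indicator {0..1} t * ennreal (\<bar>f (u t + a *\<^sub>R h)\<bar> * (norm h * norm (v t)))) \<partial>lborel \<partial>lborel)"
proof -
  define k where "k a t = \<bar>f (u t + a *\<^sub>R h)\<bar> * (norm h * norm (v t))" for a t
  have "continuous_on UNIV (\<lambda>z. k (fst z) (snd z))"
    unfolding k_def
    by (auto intro!: continuous_intros continuous_on_compose_UNIV[OF f]
        continuous_on_compose_UNIV[OF loopD(3)[OF u]] continuous_on_compose_UNIV[OF loopD(2)[OF u]])
  then have ck2: "continuous_on ({0..1} \<times> cbox 0 1) (\<lambda>(a, t). k a t)"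
    by (auto simp: case_prod_beta intro: continuous_on_subset)
  have ck1: "continuous_on {0..1} (k a)" for a
    unfolding k_def by (intro continuous_intros loopD[OF u] continuous_on_compose_UNIV[OF f])
  have cki: "continuous_on {0..1} (\<lambda>a. integral {0..1} (k a))"
    using integral_continuous_on_param[OF ck2] by simp
  have l: "loop (\<lambda>t. u t + a *\<^sub>R h) v" for a
    using loop_lincomb[OF u loop_const[of h], of a] by simp
  have "\<bar>flux f (\<lambda>t. u t + h) v - flux f u v\<bar> = \<bar>integral {0..1} (\<lambda>a. dflux f (\<lambda>t. u t + a *\<^sub>R h) v (\<lambda>t. h))\<bar>"
    using flux_homotopy[OF f u loop_const[of h]] by simp
  also have "\<dots> \<le> integral {0..1} (\<lambda>a. integral {0..1} (k a))"
    unfolding real_norm_def[symmetric]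
  proof (rule integral_norm_bound_integral)
    show "(\<lambda>a. dflux f (\<lambda>t. u t + a *\<^sub>R h) v (\<lambda>t. h)) integrable_on {0..1}"
      using continuous_on_dflux_param[OF f u loop_const[of h]] by (auto intro: integrable_continuous_real)
    show "(\<lambda>a. integral {0..1} (k a)) integrable_on {0..1}" by (rule integrable_continuous_real[OF cki])
    fix a :: real
    show "norm (dflux f (\<lambda>t. u t + a *\<^sub>R h) v (\<lambda>t. h)) \<le> integral {0..1} (k a)"
      unfolding dflux_def
    proof (rule integral_norm_bound_integral)
      show "norm (f (u t + a *\<^sub>R h) * (h \<bullet> (\<i> * v t))) \<le> k a t" for t
        unfolding k_def using norm_inner_times_i[of h "v t"] by (simp add: abs_mult mult_left_mono)
    qed (auto intro!: integrable_continuous_real ck1 dflux_continuous[OF f l])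
  qed
  finally have "\<bar>flux f u v\<bar> \<le> \<bar>flux f (\<lambda>t. u t + h) v\<bar> + integral {0..1} (\<lambda>a. integral {0..1} (k a))" by linarith
  moreover have k0: "0 \<le> k a t" for a t by (simp add: k_def)
  moreover have i0: "0 \<le> integral {0..1} (k a)" for a
    by (rule integral_nonneg) (auto intro: integrable_continuous_real ck1 k0)
  moreover have "0 \<le> integral {0..1} (\<lambda>a. integral {0..1} (k a))"
    by (rule integral_nonneg) (auto intro: integrable_continuous_real cki i0)
  ultimately have "ennreal \<bar>flux f u v\<bar> \<le> ennreal \<bar>flux f (\<lambda>t. u t + h) v\<bar> + ennreal (integral {0..1} (\<lambda>a. integral {0..1} (k a)))"
    by (simp add: ennreal_plus[symmetric] del: ennreal_plus)
  also have "ennreal (integral {0..1} (\<lambda>a. integral {0..1} (k a))) =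
     (\<integral>\<^sup>+a. indicator {0..1} a * (\<integral>\<^sup>+t. indicator {0..1} t * ennreal (k a t) \<partial>lborel) \<partial>lborel)"
    by (simp add: nn_integral_continuous_01 cki i0 ck1 k0)
  also have "\<dots> = (\<integral>\<^sup>+a. \<integral>\<^sup>+t. indicator {0..1} a * (indicator {0..1} t * ennreal (k a t)) \<partial>lborel \<partial>lborel)"
  proof (rule nn_integral_cong)
    fix a :: real
    show "indicator {0..1} a * (\<integral>\<^sup>+t. indicator {0..1} t * ennreal (k a t) \<partial>lborel)
      = (\<integral>\<^sup>+t. indicator {0..1} a * (indicator {0..1} t * ennreal (k a t)) \<partial>lborel)"
      by (cases "a \<in> {0..1}") auto
  qed
  finally show ?thesis by (simp add: k_def)
qed

lemma superlevel_finite: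
  assumes "(f \<longlongrightarrow> 0) at_infinity" "0 < s"
  shows "superlevel f s < \<infinity>"
proof -
  obtain B where B: "\<And>x. norm x \<ge> B \<Longrightarrow> \<bar>f x\<bar> < s"
    using tendstoD[OF assms] by (auto simp: eventually_at_infinity)
  have "superlevel f s \<le> emeasure lborel (ball 0 B :: complex set)"
    unfolding superlevel_def by (rule emeasure_mono) (use B in \<open>force simp: not_less[symmetric]\<close>)+
  also have "\<dots> < \<infinity>" by (rule emeasure_lborel_ball_finite)
  finally show ?thesis .
qed

text \<open>Averaging the translation homotopy over all displacements of size between R and 2R, and letting R tend to infinity,
  replaces the Newtonian potential of f.\<close>

theorem flux_lorentz_bound:
  assumes f: "continuous_on UNIV f" and lim: "(f \<longlongrightarrow> 0) at_infinity"
    and lor: "lorentz21 f \<le> ennreal C" and C: "0 \<le> C" and u: "loop u v"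
  shows "\<bar>flux f u v\<bar> \<le> 4 / (3 * sqrt pi) * C * len v"
proof -
  have [measurable]: "f \<in> borel_measurable borel" "u \<in> borel_measurable borel" "v \<in> borel_measurable borel"
    by (auto intro: borel_measurable_continuous_onI f loopD[OF u])
  have fin: "superlevel f s < \<infinity>" if "0 < s" for s by (rule superlevel_finite[OF lim that])
  have main: "\<bar>flux f u v\<bar> \<le> e * (len v)\<^sup>2 + 4 / (3 * sqrt pi) * C * len v" if e: "e > 0" for e
  proof -
    obtain B where B: "\<And>x. norm x \<ge> B \<Longrightarrow> \<bar>f x\<bar> < e"
      using tendstoD[OF lim e] by (auto simp: eventually_at_infinity)
    \<comment> \<open>If |h| >= R, the ball of radius \<open>len v\<close> about the base point of
      the translated loop lies where |f| < e.\<close>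
    define R where "R = max 1 (B + norm (u 0) + len v)"
    have R: "R > 0" "R \<ge> B + norm (u 0) + len v" by (auto simp: R_def)
    have far: "\<bar>flux f (\<lambda>t. u t + h) v\<bar> \<le> e * (len v)\<^sup>2" if "R \<le> norm h" for h
    proof (rule flux_bound_len[OF f])
      show "loop (\<lambda>t. u t + h) v" using loop_lincomb[OF u loop_const[of h], of 1] by simp
      fix x assume x: "norm (x - (u 0 + h)) \<le> len v"
      have "norm h \<le> norm x + norm (x - (u 0 + h)) + norm (u 0)"
        using norm_triangle_ineq4[of "x - (x - (u 0 + h))" "u 0"] norm_triangle_ineq4[of x "x - (u 0 + h)"] by simp
      with x R that have "norm x \<ge> B" by linarith
      then show "\<bar>f x\<bar> \<le> e" using B by (simp add: less_imp_le)
    qed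
    \<comment> \<open>\<open>norm h\<close> is replaced by its bound 2 R, so that h enters through f
      alone and W can be integrated over the full disc instead of the annulus.\<close>
    define W where "W h = (\<integral>\<^sup>+a. \<integral>\<^sup>+t. indicator {0..1} a * (indicator {0..1} t * ennreal (\<bar>f (u t + a *\<^sub>R h)\<bar> * (2 * R * norm (v t)))) \<partial>lborel \<partial>lborel)" for h
    have [measurable]: "W \<in> borel_measurable borel" unfolding W_def by measurable
    let ?W = "\<lambda>h. indicator (cball 0 (2 * R)) h * W h"
    define Ann where "Ann = cball 0 (2 * R) - ball (0::complex) R"
    have [measurable]: "Ann \<in> sets borel" "cball (0::complex) (2 * R) \<in> sets borel" by (auto simp: Ann_def)
    have area: "emeasure lborel Ann = ennreal (3 * pi * R\<^sup>2)"
    proof -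
      have "emeasure lborel Ann = emeasure lborel (cball (0::complex) (2 * R)) - emeasure lborel (ball (0::complex) R)"
        unfolding Ann_def using R by (intro emeasure_Diff) (auto simp: emeasure_ball)
      also have "\<dots> = ennreal (3 * pi * R\<^sup>2)"
        using R by (simp add: emeasure_ball emeasure_cball unit_ball_vol_2 ennreal_minus power_mult_distrib algebra_simps)
      finally show ?thesis .
    qed
    have "ennreal \<bar>flux f u v\<bar> * ennreal (3 * pi * R\<^sup>2) = (\<integral>\<^sup>+h. ennreal \<bar>flux f u v\<bar> * indicator Ann h \<partial>lborel)"
      by (simp add: nn_integral_cmult_indicator area)
    also have "\<dots> \<le> (\<integral>\<^sup>+h. ennreal (e * (len v)\<^sup>2) * indicator Ann h + ?W h \<partial>lborel)"
    proof (rule nn_integral_mono)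
      fix h :: complex
      show "ennreal \<bar>flux f u v\<bar> * indicator Ann h \<le> ennreal (e * (len v)\<^sup>2) * indicator Ann h + ?W h"
      proof (cases "h \<in> Ann")
        case True
        then have h: "R \<le> norm h" "norm h \<le> 2 * R" by (auto simp: Ann_def)
        have "ennreal \<bar>flux f u v\<bar> \<le> ennreal \<bar>flux f (\<lambda>t. u t + h) v\<bar> +
          (\<integral>\<^sup>+a. \<integral>\<^sup>+t. indicator {0..1} a * (indicator {0..1} t * ennreal (\<bar>f (u t + a *\<^sub>R h)\<bar> * (norm h * norm (v t)))) \<partial>lborel \<partial>lborel)"
          by (rule flux_translation[OF f u])
        also have "\<dots> \<le> ennreal (e * (len v)\<^sup>2) + W h"
          unfolding W_def using far[OF h(1)] h(2)
          by (intro add_mono nn_integral_mono mult_left_mono ennreal_leI mult_right_mono) auto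
        finally show ?thesis using True by (simp add: Ann_def)
      qed simp
    qed
    also have "\<dots> = ennreal (e * (len v)\<^sup>2) * ennreal (3 * pi * R\<^sup>2) + (\<integral>\<^sup>+h. ?W h \<partial>lborel)"
      by (subst nn_integral_add) (auto simp: nn_integral_cmult_indicator area)
    \<comment> \<open>One factor 2 R comes from the displacement and 2 R sqrt pi C from
      \<open>lorentz21_segment_bound\<close>. Division by the area 3 pi R^2 of the annulus cancels R
      and leaves 4 / (3 sqrt pi).\<close>
    also have "(\<integral>\<^sup>+h. ?W h \<partial>lborel) \<le> ennreal (4 * R\<^sup>2 * sqrt pi * C * len v)"
    proof -
      let ?K = "\<lambda>t a h. indicator {0..1::real} t * ennreal (2 * R * norm (v t)) * (indicator {0..1} a * (indicator (cball 0 (2 * R)) h * ennreal \<bar>f (u t + a *\<^sub>R h)\<bar>))"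
      have "(\<integral>\<^sup>+h. ?W h \<partial>lborel) = (\<integral>\<^sup>+h. \<integral>\<^sup>+a. \<integral>\<^sup>+t. ?K t a h \<partial>lborel \<partial>lborel \<partial>lborel)"
      proof (rule nn_integral_cong)
        fix h :: complex
        have "?W h = (\<integral>\<^sup>+a. \<integral>\<^sup>+t. indicator (cball 0 (2 * R)) h * (indicator {0..1} a * (indicator {0..1} t * ennreal (\<bar>f (u t + a *\<^sub>R h)\<bar> * (2 * R * norm (v t))))) \<partial>lborel \<partial>lborel)"
          unfolding W_def by (cases "h \<in> cball 0 (2 * R)") auto
        also have "\<dots> = (\<integral>\<^sup>+a. \<integral>\<^sup>+t. ?K t a h \<partial>lborel \<partial>lborel)"
          using R by (intro nn_integral_cong) (simp add: ennreal_mult' mult_ac)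
        finally show "?W h = (\<integral>\<^sup>+a. \<integral>\<^sup>+t. ?K t a h \<partial>lborel \<partial>lborel)" .
      qed
      also have "\<dots> = (\<integral>\<^sup>+h. \<integral>\<^sup>+t. \<integral>\<^sup>+a. ?K t a h \<partial>lborel \<partial>lborel \<partial>lborel)"
        by (intro nn_integral_cong lborel_pair.Fubini') measurable
      also have "\<dots> = (\<integral>\<^sup>+t. \<integral>\<^sup>+h. \<integral>\<^sup>+a. ?K t a h \<partial>lborel \<partial>lborel \<partial>lborel)"
        by (rule lborel_pair.Fubini') measurable
      also have "\<dots> = (\<integral>\<^sup>+t. \<integral>\<^sup>+a. \<integral>\<^sup>+h. ?K t a h \<partial>lborel \<partial>lborel \<partial>lborel)"
        by (intro nn_integral_cong lborel_pair.Fubini') measurable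
      also have "\<dots> \<le> (\<integral>\<^sup>+t. ennreal (4 * R\<^sup>2 * sqrt pi * C) * (indicator {0..1} t * ennreal (norm (v t))) \<partial>lborel)"
      proof (rule nn_integral_mono)
        fix t :: real
        have "(\<integral>\<^sup>+a. \<integral>\<^sup>+h. ?K t a h \<partial>lborel \<partial>lborel) = indicator {0..1} t * ennreal (2 * R * norm (v t)) *
            (\<integral>\<^sup>+a. \<integral>\<^sup>+h. indicator {0..1} a * (indicator (cball 0 (2 * R)) h * ennreal \<bar>f (u t + a *\<^sub>R h)\<bar>) \<partial>lborel \<partial>lborel)"
          by (simp add: nn_integral_cmult)
        also have "\<dots> \<le> indicator {0..1} t * ennreal (2 * R * norm (v t)) * (ennreal (sqrt pi * (2 * R)) * ennreal C)"
          using R by (intro mult_left_mono order_trans[OF lorentz21_segment_bound[OF _ fin] mult_left_mono[OF lor]]) auto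
        also have "\<dots> = ennreal (4 * R\<^sup>2 * sqrt pi * C) * (indicator {0..1} t * ennreal (norm (v t)))"
          using R C by (cases "t \<in> {0..1}") (auto simp: ennreal_mult[symmetric] power2_eq_square mult_ac)
        finally show "(\<integral>\<^sup>+a. \<integral>\<^sup>+h. ?K t a h \<partial>lborel \<partial>lborel) \<le> ennreal (4 * R\<^sup>2 * sqrt pi * C) * (indicator {0..1} t * ennreal (norm (v t)))" .
      qed
      also have "\<dots> = ennreal (4 * R\<^sup>2 * sqrt pi * C) * ennreal (len v)"
      proof -
        have "(\<integral>\<^sup>+t. indicator {0..1} t * ennreal (norm (v t)) \<partial>lborel) = ennreal (len v)"
          unfolding len_def by (rule nn_integral_continuous_01) (auto intro!: continuous_intros loopD[OF u])
        then show ?thesis by (subst nn_integral_cmult) auto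
      qed
      also have "\<dots> = ennreal (4 * R\<^sup>2 * sqrt pi * C * len v)"
        using C len_nonneg by (simp add: ennreal_mult[symmetric])
      finally show ?thesis .
    qed
    finally have "ennreal (\<bar>flux f u v\<bar> * (3 * pi * R\<^sup>2)) \<le> ennreal (e * (len v)\<^sup>2 * (3 * pi * R\<^sup>2) + 4 * R\<^sup>2 * sqrt pi * C * len v)"
      using e C len_nonneg[of v] by (simp add: ennreal_mult[symmetric] ennreal_plus[symmetric] add_left_mono del: ennreal_plus)
    then have "\<bar>flux f u v\<bar> * (3 * pi * R\<^sup>2) \<le> e * (len v)\<^sup>2 * (3 * pi * R\<^sup>2) + 4 * R\<^sup>2 * sqrt pi * C * len v"
      using e C len_nonneg[of v] by (subst (asm) ennreal_le_iff) auto
    also have "\<dots> = (e * (len v)\<^sup>2 + 4 / (3 * sqrt pi) * C * len v) * (3 * pi * R\<^sup>2)"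
    proof -
      have "4 / (3 * sqrt pi) * (3 * pi) = 4 * sqrt pi"
        by (simp add: field_simps)
      moreover have "4 / (3 * sqrt pi) * C * len v * (3 * pi * R\<^sup>2) = (4 / (3 * sqrt pi) * (3 * pi)) * (C * len v * R\<^sup>2)"
        by (simp only: mult_ac)
      ultimately have "4 / (3 * sqrt pi) * C * len v * (3 * pi * R\<^sup>2) = 4 * sqrt pi * (C * len v * R\<^sup>2)"
        by (simp only:)
      then show ?thesis unfolding distrib_right[of "e * (len v)\<^sup>2"] by (simp only: mult_ac)
    qed
    finally show ?thesis using R by simp
  qed
  show ?thesis
  proof (rule field_le_epsilon)
    fix e :: real assume e: "e > 0"
    have "\<bar>flux f u v\<bar> \<le> e / ((len v)\<^sup>2 + 1) * (len v)\<^sup>2 + 4 / (3 * sqrt pi) * C * len v"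
      by (rule main) (use e in \<open>simp add: add_nonneg_pos\<close>)
    also have "e / ((len v)\<^sup>2 + 1) * (len v)\<^sup>2 \<le> e"
      using e by (simp add: divide_le_eq add_nonneg_pos mult_left_mono)
    finally show "\<bar>flux f u v\<bar> \<le> 4 / (3 * sqrt pi) * C * len v + e" by simp
  qed
qed

text \<open>The product of 4 / (3 sqrt pi) and (2 / pi)^(3/2) is 8 sqrt 2 / (3 pi^2), which sqrt 2
  <= 3/2 and pi > 3 bring below 4/9.\<close>

lemma flux_lorentz_half:
  assumes f: "continuous_on UNIV f" and lim: "(f \<longlongrightarrow> 0) at_infinity"
    and lor: "lorentz21 f < ennreal ((2 / pi) powr (3/2))" and u: "loop u v"
  shows "\<bar>flux f u v\<bar> \<le> len v / 2"
proof -
  have "(2 / pi) powr (3/2) = (2 / pi) powr 1 * (2 / pi) powr (1/2)"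
    by (subst powr_add[symmetric]) simp
  then have eq: "(2 / pi) powr (3/2) = 2 / pi * (sqrt 2 / sqrt pi)"
    by (simp add: powr_half_sqrt real_sqrt_divide)
  have "4 / (3 * sqrt pi) * (2 / pi * (sqrt 2 / sqrt pi)) = 8 * sqrt 2 / (3 * pi\<^sup>2)"
    by (simp add: power2_eq_square field_simps)
  also have "\<dots> \<le> 8 * (3/2) / (3 * 3\<^sup>2)"
  proof (rule frac_le)
    have "sqrt 2 \<le> 3/2" by (rule real_le_lsqrt) (auto simp: power2_eq_square)
    then show "8 * sqrt 2 \<le> 8 * (3/2)" by simp
    have "(3::real)\<^sup>2 \<le> pi\<^sup>2" using pi_gt3 by (intro power_mono) auto
    then show "3 * 3\<^sup>2 \<le> 3 * pi\<^sup>2" by simp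
  qed auto
  also have "\<dots> \<le> 1/2" by simp
  finally have "4 / (3 * sqrt pi) * (2 / pi) powr (3/2) * len v \<le> 1/2 * len v"
    unfolding eq by (rule mult_right_mono[OF _ len_nonneg])
  with flux_lorentz_bound[OF f lim less_imp_le[OF lor] _ u] show ?thesis by simp
qed

section \<open>Trigonometric polynomials\<close>

definition ee :: "int \<Rightarrow> real \<Rightarrow> complex" where
  "ee k t = cis (2 * pi * of_int k * t)"

abbreviation modes :: "nat \<Rightarrow> int set" where
  "modes n \<equiv> {- int n..int n}"

text \<open>Coefficients are total functions on the integers and only those in
  \<open>modes n\<close> matter, so one coefficient function, such as that of a circle, serves every
  degree.\<close>

definition tp :: "nat \<Rightarrow> (int \<Rightarrow> complex) \<Rightarrow> real \<Rightarrow> complex" where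
  "tp n c t = (\<Sum>k\<in>modes n. c k * ee k t)"

text \<open>The Fourier multiplier of d/dt; velocities are written \<open>tp n (dc c)\<close>
  throughout.\<close>

definition dc :: "(int \<Rightarrow> complex) \<Rightarrow> int \<Rightarrow> complex" where
  "dc c k = 2 * pi * \<i> * of_int k * c k"

lemma norm_ee [simp]: "norm (ee k t) = 1" by (simp add: ee_def)

lemma ee_0 [simp]: "ee 0 t = 1" by (simp add: ee_def)

lemma ee_add: "ee (k + l) t = ee k t * ee l t"
  by (simp add: ee_def cis_mult algebra_simps)

lemma ee_minus: "ee (- k) t = cnj (ee k t)"
  by (simp add: ee_def cis_cnj)

lemma ee_int: "ee k (of_int m) = 1"
proof -
  have "2 * pi * of_int k * of_int m = 2 * pi * of_int (k * m)" by simp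
  then show ?thesis unfolding ee_def by (simp only:) (metis cis_multiple_2pi Ints_of_int)
qed

lemma ee_plus_int: "ee k (t + of_int m) = ee k t"
proof -
  have "ee k (t + of_int m) = ee k t * ee k (of_int m)"
    by (simp add: ee_def cis_mult algebra_simps)
  then show ?thesis by (simp add: ee_int)
qed

lemma ee_has_vector_derivative: "(ee k has_vector_derivative 2 * pi * \<i> * of_int k * ee k t) (at t within S)"
proof -
  have "((\<lambda>z. exp (2 * pi * \<i> * of_int k * z)) has_field_derivative 2 * pi * \<i> * of_int k * exp (2 * pi * \<i> * of_int k * of_real t)) (at (of_real t))"
    by (auto intro!: derivative_eq_intros)
  from has_vector_derivative_real_field[OF this, of S] show ?thesis
    by (simp add: ee_def[abs_def] cis_conv_exp mult_ac)
qed

lemma continuous_on_ee [continuous_intros]: "continuous_on S (ee k)"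
  unfolding ee_def[abs_def] by (intro continuous_intros)

lemma tp_add_scale: "tp n (\<lambda>k. a k + s *\<^sub>R b k) t = tp n a t + s *\<^sub>R tp n b t"
  by (simp add: tp_def distrib_right sum.distrib scaleR_sum_right)

lemma tp_scale: "tp n (\<lambda>k. s *\<^sub>R b k) t = s *\<^sub>R tp n b t"
  by (simp add: tp_def scaleR_sum_right)

lemma tp_mult: "tp n (\<lambda>k. z * b k) t = z * tp n b t"
  by (simp add: tp_def sum_distrib_left mult.assoc)

lemma dc_add_scale: "dc (\<lambda>k. a k + s *\<^sub>R b k) = (\<lambda>k. dc a k + s *\<^sub>R dc b k)"
  by (auto simp: dc_def algebra_simps)

lemma dc_scale: "dc (\<lambda>k. s *\<^sub>R b k) = (\<lambda>k. s *\<^sub>R dc b k)"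
  by (auto simp: dc_def)

lemma tp_has_vector_derivative: "(tp n c has_vector_derivative tp n (dc c) t) (at t within S)"
proof -
  have "((\<lambda>t. \<Sum>k\<in>modes n. c k * ee k t) has_vector_derivative (\<Sum>k\<in>modes n. c k * (2 * pi * \<i> * of_int k * ee k t))) (at t within S)"
    by (intro has_vector_derivative_sum has_vector_derivative_mult_right ee_has_vector_derivative)
  then show ?thesis by (simp add: tp_def[abs_def] dc_def mult_ac)
qed

lemma continuous_on_tp: "continuous_on S (tp n c)"
  unfolding tp_def[abs_def] by (intro continuous_intros)

lemma tp_plus_int: "tp n c (t + of_int m) = tp n c t"
  by (simp add: tp_def ee_plus_int)

lemma loop_tp: "loop (tp n c) (tp n (dc c))"
  using tp_plus_int[of n c 0 1] by (simp add: loop_def tp_has_vector_derivative continuous_on_tp)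

lemma norm_tp_le: "norm (tp n c t) \<le> (\<Sum>k\<in>modes n. norm (c k))"
  unfolding tp_def by (rule order_trans[OF norm_sum]) (simp add: norm_mult)

lemma ee_has_integral: "(ee k has_integral (if k = 0 then 1 else 0)) {0..1}"
proof (cases "k = 0")
  case True
  then have "ee k = (\<lambda>t. 1)" by auto
  then show ?thesis using True has_integral_const_real[of "1::complex" 0 1] by simp
next
  case False
  define z where "z = 2 * pi * \<i> * of_int k"
  have z: "z \<noteq> 0" using False by (simp add: z_def)
  have "((\<lambda>t. z * ee k t) has_integral (ee k 1 - ee k 0)) {0..1}"
    unfolding z_def by (rule fundamental_theorem_of_calculus) (simp_all only: ee_has_vector_derivative zero_le_one)
  then have "((\<lambda>t. z * ee k t) has_integral 0) {0..1}"
    using ee_int[of k 1] ee_int[of k 0] by simp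
  from has_integral_mult_right[OF this, of "inverse z"] show ?thesis
    using False z by (simp add: mult.assoc[symmetric])
qed

theorem parseval_tp:
  "((\<lambda>t. tp n c t \<bullet> tp n d t) has_integral (\<Sum>k\<in>modes n. c k \<bullet> d k)) {0..1}"
proof -
  let ?I = "modes n"
  have eq: "tp n c t \<bullet> tp n d t = (\<Sum>k\<in>?I. \<Sum>l\<in>?I. Re (c k * cnj (d l) * ee (k - l) t))" for t
  proof -
    have "tp n c t \<bullet> tp n d t = Re (tp n c t * cnj (tp n d t))" by (simp add: inner_complex_def)
    also have "tp n c t * cnj (tp n d t) = (\<Sum>k\<in>?I. \<Sum>l\<in>?I. c k * cnj (d l) * ee (k - l) t)"
      unfolding tp_def cnj_sum sum_product
      by (intro sum.cong refl) (simp add: ee_add[of _ "- _", simplified] ee_minus mult_ac)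
    finally show ?thesis by simp
  qed
  have "((\<lambda>t. \<Sum>k\<in>?I. \<Sum>l\<in>?I. Re (c k * cnj (d l) * ee (k - l) t)) has_integral
      (\<Sum>k\<in>?I. \<Sum>l\<in>?I. Re (c k * cnj (d l) * (if k - l = 0 then 1 else 0)))) {0..1}"
    by (intro has_integral_sum finite_atLeastAtMost_int has_integral_Re has_integral_mult_right ee_has_integral)
  also have "(\<Sum>k\<in>?I. \<Sum>l\<in>?I. Re (c k * cnj (d l) * (if k - l = 0 then 1 else 0))) = (\<Sum>k\<in>?I. c k \<bullet> d k)"
  proof (rule sum.cong[OF refl])
    fix k assume k: "k \<in> ?I"
    have "(\<Sum>l\<in>?I. Re (c k * cnj (d l) * (if k - l = 0 then 1 else 0))) = (\<Sum>l\<in>?I. if k = l then Re (c k * cnj (d l)) else 0)"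
      by (rule sum.cong) auto
    also have "\<dots> = c k \<bullet> d k" using k by (simp add: inner_complex_def)
    finally show "(\<Sum>l\<in>?I. Re (c k * cnj (d l) * (if k - l = 0 then 1 else 0))) = c k \<bullet> d k" .
  qed
  finally show ?thesis unfolding eq .
qed

section \<open>Energy and area as quadratic forms in the coefficients\<close>

definition energy :: "nat \<Rightarrow> (int \<Rightarrow> complex) \<Rightarrow> real" where
  "energy n c = (\<Sum>k\<in>modes n. (norm (dc c k))\<^sup>2)"

definition bienergy :: "nat \<Rightarrow> (int \<Rightarrow> complex) \<Rightarrow> (int \<Rightarrow> complex) \<Rightarrow> real" where
  "bienergy n c d = (\<Sum>k\<in>modes n. dc c k \<bullet> dc d k)"

definition tarea :: "nat \<Rightarrow> (int \<Rightarrow> complex) \<Rightarrow> real" where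
  "tarea n c = - pi * (\<Sum>k\<in>modes n. of_int k * (norm (c k))\<^sup>2)"

text \<open>The first variation of \<open>tarea\<close> at c in the direction d, as
  \<open>tarea_add_scale\<close> shows; it becomes the multiplier term of the Euler-Lagrange
  equation.\<close>

definition biarea :: "nat \<Rightarrow> (int \<Rightarrow> complex) \<Rightarrow> (int \<Rightarrow> complex) \<Rightarrow> real" where
  "biarea n c d = (\<Sum>k\<in>modes n. d k \<bullet> (\<i> * dc c k))"

lemma inner_i_dc: "d k \<bullet> (\<i> * dc c k) = - (2 * pi * of_int k) * (c k \<bullet> d k)"
  by (simp add: dc_def inner_complex_def algebra_simps)

lemma biarea_self: "biarea n c c = 2 * tarea n c"
  unfolding biarea_def tarea_def inner_i_dc
  by (simp add: sum_distrib_left power2_norm_eq_inner mult_ac sum_negf)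

lemma biarea_integral: "((\<lambda>t. tp n d t \<bullet> (\<i> * tp n (dc c) t)) has_integral biarea n c d) {0..1}"
  using parseval_tp[of n d "\<lambda>k. \<i> * dc c k"] unfolding biarea_def tp_mult .

lemma bienergy_integral: "((\<lambda>t. tp n (dc c) t \<bullet> tp n (dc d) t) has_integral bienergy n c d) {0..1}"
  unfolding bienergy_def by (rule parseval_tp)

lemma energy_eq_bienergy: "energy n c = bienergy n c c"
  by (simp add: energy_def bienergy_def power2_norm_eq_inner)

lemma energy_integral: "((\<lambda>t. (norm (tp n (dc c) t))\<^sup>2) has_integral energy n c) {0..1}"
  unfolding energy_eq_bienergy power2_norm_eq_inner by (rule bienergy_integral)

lemma energy_nonneg: "0 \<le> energy n c"
  by (simp add: energy_def sum_nonneg)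

lemma norm_add_scale_sq: "(norm (a + s *\<^sub>R b))\<^sup>2 = (norm a)\<^sup>2 + 2 * s * (a \<bullet> b) + s\<^sup>2 * (norm b)\<^sup>2" for a b :: complex
  unfolding cmod_power2 inner_complex_def by (simp add: power2_eq_square algebra_simps)

lemma energy_add_scale: "energy n (\<lambda>k. c k + s *\<^sub>R d k) = energy n c + 2 * s * bienergy n c d + s\<^sup>2 * energy n d"
  unfolding energy_def bienergy_def dc_add_scale sum_distrib_left sum.distrib[symmetric]
  by (intro sum.cong refl) (simp add: norm_add_scale_sq algebra_simps)

lemma tarea_add_scale: "tarea n (\<lambda>k. c k + s *\<^sub>R d k) = tarea n c + s * biarea n c d + s\<^sup>2 * tarea n d"
  unfolding tarea_def biarea_def inner_i_dc sum_distrib_left sum.distrib[symmetric]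
  by (intro sum.cong refl) (simp add: norm_add_scale_sq algebra_simps)

lemma energy_scale: "energy n (\<lambda>k. s *\<^sub>R c k) = s\<^sup>2 * energy n c"
  by (simp add: energy_def dc_scale sum_distrib_left power_mult_distrib)

lemma tarea_scale: "tarea n (\<lambda>k. s *\<^sub>R c k) = s\<^sup>2 * tarea n c"
  by (simp add: tarea_def sum_distrib_left power_mult_distrib mult_ac)

text \<open>Hurwitz's argument: in coefficients the inequality reduces to |k| <= k^2 for each
  integer mode k.\<close>

lemma isoperimetric_tp: "4 * pi * \<bar>tarea n c\<bar> \<le> energy n c"
proof -
  have "\<bar>tarea n c\<bar> \<le> pi * (\<Sum>k\<in>modes n. \<bar>of_int k * (norm (c k))\<^sup>2\<bar>)"
  proof -
    have "\<bar>tarea n c\<bar> = pi * \<bar>\<Sum>k\<in>modes n. of_int k * (norm (c k))\<^sup>2\<bar>"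
      by (simp add: tarea_def abs_mult)
    also have "\<dots> \<le> pi * (\<Sum>k\<in>modes n. \<bar>of_int k * (norm (c k))\<^sup>2\<bar>)"
      by (rule mult_left_mono[OF sum_abs]) simp
    finally show ?thesis .
  qed
  then have "4 * pi * \<bar>tarea n c\<bar> \<le> 4 * pi * (pi * (\<Sum>k\<in>modes n. \<bar>of_int k * (norm (c k))\<^sup>2\<bar>))"
    by (intro mult_left_mono) auto
  also have "\<dots> = (\<Sum>k\<in>modes n. 4 * pi\<^sup>2 * (of_int \<bar>k\<bar> * (norm (c k))\<^sup>2))"
    by (simp add: sum_distrib_left abs_mult power2_eq_square mult_ac)
  also have "\<dots> \<le> energy n c"
    unfolding energy_def
  proof (rule sum_mono)
    fix k :: int
    have "\<bar>k\<bar> * 1 \<le> \<bar>k\<bar> * \<bar>k\<bar>"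
      by (cases "k = 0") (simp, intro mult_left_mono, auto)
    then have "\<bar>k\<bar> \<le> k\<^sup>2" by (simp add: power2_eq_square)
    then have "of_int \<bar>k\<bar> \<le> (of_int k :: real)\<^sup>2" by (metis of_int_le_iff of_int_power)
    then have "4 * pi\<^sup>2 * (of_int \<bar>k\<bar> * (norm (c k))\<^sup>2) \<le> 4 * pi\<^sup>2 * ((of_int k)\<^sup>2 * (norm (c k))\<^sup>2)"
      by (intro mult_left_mono mult_right_mono) auto
    then show "4 * pi\<^sup>2 * (of_int \<bar>k\<bar> * (norm (c k))\<^sup>2) \<le> (norm (dc c k))\<^sup>2"
      by (simp add: dc_def norm_mult power_mult_distrib mult.assoc)
  qed
  finally show ?thesis .
qed

lemma integral_norm_Cauchy_Schwarz:
  fixes g :: "real \<Rightarrow> complex"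
  assumes "continuous_on {a..b} g" "a \<le> b"
  shows "(integral {a..b} (\<lambda>t. norm (g t)))\<^sup>2 \<le> (b - a) * integral {a..b} (\<lambda>t. (norm (g t))\<^sup>2)"
proof (cases "a = b")
  case False
  with assms have ab: "a < b" by simp
  define I where "I = integral {a..b} (\<lambda>t. norm (g t))"
  \<comment> \<open>m is the mean of |g|; the claim amounts to the nonnegativity of the variance of
    |g|.\<close>
  define m where "m = I / (b - a)"
  have I: "((\<lambda>t. norm (g t)) has_integral I) {a..b}"
    unfolding I_def by (intro integrable_integral integrable_continuous_real continuous_intros assms)
  have I2: "((\<lambda>t. (norm (g t))\<^sup>2) has_integral integral {a..b} (\<lambda>t. (norm (g t))\<^sup>2)) {a..b}"
    by (intro integrable_integral integrable_continuous_real continuous_intros assms)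
  have "((\<lambda>t. (norm (g t))\<^sup>2 - 2 * m * norm (g t) + m\<^sup>2) has_integral
      (integral {a..b} (\<lambda>t. (norm (g t))\<^sup>2) - 2 * m * I + (b - a) *\<^sub>R m\<^sup>2)) {a..b}"
    using has_integral_const_real[of "m\<^sup>2" a b] ab
    by (intro has_integral_add has_integral_diff I2 has_integral_mult_right I) auto
  moreover have "0 \<le> (norm (g t))\<^sup>2 - 2 * m * norm (g t) + m\<^sup>2" for t
    using zero_le_power2[of "norm (g t) - m"] by (simp add: power2_diff mult_ac)
  ultimately have "0 \<le> integral {a..b} (\<lambda>t. (norm (g t))\<^sup>2) - 2 * m * I + (b - a) * m\<^sup>2"
    by (auto dest!: has_integral_nonneg)
  moreover have Im: "I = m * (b - a)" using ab by (simp add: m_def)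
  ultimately have "m\<^sup>2 * (b - a) \<le> integral {a..b} (\<lambda>t. (norm (g t))\<^sup>2)"
    by (simp add: power2_eq_square algebra_simps)
  then have "(b - a) * (m\<^sup>2 * (b - a)) \<le> (b - a) * integral {a..b} (\<lambda>t. (norm (g t))\<^sup>2)"
    using ab by (intro mult_left_mono) auto
  moreover have "(b - a) * (m\<^sup>2 * (b - a)) = I\<^sup>2" by (simp add: Im power2_eq_square mult_ac)
  ultimately show ?thesis by (simp add: I_def)
qed simp

text \<open>Links the length, which controls the flux, to the energy, which is minimised; equality
  holds at constant speed.\<close>

lemma len_tp_le: "len (tp n (dc c)) \<le> sqrt (energy n c)"
  using integral_norm_Cauchy_Schwarz[of 0 1 "tp n (dc c)"] integral_unique[OF energy_integral[of n c]]
  by (intro real_le_rsqrt) (simp add: len_def continuous_on_tp)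

text \<open>With the convention of the area functional, counterclockwise circles have negative area.\<close>

lemma circle_tp:
  assumes "n \<ge> 1" "s = 1 \<or> s = - 1"
    and c_def: "c = (\<lambda>k::int. if k = 0 then q else if k = s then complex_of_real r else 0)"
  shows "tp n c = (\<lambda>t. q + r * ee s t)" "tp n (dc c) = (\<lambda>t. 2 * pi * \<i> * of_int s * r * ee s t)"
    "energy n c = (2 * pi * r)\<^sup>2" "tarea n c = - pi * of_int s * r\<^sup>2"
proof -
  have sum: "(\<Sum>k\<in>modes n. F k) = F 0 + F s" if "\<And>k. k \<noteq> 0 \<Longrightarrow> k \<noteq> s \<Longrightarrow> F k = 0" for F :: "int \<Rightarrow> 'a::ab_group_add"
  proof -
    have "(\<Sum>k\<in>modes n. F k) = sum F {0, s}"
      by (rule sum.mono_neutral_right) (use assms that in auto)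
    also have "\<dots> = F 0 + F s" using assms by (subst sum.insert) auto
    finally show ?thesis .
  qed
  have s: "s \<noteq> 0" "(of_int s :: real)\<^sup>2 = 1" using assms by auto
  show "tp n c = (\<lambda>t. q + r * ee s t)"
    unfolding tp_def[abs_def] by (subst sum) (use s in \<open>auto simp: c_def\<close>)
  show "tp n (dc c) = (\<lambda>t. 2 * pi * \<i> * of_int s * r * ee s t)"
    unfolding tp_def[abs_def] by (subst sum) (use s in \<open>auto simp: c_def dc_def\<close>)
  show "energy n c = (2 * pi * r)\<^sup>2"
    unfolding energy_def by (subst sum) (use s in \<open>auto simp: c_def dc_def norm_mult power_mult_distrib\<close>)
  show "tarea n c = - pi * of_int s * r\<^sup>2"
    unfolding tarea_def by (subst sum) (use s in \<open>auto simp: c_def\<close>)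
qed

text \<open>Contraction of the circle to its centre: at scale a the integrand of
  \<open>dflux\<close> is -2 pi r^2 a s f, and integrating a over [0,1] contributes 1/2.\<close>

lemma flux_circle_le:
  assumes f: "continuous_on UNIV f" and s: "s = 1 \<or> s = - 1" and r: "r > 0" and m: "m \<ge> 0"
    and sgn: "\<And>x. x \<in> cball q r \<Longrightarrow> m \<le> of_int s * f x"
  shows "flux f (\<lambda>t. q + r * ee s t) (\<lambda>t. 2 * pi * \<i> * of_int s * r * ee s t) \<le> - (pi * r\<^sup>2 * m)"
proof -
  define u where "u = (\<lambda>t. q + complex_of_real r * ee s t)"
  define v where "v = (\<lambda>t. 2 * pi * \<i> * of_int s * complex_of_real r * ee s t)"
  have u: "loop u v" using loop_tp circle_tp(1,2)[OF le_refl s refl, of q r] unfolding u_def v_def by metis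
  have lp: "loop (\<lambda>t. q + a *\<^sub>R (u t - q)) (\<lambda>t. a *\<^sub>R v t)" for a
    using loop_lincomb[OF loop_const loop_diff_const[OF u]] by simp
  let ?d = "\<lambda>a. dflux f (\<lambda>t. q + a *\<^sub>R (u t - q)) (\<lambda>t. a *\<^sub>R v t) (\<lambda>t. u t - q)"
  have "flux f u v = integral {0..1} (\<lambda>a. ?d a)"
    by (rule flux_cone[OF f u])
  also have "\<dots> \<le> integral {0..1} (\<lambda>a. (- (2 * pi * r\<^sup>2 * m)) * a)"
  proof (rule integral_le)
    show "(\<lambda>a. ?d a) integrable_on {0..1}"
      using continuous_on_dflux_param[OF f loop_const[of q] loop_diff_const[OF u, of q], of "{0..1}"]
      by (intro integrable_continuous_real) simp
    show "(\<lambda>a. (- (2 * pi * r\<^sup>2 * m)) * a) integrable_on {0..1}"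
      by (intro integrable_continuous_real continuous_intros)
    fix a :: real assume a: "a \<in> {0..1}"
    have "?d a \<le> integral {0..1} (\<lambda>t::real. (- (2 * pi * r\<^sup>2 * m)) * a)"
      unfolding dflux_def
    proof (rule integral_le)
      show "(\<lambda>t. f (q + a *\<^sub>R (u t - q)) * ((u t - q) \<bullet> (\<i> * a *\<^sub>R v t))) integrable_on {0..1}"
        by (intro integrable_continuous_real dflux_continuous[OF f lp] continuous_intros loopD[OF u])
      fix t :: real
      have ip: "(u t - q) \<bullet> (\<i> * a *\<^sub>R v t) = - (2 * pi * r\<^sup>2 * a * of_int s)"
      proof -
        have "(u t - q) \<bullet> (\<i> * a *\<^sub>R v t) = - (2 * pi * r\<^sup>2 * a * of_int s) * (ee s t \<bullet> ee s t)"
          by (simp add: u_def v_def inner_complex_def power2_eq_square algebra_simps)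
        then show ?thesis by (simp add: power2_norm_eq_inner[symmetric])
      qed
      have "norm (q - (q + a *\<^sub>R (u t - q))) \<le> r"
        using a r mult_mono[of a 1 r r] by (simp add: u_def norm_mult)
      then have "m \<le> of_int s * f (q + a *\<^sub>R (u t - q))" by (intro sgn) (simp add: dist_norm)
      then have "2 * pi * r\<^sup>2 * a * m \<le> 2 * pi * r\<^sup>2 * a * (of_int s * f (q + a *\<^sub>R (u t - q)))"
        using a by (intro mult_left_mono) auto
      then show "f (q + a *\<^sub>R (u t - q)) * ((u t - q) \<bullet> (\<i> * a *\<^sub>R v t)) \<le> (- (2 * pi * r\<^sup>2 * m)) * a"
        unfolding ip by (simp add: mult_ac)
    qed auto
    then show "?d a \<le> (- (2 * pi * r\<^sup>2 * m)) * a"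
      by simp
  qed
  also have "\<dots> = - (pi * r\<^sup>2 * m)"
    using ident_has_integral[of 0 "1::real"] by (simp add: integral_unique)
  finally show ?thesis unfolding u_def v_def .
qed

section \<open>Minimisers among trigonometric polynomials\<close>

lemma integral_tendsto_bounded:
  fixes g :: "nat \<Rightarrow> real \<Rightarrow> real"
  assumes "\<And>j. continuous_on {0..1} (g j)" "\<And>j t. t \<in> {0..1} \<Longrightarrow> \<bar>g j t\<bar> \<le> B"
    "\<And>t. t \<in> {0..1} \<Longrightarrow> (\<lambda>j. g j t) \<longlonglongrightarrow> h t"
  shows "(\<lambda>j. integral {0..1} (g j)) \<longlonglongrightarrow> integral {0..1} h"
  by (rule dominated_convergence(2)[where h="\<lambda>t. B"])
     (use assms in \<open>auto intro: integrable_continuous_real\<close>)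

lemma continuous_bounded_on_cball:
  fixes f :: "complex \<Rightarrow> real"
  assumes "continuous_on UNIV f"
  obtains M where "M \<ge> 0" "\<And>p. norm p \<le> B \<Longrightarrow> \<bar>f p\<bar> \<le> M"
proof -
  have "bounded (f ` cball 0 B)"
    by (intro compact_imp_bounded compact_continuous_image continuous_on_subset[OF assms]) auto
  then obtain M where "M > 0" "\<forall>x\<in>f ` cball 0 B. norm x \<le> M" by (auto simp: bounded_pos)
  then show ?thesis by (intro that[of M]) auto
qed

lemma tendsto_compose_continuous:
  assumes "continuous_on UNIV f" "x \<longlonglongrightarrow> l"
  shows "(\<lambda>j. f (x j)) \<longlonglongrightarrow> f l"
  using continuous_on_tendsto_compose[OF assms] by simp

lemma flux_tendsto:
  assumes f: "continuous_on UNIV f"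
    and c: "\<And>j. continuous_on {0..1} (u j)" "\<And>j. continuous_on {0..1} (v j)"
    and B: "\<And>j t. t \<in> {0..1} \<Longrightarrow> norm (u j t) \<le> B" "\<And>j t. t \<in> {0..1} \<Longrightarrow> norm (v j t) \<le> B"
    and lim: "\<And>t. t \<in> {0..1} \<Longrightarrow> (\<lambda>j. u j t) \<longlonglongrightarrow> u' t" "\<And>t. t \<in> {0..1} \<Longrightarrow> (\<lambda>j. v j t) \<longlonglongrightarrow> v' t"
  shows "(\<lambda>j. flux f (u j) (v j)) \<longlonglongrightarrow> flux f u' v'"
proof -
  obtain M where M: "M \<ge> 0" "\<And>p. norm p \<le> B \<Longrightarrow> \<bar>f p\<bar> \<le> M"
    using continuous_bounded_on_cball[OF f] by blast
  have "(\<lambda>j. integral {0..1} (\<lambda>t. hprim f (u j t) * Im (v j t))) \<longlonglongrightarrow> integral {0..1} (\<lambda>t. hprim f (u' t) * Im (v' t))"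
  proof (rule integral_tendsto_bounded)
    show "continuous_on {0..1} (\<lambda>t. hprim f (u j t) * Im (v j t))" for j
      by (intro continuous_intros continuous_on_compose_UNIV[OF continuous_on_hprim[OF f]] c)
    show "\<bar>hprim f (u j t) * Im (v j t)\<bar> \<le> (B * M) * B" if "t \<in> {0..1}" for j t
      unfolding abs_mult using hprim_bound[OF f M(2), of B "u j t"] B(1,2)[OF that, of j] abs_Im_le_cmod[of "v j t"]
      by (intro mult_mono) auto
    show "(\<lambda>j. hprim f (u j t) * Im (v j t)) \<longlonglongrightarrow> hprim f (u' t) * Im (v' t)" if "t \<in> {0..1}" for t
      by (intro tendsto_intros tendsto_compose_continuous[OF continuous_on_hprim[OF f]] lim that)
  qed
  then show ?thesis unfolding flux_def by (rule tendsto_minus)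
qed

lemma dflux_tendsto:
  assumes f: "continuous_on UNIV f"
    and c: "\<And>j. continuous_on {0..1} (u j)" "\<And>j. continuous_on {0..1} (v j)" "\<And>j. continuous_on {0..1} (\<phi> j)"
    and B: "\<And>j t. t \<in> {0..1} \<Longrightarrow> norm (u j t) \<le> B" "\<And>j t. t \<in> {0..1} \<Longrightarrow> norm (v j t) \<le> B"
      "\<And>j t. t \<in> {0..1} \<Longrightarrow> norm (\<phi> j t) \<le> B"
    and lim: "\<And>t. t \<in> {0..1} \<Longrightarrow> (\<lambda>j. u j t) \<longlonglongrightarrow> u' t" "\<And>t. t \<in> {0..1} \<Longrightarrow> (\<lambda>j. v j t) \<longlonglongrightarrow> v' t"
      "\<And>t. t \<in> {0..1} \<Longrightarrow> (\<lambda>j. \<phi> j t) \<longlonglongrightarrow> \<phi>' t"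
  shows "(\<lambda>j. dflux f (u j) (v j) (\<phi> j)) \<longlonglongrightarrow> dflux f u' v' \<phi>'"
  unfolding dflux_def
proof -
  obtain M where M: "M \<ge> 0" "\<And>p. norm p \<le> B \<Longrightarrow> \<bar>f p\<bar> \<le> M"
    using continuous_bounded_on_cball[OF f] by blast
  show "(\<lambda>j. integral {0..1} (\<lambda>t. f (u j t) * (\<phi> j t \<bullet> (\<i> * v j t)))) \<longlonglongrightarrow> integral {0..1} (\<lambda>t. f (u' t) * (\<phi>' t \<bullet> (\<i> * v' t)))"
  proof (rule integral_tendsto_bounded)
    show "continuous_on {0..1} (\<lambda>t. f (u j t) * (\<phi> j t \<bullet> (\<i> * v j t)))" for j
      by (intro continuous_intros continuous_on_compose_UNIV[OF f] c)
    show "\<bar>f (u j t) * (\<phi> j t \<bullet> (\<i> * v j t))\<bar> \<le> M * (B * B)" if t: "t \<in> {0..1}" for j t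
    proof -
      have "\<bar>\<phi> j t \<bullet> (\<i> * v j t)\<bar> \<le> B * B"
        using norm_inner_times_i[of "\<phi> j t" "v j t"] mult_mono[OF B(3)[OF t] B(2)[OF t], of j j] order_trans[OF norm_ge_zero B(3)[OF t, of j]]
        by simp
      then show ?thesis unfolding abs_mult using M B(1)[OF t] by (intro mult_mono) auto
    qed
    show "(\<lambda>j. f (u j t) * (\<phi> j t \<bullet> (\<i> * v j t))) \<longlonglongrightarrow> f (u' t) * (\<phi>' t \<bullet> (\<i> * v' t))" if "t \<in> {0..1}" for t
      by (intro tendsto_intros tendsto_compose_continuous[OF f] lim that)
  qed
qed

text \<open>Coefficients are functions, not points of a Euclidean space, so the Bolzano-Weierstrass
  theorem is applied one mode at a time.\<close>

lemma finite_bounded_convergent_subsequence: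
  fixes x :: "nat \<Rightarrow> 'a \<Rightarrow> complex"
  assumes "finite A" "\<And>k. k \<in> A \<Longrightarrow> bounded (range (\<lambda>j. x j k))"
  shows "\<exists>r l. strict_mono r \<and> (\<forall>k\<in>A. (\<lambda>j. x (r j) k) \<longlonglongrightarrow> l k)"
  using assms
proof (induction A rule: finite_induct)
  case empty
  then show ?case by (auto intro!: exI[of _ id] simp: strict_mono_def)
next
  case (insert a A)
  then obtain r l where r: "strict_mono r" "\<forall>k\<in>A. (\<lambda>j. x (r j) k) \<longlonglongrightarrow> l k" by auto
  have "bounded (range (\<lambda>j. x (r j) a))"
    by (rule bounded_subset[OF insert.prems[of a]]) auto
  then obtain s m where s: "strict_mono s" "((\<lambda>j. x (r j) a) \<circ> s) \<longlonglongrightarrow> m"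
    using bounded_imp_convergent_subsequence by blast
  have "(\<lambda>j. x ((r \<circ> s) j) k) \<longlonglongrightarrow> (l(a := m)) k" if "k \<in> insert a A" for k
  proof (cases "k = a")
    case True
    then show ?thesis using s(2) by (simp add: o_def)
  next
    case False
    with that r have "(\<lambda>j. x (r j) k) \<longlonglongrightarrow> l k" by auto
    from LIMSEQ_subseq_LIMSEQ[OF this s(1)] show ?thesis using False by (simp add: o_def)
  qed
  then show ?case using strict_mono_o[OF r(1) s(1)] by blast
qed

section \<open>The finite-dimensional minimum problem\<close>

text \<open>The root keeps the first term homogeneous of degree one, like the length, so that a flux
  bound linear in the length can be compared with it.\<close>

definition lagrangian :: "(complex \<Rightarrow> real) \<Rightarrow> nat \<Rightarrow> (int \<Rightarrow> complex) \<Rightarrow> real" where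
  "lagrangian f n c = sqrt (energy n c) + flux f (tp n c) (tp n (dc c))"

text \<open>The bound l is artificial: it bounds the nonconstant modes and makes the quadratic flux
  bounds effective. Minimisers are later shown to lie strictly below it.\<close>

definition admissible :: "nat \<Rightarrow> real \<Rightarrow> real \<Rightarrow> (int \<Rightarrow> complex) set" where
  "admissible n \<tau> l = {c. tarea n c = \<tau> \<and> sqrt (energy n c) \<le> l}"

lemma norm_coeff_le:
  assumes "k \<in> modes n" "k \<noteq> 0"
  shows "norm (c k) \<le> sqrt (energy n c)"
proof (rule real_le_rsqrt)
  have "1 \<le> (2 * pi * real_of_int \<bar>k\<bar>)"
    using assms pi_gt3 mult_mono[of 1 "2 * pi" 1 "real_of_int \<bar>k\<bar>"] by simp
  then have "norm (c k) * 1 \<le> norm (c k) * (2 * pi * real_of_int \<bar>k\<bar>)"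
    by (intro mult_left_mono) auto
  then have "(norm (c k))\<^sup>2 \<le> (norm (dc c k))\<^sup>2"
    by (intro power_mono) (auto simp: dc_def norm_mult mult_ac)
  also have "\<dots> \<le> energy n c"
    unfolding energy_def by (rule member_le_sum) (use assms in auto)
  finally show "(norm (c k))\<^sup>2 \<le> energy n c" .
qed

text \<open>The energy does not see the constant mode, which is recovered from the base point by
  subtracting the 2 n other coefficients. Dependence on n does no harm for compactness at fixed
  degree.\<close>

lemma norm_all_coeff_le:
  assumes k: "k \<in> modes n" and R: "norm (tp n c 0) \<le> R" and l: "sqrt (energy n c) \<le> l"
  shows "norm (c k) \<le> R + (2 * n + 2) * l"
proof -
  let ?I = "modes n"
  have l0: "0 \<le> l" using l energy_nonneg[of n c] by (meson order_trans real_sqrt_ge_zero)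
  have R0: "0 \<le> R" using R norm_ge_zero order_trans by blast
  have b: "norm (c k) \<le> l" if "k \<in> ?I" "k \<noteq> 0" for k using norm_coeff_le[OF that] l by (rule order_trans)
  show ?thesis
  proof (cases "k = 0")
    case True
    have "tp n c 0 = (\<Sum>k\<in>?I. c k)" using ee_int[of _ 0] by (simp add: tp_def)
    also have "\<dots> = c 0 + (\<Sum>k\<in>?I - {0}. c k)" by (rule sum.remove) auto
    finally have "c 0 = tp n c 0 - (\<Sum>k\<in>?I - {0}. c k)" by simp
    then have "norm (c 0) \<le> norm (tp n c 0) + norm (\<Sum>k\<in>?I - {0}. c k)" by (metis norm_triangle_ineq4)
    also have "norm (\<Sum>k\<in>?I - {0}. c k) \<le> (\<Sum>k\<in>?I - {0}. l)"
      by (rule sum_norm_le) (use b in auto)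
    also have "\<dots> = (2 * n) * l" by simp
    finally show ?thesis using True R l0 by (simp add: algebra_simps)
  next
    case False
    then have "norm (c k) \<le> 1 * l" using b k by simp
    also have "1 * l \<le> (2 * real n + 2) * l" by (rule mult_right_mono) (use l0 in auto)
    finally show ?thesis using R0 by linarith
  qed
qed

lemma tp_tendsto:
  assumes "\<And>k. k \<in> modes n \<Longrightarrow> (\<lambda>j. y j k) \<longlonglongrightarrow> d k"
  shows "(\<lambda>j. tp n (y j) t) \<longlonglongrightarrow> tp n d t"
  unfolding tp_def by (intro tendsto_intros assms)

lemma dc_tendsto: "(\<lambda>j. y j k) \<longlonglongrightarrow> d k \<Longrightarrow> (\<lambda>j. dc (y j) k) \<longlonglongrightarrow> dc d k"
  unfolding dc_def by (intro tendsto_intros)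

lemma tp_bounded_of_tendsto:
  assumes "\<And>k. k \<in> modes n \<Longrightarrow> (\<lambda>j. y j k) \<longlonglongrightarrow> d k"
  shows "\<exists>B. \<forall>j t. norm (tp n (y j) t) \<le> B"
proof -
  have "(\<lambda>j. \<Sum>k\<in>modes n. norm (y j k)) \<longlonglongrightarrow> (\<Sum>k\<in>modes n. norm (d k))"
    by (intro tendsto_intros assms)
  then have "bounded (range (\<lambda>j. \<Sum>k\<in>modes n. norm (y j k)))" by (rule convergent_imp_bounded)
  then obtain B where "\<And>j. \<bar>\<Sum>k\<in>modes n. norm (y j k)\<bar> \<le> B" by (auto simp: bounded_iff)
  then have "norm (tp n (y j) t) \<le> B" for j t
    using norm_tp_le[of n "y j" t] order_trans[OF abs_ge_self] order_trans by metis
  then show ?thesis by blast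
qed

lemma lagrangian_tendsto:
  assumes f: "continuous_on UNIV f" and lim: "\<And>k. k \<in> modes n \<Longrightarrow> (\<lambda>j. x j k) \<longlonglongrightarrow> c k"
  shows "(\<lambda>j. lagrangian f n (x j)) \<longlonglongrightarrow> lagrangian f n c"
    "(\<lambda>j. energy n (x j)) \<longlonglongrightarrow> energy n c" "(\<lambda>j. tarea n (x j)) \<longlonglongrightarrow> tarea n c"
    "(\<lambda>j. tp n (x j) t) \<longlonglongrightarrow> tp n c t"
proof -
  have limd: "\<And>k. k \<in> modes n \<Longrightarrow> (\<lambda>j. dc (x j) k) \<longlonglongrightarrow> dc c k"
    by (intro dc_tendsto lim)
  show E: "(\<lambda>j. energy n (x j)) \<longlonglongrightarrow> energy n c"
    unfolding energy_def by (intro tendsto_intros limd)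
  show "(\<lambda>j. tarea n (x j)) \<longlonglongrightarrow> tarea n c"
    unfolding tarea_def by (intro tendsto_intros lim)
  note tpl = tp_tendsto and bd = tp_bounded_of_tendsto
  show "(\<lambda>j. tp n (x j) t) \<longlonglongrightarrow> tp n c t" by (rule tpl[OF lim])
  obtain B1 where B1: "\<And>j t. norm (tp n (x j) t) \<le> B1" using bd[of n x c, OF lim] by blast
  obtain B2 where B2: "\<And>j t. norm (tp n (dc (x j)) t) \<le> B2" using bd[of n "\<lambda>j. dc (x j)" "dc c", OF limd] by blast
  have "(\<lambda>j. flux f (tp n (x j)) (tp n (dc (x j)))) \<longlonglongrightarrow> flux f (tp n c) (tp n (dc c))"
  proof (rule flux_tendsto[OF f, where B="max B1 B2"])
    show "norm (tp n (x j) t) \<le> max B1 B2" "norm (tp n (dc (x j)) t) \<le> max B1 B2" for j t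
      using B1[of j t] B2[of j t] by auto
    show "(\<lambda>j. tp n (x j) t) \<longlonglongrightarrow> tp n c t" "(\<lambda>j. tp n (dc (x j)) t) \<longlonglongrightarrow> tp n (dc c) t" for t
      by (rule tpl, erule lim) (rule tpl, erule limd)
  qed (rule continuous_on_tp)+
  then show "(\<lambda>j. lagrangian f n (x j)) \<longlonglongrightarrow> lagrangian f n c"
    unfolding lagrangian_def by (intro tendsto_intros E)
qed

text \<open>By \<open>far\<close>, curves starting outside the ball of radius R lose against c0, and
  on the others all relevant coefficients are bounded. The strict inequality in \<open>far\<close>
  also places the minimiser inside the open ball.\<close>

lemma galerkin_minimizer:
  assumes f: "continuous_on UNIV f" and c0: "c0 \<in> admissible n \<tau> l"
    and far: "\<And>c. c \<in> admissible n \<tau> l \<Longrightarrow> norm (tp n c 0) \<ge> R \<Longrightarrow> lagrangian f n c > lagrangian f n c0"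
  obtains c where "c \<in> admissible n \<tau> l" "\<And>d. d \<in> admissible n \<tau> l \<Longrightarrow> lagrangian f n c \<le> lagrangian f n d"
    "norm (tp n c 0) < R"
proof -
  define S where "S = {c \<in> admissible n \<tau> l. norm (tp n c 0) \<le> R}"
  have c0R: "norm (tp n c0 0) < R" using far[OF c0] by force
  have c0S: "c0 \<in> S" using c0 c0R by (simp add: S_def)
  \<comment> \<open>Compactness is proved for the set of values, since coefficients outside
    \<open>modes n\<close> are arbitrary.\<close>
  have "seq_compact (lagrangian f n ` S)"
    unfolding seq_compact_def
  proof (intro allI impI)
    fix y :: "nat \<Rightarrow> real" assume "\<forall>j. y j \<in> lagrangian f n ` S"
    then have "\<forall>j. \<exists>c. c \<in> S \<and> y j = lagrangian f n c" by blast
    from choice[OF this] obtain x where x: "\<And>j. x j \<in> S" "\<And>j. y j = lagrangian f n (x j)" by blast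
    have "bounded (range (\<lambda>j. x j k))" if "k \<in> modes n" for k
    proof (rule boundedI)
      fix y assume "y \<in> range (\<lambda>j. x j k)"
      then obtain j where "y = x j k" by blast
      then show "norm y \<le> R + (2 * real n + 2) * l"
        using norm_all_coeff_le[OF that, of "x j" R l] x(1)[of j] by (simp add: S_def admissible_def)
    qed
    then have "\<exists>r c. strict_mono r \<and> (\<forall>k\<in>modes n. (\<lambda>j. x (r j) k) \<longlonglongrightarrow> c k)"
      by (intro finite_bounded_convergent_subsequence) simp
    then obtain r c where r: "strict_mono r" "\<forall>k\<in>modes n. (\<lambda>j. x (r j) k) \<longlonglongrightarrow> c k"
      by blast
    note lim = lagrangian_tendsto[OF f bspec[OF r(2)]]
    have xr: "tarea n (x (r j)) = \<tau>" "sqrt (energy n (x (r j))) \<le> l" "norm (tp n (x (r j)) 0) \<le> R" for j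
      using x(1)[of "r j"] by (auto simp: S_def admissible_def)
    have "tarea n c = \<tau>"
      using LIMSEQ_unique[OF lim(3)] xr(1) by simp
    moreover have "sqrt (energy n c) \<le> l"
      by (rule LIMSEQ_le_const2[OF tendsto_real_sqrt[OF lim(2)]]) (use xr in auto)
    moreover have "norm (tp n c 0) \<le> R"
      by (rule LIMSEQ_le_const2[OF tendsto_norm[OF lim(4)]]) (use xr in auto)
    ultimately have "c \<in> S" by (simp add: S_def admissible_def)
    moreover have "(y \<circ> r) \<longlonglongrightarrow> lagrangian f n c" using lim(1) by (simp add: o_def x(2))
    ultimately show "\<exists>l\<in>lagrangian f n ` S. \<exists>r. strict_mono r \<and> (y \<circ> r) \<longlonglongrightarrow> l"
      using r(1) by blast
  qed
  then have "compact (lagrangian f n ` S)" by (simp add: compact_eq_seq_compact_metric)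
  then obtain m where "m \<in> lagrangian f n ` S" "\<forall>t\<in>lagrangian f n ` S. m \<le> t"
    using compact_attains_inf[of "lagrangian f n ` S"] c0S by blast
  then obtain c where c: "c \<in> S" "\<And>d. d \<in> S \<Longrightarrow> lagrangian f n c \<le> lagrangian f n d" by auto
  have min: "lagrangian f n c \<le> lagrangian f n d" if "d \<in> admissible n \<tau> l" for d
  proof (cases "norm (tp n d 0) \<le> R")
    case True
    then show ?thesis using c(2) that by (simp add: S_def)
  next
    case False
    then show ?thesis using far[OF that] c(2)[OF c0S] by simp
  qed
  have "norm (tp n c 0) < R"
    using far[of c] c c(2)[OF c0S] by (force simp: S_def)
  then show ?thesis using c min that by (auto simp: S_def)
qed

lemma dflux_tp_tendsto:
  assumes f: "continuous_on UNIV f"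
    and a: "\<And>k. k \<in> modes n \<Longrightarrow> (\<lambda>j. x j k) \<longlonglongrightarrow> c k"
    and b: "\<And>k. k \<in> modes n \<Longrightarrow> (\<lambda>j. y j k) \<longlonglongrightarrow> d k"
  shows "(\<lambda>j. dflux f (tp n (x j)) (tp n (dc (x j))) (tp n (y j))) \<longlonglongrightarrow> dflux f (tp n c) (tp n (dc c)) (tp n d)"
proof -
  have a': "\<And>k. k \<in> modes n \<Longrightarrow> (\<lambda>j. dc (x j) k) \<longlonglongrightarrow> dc c k"
    by (intro dc_tendsto a)
  obtain B1 where B1: "\<And>j t. norm (tp n (x j) t) \<le> B1" using tp_bounded_of_tendsto[of n x c, OF a] by blast
  obtain B2 where B2: "\<And>j t. norm (tp n (dc (x j)) t) \<le> B2"
    using tp_bounded_of_tendsto[of n "\<lambda>j. dc (x j)" "dc c", OF a'] by blast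
  obtain B3 where B3: "\<And>j t. norm (tp n (y j) t) \<le> B3" using tp_bounded_of_tendsto[of n y d, OF b] by blast
  show ?thesis
  proof (rule dflux_tendsto[OF f, where B="max B1 (max B2 B3)"])
    show "norm (tp n (x j) t) \<le> max B1 (max B2 B3)" "norm (tp n (dc (x j)) t) \<le> max B1 (max B2 B3)"
      "norm (tp n (y j) t) \<le> max B1 (max B2 B3)" for j t
      using B1[of j t] B2[of j t] B3[of j t] by auto
    show "(\<lambda>j. tp n (x j) t) \<longlonglongrightarrow> tp n c t" for t by (rule tp_tendsto, erule a)
    show "(\<lambda>j. tp n (dc (x j)) t) \<longlonglongrightarrow> tp n (dc c) t" for t by (rule tp_tendsto, erule a')
    show "(\<lambda>j. tp n (y j) t) \<longlonglongrightarrow> tp n d t" for t by (rule tp_tendsto, erule b)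
  qed (rule continuous_on_tp)+
qed

lemma dflux_scale: "dflux f u v (\<lambda>t. s *\<^sub>R \<phi> t) = s * dflux f u v \<phi>"
proof -
  have "dflux f u v (\<lambda>t. s *\<^sub>R \<phi> t) = integral {0..1} (\<lambda>t. s * (f (u t) * (\<phi> t \<bullet> (\<i> * v t))))"
    unfolding dflux_def by (simp only: inner_scaleR_left mult.left_commute)
  then show ?thesis by (simp add: dflux_def)
qed

lemma dflux_add_scale:
  assumes "continuous_on UNIV f" "loop u v" "continuous_on {0..1} \<phi>" "continuous_on {0..1} \<eta>"
  shows "dflux f u v (\<lambda>t. \<phi> t + s *\<^sub>R \<eta> t) = dflux f u v \<phi> + s * dflux f u v \<eta>"
proof -
  have "dflux f u v (\<lambda>t. \<phi> t + s *\<^sub>R \<eta> t) = dflux f u v \<phi> + dflux f u v (\<lambda>t. s *\<^sub>R \<eta> t)"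
    unfolding dflux_def inner_add_left distrib_left
    by (rule integral_add; rule integrable_continuous_real, rule dflux_continuous) (auto intro!: assms continuous_intros)
  then show ?thesis by (simp add: dflux_scale)
qed

lemma tp_add_scale_fun:
  "(\<lambda>t. tp n c t + s *\<^sub>R tp n x t) = tp n (\<lambda>k. c k + s *\<^sub>R x k)"
  "(\<lambda>t. tp n (dc c) t + s *\<^sub>R tp n (dc x) t) = tp n (dc (\<lambda>k. c k + s *\<^sub>R x k))"
  by (auto simp: tp_add_scale dc_add_scale)

text \<open>The multiplier comes from differentiating along the curves c + s d rescaled to the prescribed area.\<close>

theorem galerkin_euler_lagrange:
  assumes f: "continuous_on UNIV f" and c: "c \<in> admissible n \<tau> l"
    and min: "\<And>d. d \<in> admissible n \<tau> l \<Longrightarrow> lagrangian f n c \<le> lagrangian f n d"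
    and int: "sqrt (energy n c) < l" and \<tau>: "\<tau> \<noteq> 0"
  shows "bienergy n c d / sqrt (energy n c) + dflux f (tp n c) (tp n (dc c)) (tp n d) =
    (sqrt (energy n c) + dflux f (tp n c) (tp n (dc c)) (tp n c)) / (2 * \<tau>) * biarea n c d"
proof -
  define u where "u = tp n c"
  define v where "v = tp n (dc c)"
  have u: "loop u v" unfolding u_def v_def by (rule loop_tp)
  define a where "a s = tarea n (\<lambda>k. c k + s *\<^sub>R d k)" for s
  define E where "E s = energy n (\<lambda>k. c k + s *\<^sub>R d k)" for s
  \<comment> \<open>Area is homogeneous of degree two, so this factor restores it to \<tau>; the
    quotient is positive for s near 0.\<close>
  define g where "g s = sqrt (\<tau> / a s)" for s
  define w where "w s = (\<lambda>k. g s *\<^sub>R (c k + s *\<^sub>R d k))" for s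
  have c\<tau>: "tarea n c = \<tau>" using c by (simp add: admissible_def)
  have E0: "energy n c > 0" using isoperimetric_tp[of n c] \<tau> c\<tau> pi_gt_zero
    by (smt (verit) zero_less_mult_iff zero_less_abs_iff)
  have a_eq: "a s = \<tau> + s * biarea n c d + s\<^sup>2 * tarea n d" for s
    by (simp add: a_def tarea_add_scale c\<tau>)
  have E_eq: "E s = energy n c + 2 * s * bienergy n c d + s\<^sup>2 * energy n d" for s
    by (simp add: E_def energy_add_scale)
  have a0: "a 0 = \<tau>" and g0: "g 0 = 1" and w0: "w 0 = c" and Ez: "E 0 = energy n c"
    using \<tau> by (auto simp: a_eq g_def w_def E_eq)
  have da: "(a has_real_derivative biarea n c d) (at 0)"
    unfolding a_eq[abs_def] by (auto intro!: derivative_eq_intros)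
  have dE: "(E has_real_derivative 2 * bienergy n c d) (at 0)"
    unfolding E_eq[abs_def] by (auto intro!: derivative_eq_intros)
  define g' where "g' = - biarea n c d / (2 * \<tau>)"
  have dg: "(g has_real_derivative g') (at 0)"
  proof -
    have "((\<lambda>s. \<tau> / a s) has_real_derivative (0 * a 0 - \<tau> * biarea n c d) / (a 0 * a 0)) (at 0)"
      by (rule DERIV_divide) (use da a0 \<tau> in auto)
    then have "((\<lambda>s. \<tau> / a s) has_real_derivative - biarea n c d / \<tau>) (at 0)"
      using \<tau> by (simp add: a0)
    from DERIV_chain2[OF DERIV_real_sqrt this] show ?thesis
      using \<tau> by (simp add: g_def[abs_def] a0 g'_def)
  qed
  have dsE: "((\<lambda>s. g s * sqrt (E s)) has_real_derivative g' * sqrt (energy n c) + bienergy n c d / sqrt (energy n c)) (at 0)"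
  proof -
    have "((\<lambda>s. sqrt (E s)) has_real_derivative inverse (sqrt (E 0)) / 2 * (2 * bienergy n c d)) (at 0)"
      by (rule DERIV_chain2[OF DERIV_real_sqrt dE]) (simp add: Ez E0)
    from DERIV_mult[OF dg this] show ?thesis by (simp add: g0 Ez field_simps)
  qed
  have sE: "sqrt (energy n (w s)) = g s * sqrt (E s)" if "g s \<ge> 0" for s
    using that by (simp add: w_def energy_scale E_def real_sqrt_mult)
  have ev_pos: "eventually (\<lambda>s. \<tau> / a s > 0) (at 0)"
  proof -
    have "isCont (\<lambda>s. \<tau> / a s) 0" using DERIV_isCont[OF da] a0 \<tau> by (intro continuous_intros) auto
    then have "((\<lambda>s. \<tau> / a s) \<longlongrightarrow> 1) (at 0)" using a0 \<tau> by (simp add: isCont_def)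
    then show ?thesis by (rule order_tendstoD) simp
  qed
  have ev_E: "eventually (\<lambda>s. g s * sqrt (E s) < l) (at 0)"
  proof -
    have "((\<lambda>s. g s * sqrt (E s)) \<longlongrightarrow> g 0 * sqrt (E 0)) (at 0)" using DERIV_isCont[OF dsE] by (simp add: isCont_def)
    then show ?thesis by (rule order_tendstoD) (use int g0 Ez in simp)
  qed
  have ev_min: "eventually (\<lambda>s. lagrangian f n c \<le> lagrangian f n (w s)) (at 0)"
    using ev_pos ev_E
  proof eventually_elim
    case (elim s)
    have "(g s)\<^sup>2 = \<tau> / a s" using elim by (simp add: g_def)
    moreover have "a s \<noteq> 0" using elim by auto
    ultimately have "tarea n (w s) = \<tau>" by (simp add: w_def tarea_scale a_def[symmetric])
    moreover have "sqrt (energy n (w s)) \<le> l" using elim sE[of s] by (simp add: g_def)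
    ultimately show ?case by (intro min) (simp add: admissible_def)
  qed
  \<comment> \<open>x s is the increment of w from c, y s its difference quotient, and Y the limit
    of y s.\<close>
  define x where "x s = (\<lambda>k. w s k - c k)" for s
  define y where "y s = (\<lambda>k. (1 / s) *\<^sub>R x s k)" for s
  define Y where "Y = (\<lambda>k. d k + g' *\<^sub>R c k)"
  define fl where "fl s = flux f (tp n (w s)) (tp n (dc (w s)))" for s
  let ?dfl = "\<lambda>a s. dflux f (tp n (\<lambda>k. c k + a *\<^sub>R x s k)) (tp n (dc (\<lambda>k. c k + a *\<^sub>R x s k)))"
  have "\<exists>\<sigma>\<in>{0..1}. fl s - fl 0 = ?dfl \<sigma> s (tp n (x s))" for s
  proof -
    have "(\<lambda>t. tp n c t + tp n (x s) t) = tp n (w s)" "(\<lambda>t. tp n (dc c) t + tp n (dc (x s)) t) = tp n (dc (w s))"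
      using tp_add_scale_fun[of n c 1 "x s"] by (simp_all add: x_def)
    then show ?thesis
      using flux_mean_value[OF f loop_tp[of n c] loop_tp[of n "x s"]] by (simp add: tp_add_scale_fun dc_add_scale fl_def w0)
  qed
  \<comment> \<open>No continuity of \<sigma> is involved: its values lie in [0,1] and x s tends to
    0, so the intermediate curves tend to c.\<close>
  then obtain \<sigma> where \<sigma>: "\<And>s. \<sigma> s \<in> {0..1}"
    "\<And>s. fl s - fl 0 = ?dfl (\<sigma> s) s (tp n (x s))"
    by metis
  have quot: "(fl s - fl 0) / s = ?dfl (\<sigma> s) s (tp n (y s))"
    if "s \<noteq> 0" for s
  proof -
    have "tp n (y s) = (\<lambda>t. (1 / s) *\<^sub>R tp n (x s) t)" unfolding y_def by (rule ext) (rule tp_scale)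
    then show ?thesis unfolding \<sigma>(2) by (simp add: dflux_scale)
  qed
  have dfl: "(fl has_real_derivative dflux f u v (tp n Y)) (at 0)"
    unfolding DERIV_def tendsto_at_iff_sequentially
  proof (intro allI impI)
    fix X :: "nat \<Rightarrow> real" assume X: "\<forall>j. X j \<in> UNIV - {0}" "X \<longlonglongrightarrow> 0"
    have gl: "(\<lambda>j. g (X j)) \<longlonglongrightarrow> 1"
      using isCont_tendsto_compose[OF DERIV_isCont[OF dg] X(2)] g0 by simp
    have gq: "(\<lambda>j. (g (X j) - 1) / X j) \<longlonglongrightarrow> g'"
      using dg X unfolding DERIV_def tendsto_at_iff_sequentially by (auto simp: o_def g0)
    have ylim: "(\<lambda>j. y (X j) k) \<longlonglongrightarrow> Y k" for k
    proof -
      have "y (X j) k = ((g (X j) - 1) / X j) *\<^sub>R c k + g (X j) *\<^sub>R d k" for j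
        using X(1) by (simp add: y_def x_def w_def algebra_simps divide_inverse)
      moreover have "(\<lambda>j. ((g (X j) - 1) / X j) *\<^sub>R c k + g (X j) *\<^sub>R d k) \<longlonglongrightarrow> g' *\<^sub>R c k + 1 *\<^sub>R d k"
        by (intro tendsto_intros gl gq)
      ultimately show ?thesis by (simp add: Y_def add.commute)
    qed
    have xlim: "(\<lambda>j. c k + \<sigma> (X j) *\<^sub>R x (X j) k) \<longlonglongrightarrow> c k" for k
    proof -
      have "(\<lambda>j. X j *\<^sub>R y (X j) k) \<longlonglongrightarrow> 0 *\<^sub>R Y k" by (intro tendsto_intros X ylim)
      then have "(\<lambda>j. x (X j) k) \<longlonglongrightarrow> 0" using X(1) by (simp add: y_def)
      then have "(\<lambda>j. \<sigma> (X j) *\<^sub>R x (X j) k) \<longlonglongrightarrow> 0"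
        by (rule tendsto_0_le[where K=1]) (use \<sigma>(1) in \<open>auto intro!: always_eventually mult_left_le_one_le\<close>)
      from tendsto_add[OF tendsto_const[of "c k"] this] show ?thesis by simp
    qed
    have "(\<lambda>j. dflux f (tp n (\<lambda>k. c k + \<sigma> (X j) *\<^sub>R x (X j) k)) (tp n (dc (\<lambda>k. c k + \<sigma> (X j) *\<^sub>R x (X j) k))) (tp n (y (X j))))
       \<longlonglongrightarrow> dflux f (tp n c) (tp n (dc c)) (tp n Y)"
      by (rule dflux_tp_tendsto[OF f]) (rule xlim ylim)+
    then show "((\<lambda>h. (fl (0 + h) - fl 0) / h) \<circ> X) \<longlonglongrightarrow> dflux f u v (tp n Y)"
      using quot X(1) by (simp add: o_def u_def v_def)
  qed
  have dL: "((\<lambda>s. g s * sqrt (E s) + fl s) has_real_derivative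
      g' * sqrt (energy n c) + bienergy n c d / sqrt (energy n c) + dflux f u v (tp n Y)) (at 0)"
    by (rule DERIV_add[OF dsE dfl])
  have "eventually (\<lambda>s. lagrangian f n c \<le> g s * sqrt (E s) + fl s) (at 0)"
    using ev_min ev_pos
  proof eventually_elim
    case (elim s)
    then show ?case using sE[of s] by (simp add: lagrangian_def fl_def g_def)
  qed
  then obtain \<delta> where \<delta>: "\<delta> > 0" "\<And>s. s \<noteq> 0 \<Longrightarrow> \<bar>s\<bar> < \<delta> \<Longrightarrow> lagrangian f n c \<le> g s * sqrt (E s) + fl s"
    by (auto simp: eventually_at dist_real_def)
  have L0: "g 0 * sqrt (E 0) + fl 0 = lagrangian f n c" by (simp add: g0 Ez fl_def w0 lagrangian_def)
  have "g' * sqrt (energy n c) + bienergy n c d / sqrt (energy n c) + dflux f u v (tp n Y) = 0"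
  proof (rule DERIV_local_min[OF dL \<delta>(1)], intro allI impI)
    fix s :: real assume "\<bar>0 - s\<bar> < \<delta>"
    then show "g 0 * sqrt (E 0) + fl 0 \<le> g s * sqrt (E s) + fl s"
      unfolding L0 using \<delta>(2)[of s] L0 by (cases "s = 0") simp_all
  qed
  moreover have "dflux f u v (tp n Y) = dflux f u v (tp n d) + g' * dflux f u v u"
  proof -
    have "tp n Y = (\<lambda>t. tp n d t + g' *\<^sub>R u t)" by (simp add: Y_def tp_add_scale u_def fun_eq_iff)
    then show ?thesis
      using dflux_add_scale[OF f u, of "tp n d" "tp n c" g'] by (simp only: u_def continuous_on_tp simp_thms)
  qed
  \<comment> \<open>g' is a multiple of \<open>biarea n c d\<close>, so its two contributions
    combine into the multiplier term.\<close>
  ultimately have "bienergy n c d / sqrt (energy n c) + dflux f u v (tp n d) = - g' * (sqrt (energy n c) + dflux f u v u)"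
    by (simp add: algebra_simps)
  also have "\<dots> = (sqrt (energy n c) + dflux f u v u) / (2 * \<tau>) * biarea n c d"
    by (simp add: g'_def)
  finally show ?thesis by (simp add: u_def v_def)
qed

section \<open>Completeness of the trigonometric system\<close>

text \<open>There is no degree bound, because the peaking functions used for completeness are
  arbitrarily high powers.\<close>

inductive trig_poly :: "(real \<Rightarrow> complex) \<Rightarrow> bool" where
  mode: "trig_poly (\<lambda>t. a * ee k t)"
| add: "trig_poly \<phi> \<Longrightarrow> trig_poly \<psi> \<Longrightarrow> trig_poly (\<lambda>t. \<phi> t + \<psi> t)"

lemma trig_poly_continuous: "trig_poly \<phi> \<Longrightarrow> continuous_on S \<phi>"
  by (induction rule: trig_poly.induct) (auto intro!: continuous_intros)

lemma trig_poly_mult_mode: "trig_poly \<psi> \<Longrightarrow> trig_poly (\<lambda>t. (a * ee k t) * \<psi> t)"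
proof (induction rule: trig_poly.induct)
  case (mode b l)
  have "(\<lambda>t. a * ee k t * (b * ee l t)) = (\<lambda>t. (a * b) * ee (k + l) t)" by (simp add: ee_add mult_ac)
  then show ?case by (simp only: trig_poly.mode)
next
  case (add \<phi> \<psi>)
  then show ?case by (simp add: distrib_left trig_poly.add)
qed

lemma trig_poly_mult: "trig_poly \<phi> \<Longrightarrow> trig_poly \<psi> \<Longrightarrow> trig_poly (\<lambda>t. \<phi> t * \<psi> t)"
  by (induction rule: trig_poly.induct) (simp_all add: trig_poly_mult_mode distrib_right trig_poly.add)

lemma trig_poly_const: "trig_poly (\<lambda>t. a)"
  using trig_poly.mode[of a 0] by simp

lemma trig_poly_power: "trig_poly \<phi> \<Longrightarrow> trig_poly (\<lambda>t. \<phi> t ^ n)"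
  by (induction n) (simp_all add: trig_poly_const trig_poly_mult)

lemma trig_poly_cos: "trig_poly (\<lambda>t. of_real (cos (2 * pi * (t - t0))))"
proof -
  have "complex_of_real (cos (2 * pi * (t - t0))) = (cis (- (2 * pi * t0)) / 2) * ee 1 t + (cis (2 * pi * t0) / 2) * ee (- 1) t" for t
    by (simp add: ee_def cis_mult complex_eq_iff) (simp add: right_diff_distrib cos_diff cos_add sin_diff sin_add add_divide_distrib diff_divide_distrib mult_ac)
  then have "(\<lambda>t. complex_of_real (cos (2 * pi * (t - t0)))) = (\<lambda>t. (cis (- (2 * pi * t0)) / 2) * ee 1 t + (cis (2 * pi * t0) / 2) * ee (- 1) t)"
    by (rule ext)
  then show ?thesis by (simp only:) (intro trig_poly.intros)
qed

text \<open>Powers of 1 + cos 2 pi (t - t0) - cos 2 pi d concentrate where |t - t0| < d.\<close>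

theorem trig_system_complete:
  fixes h :: "real \<Rightarrow> complex"
  assumes h: "continuous_on {0..1} h" and orth: "\<And>k a. integral {0..1} (\<lambda>t. h t \<bullet> (a * ee k t)) = 0"
    and t0: "0 < t0" "t0 < 1"
  shows "h t0 = 0"
proof (rule ccontr)
  assume nz: "h t0 \<noteq> 0"
  have orth_trig: "integral {0..1} (\<lambda>t. h t \<bullet> \<phi> t) = 0" if "trig_poly \<phi>" for \<phi>
    using that
  proof (induction rule: trig_poly.induct)
    case (add \<phi> \<psi>)
    then show ?case unfolding inner_add_right
      by (subst integral_add) (auto intro!: integrable_continuous_real continuous_intros h trig_poly_continuous)
  qed (rule orth)
  \<comment> \<open>Projection on the direction \<open>h t0\<close> reduces the claim to a real
    function that is positive near t0.\<close>
  define h0 where "h0 t = h t \<bullet> h t0" for t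
  have ch0: "continuous_on {0..1} h0" unfolding h0_def by (intro continuous_intros h)
  define m where "m = h0 t0 / 2"
  have m: "m > 0" using nz by (simp add: m_def h0_def)
  have "\<exists>d>0. \<forall>t\<in>{0..1}. dist t t0 < d \<longrightarrow> dist (h0 t) (h0 t0) < m"
    using ch0 t0 m unfolding continuous_on_iff by simp
  then obtain d1 where d1: "d1 > 0" "\<And>t. t \<in> {0..1} \<Longrightarrow> \<bar>t - t0\<bar> < d1 \<Longrightarrow> \<bar>h0 t - h0 t0\<bar> < m"
    by (auto simp: dist_real_def)
  \<comment> \<open>The window of radius d lies inside [0,1], h0 >= m on it, and 2 pi d < pi keeps
    the cosine monotone there.\<close>
  define d where "d = min (d1 / 2) (min (t0 / 2) ((1 - t0) / 2))"
  have d: "d > 0" "d < d1" "d < t0" "d < 1 - t0" "d < 1/2" using d1(1) t0 by (auto simp: d_def min_def)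
  have h0m: "h0 t \<ge> m" if "\<bar>t - t0\<bar> \<le> d" for t
  proof -
    have "t \<in> {0..1}" using that d by auto
    then have "\<bar>h0 t - h0 t0\<bar> < m" using that d by (intro d1(2)) auto
    then show ?thesis unfolding m_def by linarith
  qed
  define q where "q t = 1 + cos (2 * pi * (t - t0)) - cos (2 * pi * d)" for t
  have q_eq: "q t = 1 + cos (2 * pi * \<bar>t - t0\<bar>) - cos (2 * pi * d)" for t
    using cos_abs_real[of "2 * pi * (t - t0)"] by (simp add: q_def abs_mult)
  \<comment> \<open>The value of q at distance d/2: q >= Q > 1 on the inner half of the window,
    while |q| <= 1 off the window.\<close>
  define Q where "Q = 1 + cos (2 * pi * (d / 2)) - cos (2 * pi * d)"
  have Q: "Q > 1"
  proof -
    have "cos (2 * pi * d) < cos (2 * pi * (d / 2))"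
      by (rule cos_monotone_0_pi) (use d pi_gt_zero in \<open>auto simp: field_simps\<close>)
    then show ?thesis by (simp add: Q_def)
  qed
  have q1: "q t \<ge> 1" if "\<bar>t - t0\<bar> \<le> d" for t
  proof -
    have "cos (2 * pi * d) \<le> cos (2 * pi * \<bar>t - t0\<bar>)"
      by (rule cos_monotone_0_pi_le) (use d that pi_gt_zero in \<open>auto simp: field_simps\<close>)
    then show ?thesis by (simp add: q_eq)
  qed
  have qQ: "q t \<ge> Q" if "\<bar>t - t0\<bar> \<le> d / 2" for t
  proof -
    have "cos (2 * pi * (d / 2)) \<le> cos (2 * pi * \<bar>t - t0\<bar>)"
      by (rule cos_monotone_0_pi_le) (use d that pi_gt_zero in \<open>auto simp: field_simps\<close>)
    then show ?thesis by (simp add: q_eq Q_def)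
  qed
  have q_small: "\<bar>q t\<bar> \<le> 1" if t: "t \<in> {0..1}" "\<bar>t - t0\<bar> \<ge> d" for t
  proof -
    define r where "r = \<bar>t - t0\<bar>"
    have r: "d \<le> r" "r \<le> 1 - d" using t d by (auto simp: r_def)
    have "cos (2 * pi * r) \<le> cos (2 * pi * d)"
    proof (cases "r \<le> 1/2")
      case True
      show ?thesis by (rule cos_monotone_0_pi_le) (use d r True pi_gt_zero in \<open>auto simp: field_simps\<close>)
    next
      case False
      \<comment> \<open>Points more than half a period away are nearer to a periodic copy of t0; the
        reflection to 1 - r returns the angle to [0, pi].\<close>
      have "cos (2 * pi * r) = cos (2 * pi * (1 - r))"
        by (simp add: right_diff_distrib cos_diff)
      also have "\<dots> \<le> cos (2 * pi * d)"
      proof (rule cos_monotone_0_pi_le)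
        show "2 * pi * d \<le> 2 * pi * (1 - r)" using r by (intro mult_left_mono) auto
        show "2 * pi * (1 - r) \<le> pi" using False mult_left_mono[of "1 - r" "1/2" "2 * pi"] by simp
      qed (use d in simp)
      finally show ?thesis .
    qed
    then show ?thesis using cos_ge_minus_one[of "2 * pi * r"] cos_le_one[of "2 * pi * d"]
      unfolding q_eq r_def[symmetric] by linarith
  qed
  obtain M where M: "\<And>t. t \<in> {0..1} \<Longrightarrow> \<bar>h0 t\<bar> \<le> M"
  proof -
    have "bounded (h0 ` {0..1})" by (intro compact_imp_bounded compact_continuous_image ch0) auto
    then obtain M where "\<forall>t\<in>{0..1}. \<bar>h0 t\<bar> \<le> M" by (auto simp: bounded_iff)
    then show ?thesis by (intro that[of M]) auto
  qed
  have M0: "M \<ge> 0" using M[of 0] by simp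
  have key: "m * Q ^ n * d \<le> M" for n
  proof -
    \<comment> \<open>Adding M makes the integrand nonnegative on [0,1], so restriction to the inner
      window only lowers the integral, which is M by orthogonality.\<close>
    define F where "F t = h0 t * q t ^ n + M" for t
    have cF: "continuous_on {0..1} F" unfolding F_def q_def by (intro continuous_intros ch0)
    have tq: "trig_poly (\<lambda>t. of_real (q t) ^ n * h t0)"
    proof -
      have "(\<lambda>t. complex_of_real (q t)) = (\<lambda>t. of_real (cos (2 * pi * (t - t0))) + of_real (1 - cos (2 * pi * d)))"
        by (simp add: q_def fun_eq_iff)
      then have "trig_poly (\<lambda>t. complex_of_real (q t))"
        by (simp only:) (intro trig_poly.add trig_poly_cos trig_poly_const)
      then show ?thesis by (intro trig_poly_mult trig_poly_power trig_poly_const)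
    qed
    have "h0 t * q t ^ n = h t \<bullet> (of_real (q t) ^ n * h t0)" for t
    proof -
      have "of_real (q t) ^ n * h t0 = (q t ^ n) *\<^sub>R h t0" by (simp add: scaleR_conv_of_real)
      then show ?thesis by (simp add: h0_def mult.commute)
    qed
    then have "integral {0..1} (\<lambda>t. h0 t * q t ^ n) = 0" using orth_trig[OF tq] by simp
    then have iF: "integral {0..1} F = M"
      unfolding F_def q_def
      by (subst integral_add) (auto intro!: integrable_continuous_real continuous_intros ch0)
    have F0: "F t \<ge> 0" if "t \<in> {0..1}" for t
    proof (cases "\<bar>t - t0\<bar> \<le> d")
      case True
      have "0 \<le> h0 t * q t ^ n" using h0m[OF True] q1[OF True] m by (intro mult_nonneg_nonneg) auto
      then show ?thesis using M0 by (simp add: F_def)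
    next
      case False
      have "\<bar>h0 t\<bar> * \<bar>q t\<bar> ^ n \<le> M * 1"
        using False that M[OF that] q_small[of t] by (intro mult_mono power_le_one) auto
      then show ?thesis by (simp add: F_def abs_mult[symmetric] power_abs[symmetric])
    qed
    have sub: "{t0 - d / 2..t0 + d / 2} \<subseteq> {0..1}" using d by auto
    have "m * Q ^ n * d = integral {t0 - d / 2..t0 + d / 2} (\<lambda>t. m * Q ^ n)" using d by simp
    also have "\<dots> \<le> integral {t0 - d / 2..t0 + d / 2} F"
    proof (rule integral_le)
      fix t assume t: "t \<in> {t0 - d / 2..t0 + d / 2}"
      then have tt: "\<bar>t - t0\<bar> \<le> d / 2" "\<bar>t - t0\<bar> \<le> d"
        using d unfolding abs_le_iff atLeastAtMost_iff by linarith+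
      have "m * Q ^ n \<le> h0 t * q t ^ n"
        using h0m[OF tt(2)] qQ[OF tt(1)] Q m by (intro mult_mono power_mono) auto
      then show "m * Q ^ n \<le> F t" using M0 by (simp add: F_def)
    qed (use continuous_on_subset[OF cF sub] in \<open>auto intro: integrable_continuous_real\<close>)
    also have "\<dots> \<le> integral {0..1} F"
      by (rule integral_subset_le[OF sub]) (use continuous_on_subset[OF cF sub] cF F0 in \<open>auto intro: integrable_continuous_real\<close>)
    finally show ?thesis by (simp add: iF)
  qed
  obtain n where "M / (m * d) < Q ^ n" using real_arch_pow[OF Q] by blast
  then have "M < m * Q ^ n * d" using m d by (simp add: divide_less_eq mult_ac)
  with key[of n] show False by simp
qed

text \<open>The du Bois-Reymond lemma with exponentials as test functions: if G is a primitive of g,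
  then V - G is orthogonal to every nonconstant mode, hence constant by completeness.\<close>

theorem weak_derivative_is_derivative:
  fixes V g :: "real \<Rightarrow> complex"
  assumes V: "continuous_on {0..1} V" and g: "continuous_on {0..1} g"
    and weak: "\<And>k a. integral {0..1} (\<lambda>t. V t \<bullet> (2 * pi * \<i> * of_int k * (a * ee k t)) + (a * ee k t) \<bullet> g t) = 0"
  shows "\<exists>\<kappa>. \<forall>t\<in>{0..1}. V t = \<kappa> + integral {0..t} g"
proof -
  define G where "G t = integral {0..t} g" for t
  have dG: "(G has_vector_derivative g t) (at t within {0..1})" if "t \<in> {0..1}" for t
    unfolding G_def by (rule integral_has_vector_derivative[OF g that])
  have cG: "continuous_on {0..1} G"
    unfolding continuous_on_eq_continuous_within using has_vector_derivative_continuous[OF dG] by blast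
  have has_integral_inner_right: "((\<lambda>t. a \<bullet> f t) has_integral a \<bullet> y) S"
    and has_integral_inner_left: "((\<lambda>t. f t \<bullet> a) has_integral y \<bullet> a) S"
    if "(f has_integral y) S" for f :: "real \<Rightarrow> complex" and y a S
    using has_integral_linear[OF that bounded_linear_inner_right, of a] has_integral_linear[OF that bounded_linear_inner_left, of a]
    by (simp_all add: o_def)
  \<comment> \<open>The constant mode as test function forces g to have mean zero, so G vanishes at
    both ends and leaves no boundary terms.\<close>
  have "a \<bullet> integral {0..1} g = 0" for a
  proof -
    have "integral {0..1} (\<lambda>t. a \<bullet> g t) = 0" using weak[of 0 a] by simp
    moreover have "((\<lambda>t. a \<bullet> g t) has_integral a \<bullet> integral {0..1} g) {0..1}"
      by (intro has_integral_inner_right integrable_integral integrable_continuous_real g)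
    ultimately show ?thesis by (simp add: integral_unique)
  qed
  then have "integral {0..1} g = 0" by (metis inner_eq_zero_iff)
  then have G01: "G 0 = 0" "G 1 = 0" by (auto simp: G_def)
  have parts: "((\<lambda>t. G t \<bullet> (2 * pi * \<i> * of_int k * (a * ee k t)) + (a * ee k t) \<bullet> g t) has_integral 0) {0..1}" for k a
  proof -
    have "((\<lambda>t. G t \<bullet> (2 * pi * \<i> * of_int k * (a * ee k t)) + (a * ee k t) \<bullet> g t) has_integral (G 1 \<bullet> (a * ee k 1) - G 0 \<bullet> (a * ee k 0))) {0..1}"
    proof (rule fundamental_theorem_of_calculus)
      fix t :: real assume t: "t \<in> {0..1}"
      have "((\<lambda>t. a * ee k t) has_vector_derivative a * (2 * pi * \<i> * of_int k * ee k t)) (at t within {0..1})"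
        by (intro has_vector_derivative_mult_right ee_has_vector_derivative)
      from bounded_bilinear.has_vector_derivative[OF bounded_bilinear_inner dG[OF t] this]
      show "((\<lambda>t. G t \<bullet> (a * ee k t)) has_vector_derivative G t \<bullet> (2 * pi * \<i> * of_int k * (a * ee k t)) + (a * ee k t) \<bullet> g t) (at t within {0..1})"
        by (simp add: mult.left_commute inner_commute)
    qed simp
    then show ?thesis by (simp add: G01)
  qed
  have VG: "integral {0..1} (\<lambda>t. (V t - G t) \<bullet> (2 * pi * \<i> * of_int k * (a * ee k t))) = 0" for k a
  proof -
    have "((\<lambda>t. V t \<bullet> (2 * pi * \<i> * of_int k * (a * ee k t)) + (a * ee k t) \<bullet> g t) has_integral 0) {0..1}"
      using weak[of k a] by (auto simp: has_integral_iff intro!: integrable_continuous_real continuous_intros V g)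
    from has_integral_diff[OF this parts[of k a]] show ?thesis by (simp add: inner_diff_left integral_unique)
  qed
  define \<kappa> where "\<kappa> = integral {0..1} (\<lambda>t. V t - G t)"
  define h where "h t = V t - G t - \<kappa>" for t
  have ch: "continuous_on {0..1} h" unfolding h_def by (intro continuous_intros V cG)
  have \<kappa>: "((\<lambda>t. V t - G t) has_integral \<kappa>) {0..1}"
    unfolding \<kappa>_def by (intro integrable_integral integrable_continuous_real continuous_intros V cG)
  have orth: "integral {0..1} (\<lambda>t. h t \<bullet> (a * ee k t)) = 0" for k a
  proof (cases "k = 0")
    case True
    have "((\<lambda>t. (V t - G t - \<kappa>) \<bullet> a) has_integral (\<kappa> - \<kappa>) \<bullet> a) {0..1}"
      using has_integral_const_real[of \<kappa> 0 1] by (intro has_integral_inner_left has_integral_diff \<kappa>) simp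
    then show ?thesis using True by (simp add: h_def integral_unique)
  next
    case False
    define z where "z = 2 * pi * \<i> * of_int k"
    have z: "z \<noteq> 0" using False by (simp add: z_def)
    have "((\<lambda>t. \<kappa> \<bullet> (a * ee k t)) has_integral \<kappa> \<bullet> (a * (if k = 0 then 1 else 0))) {0..1}"
      by (intro has_integral_inner_right has_integral_mult_right ee_has_integral)
    then have i1: "((\<lambda>t. \<kappa> \<bullet> (a * ee k t)) has_integral 0) {0..1}" using False by simp
    have "((\<lambda>t. (V t - G t) \<bullet> (z * ((a / z) * ee k t))) has_integral 0) {0..1}"
      using VG[of k "a / z"] z unfolding z_def[symmetric]
      by (auto simp: has_integral_iff intro!: integrable_continuous_real continuous_intros V cG)
    then have "((\<lambda>t. (V t - G t) \<bullet> (a * ee k t)) has_integral 0) {0..1}"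
      using z by (simp add: mult.assoc[symmetric])
    from has_integral_diff[OF this i1] show ?thesis by (simp add: h_def inner_diff_left integral_unique)
  qed
  have h0: "h t = 0" if "0 < t" "t < 1" for t by (rule trig_system_complete[OF ch orth that])
  have "h t = 0" if t: "t \<in> {0..1}" for t
  proof -
    have "closure {0<..<1::real} \<subseteq> {0..1}" by simp
    then have "continuous_on (closure {0<..<1}) h" using ch continuous_on_subset by blast
    then show ?thesis
      by (rule continuous_constant_on_closure) (use h0 t in auto)
  qed
  then show ?thesis by (intro exI[of _ \<kappa>]) (auto simp: h_def G_def algebra_simps)
qed

section \<open>Passage to the limit\<close>

text \<open>Integration by parts in Fourier coefficients: the pairing of u' with u''' is minus the
  squared L2 norm of u''.\<close>

lemma bienergy_second_derivative:
  "bienergy n c (dc (dc c)) = - (\<Sum>k\<in>modes n. (norm (dc (dc c) k))\<^sup>2)"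
  unfolding bienergy_def sum_negf[symmetric]
proof (rule sum.cong[OF refl])
  fix k :: int
  define a where "a = dc c k"
  define m where "m = 2 * pi * real_of_int k"
  have d: "dc e k = \<i> * of_real m * e k" for e by (simp add: dc_def m_def mult_ac)
  have "a \<bullet> (\<i> * of_real m * (\<i> * of_real m * a)) = - (norm (\<i> * of_real m * a))\<^sup>2"
    by (simp only: norm_mult power_mult_distrib cmod_power2 inner_complex_def)
       (simp add: power2_eq_square algebra_simps)
  then show "dc c k \<bullet> dc (dc (dc c)) k = - (norm (dc (dc c) k))\<^sup>2"
    by (simp add: d[of "dc (dc c)"] d[of "dc c"] a_def[symmetric])
qed

text \<open>Testing the Euler-Lagrange equation with the second derivative is allowed because trigonometric polynomials are
  closed under differentiation.\<close>

lemma second_derivative_bound: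
  assumes f: "continuous_on UNIV f" and M: "\<And>p. \<bar>f p\<bar> \<le> M"
    and L: "L = sqrt (energy n c)" "L > 0"
    and EL: "bienergy n c (dc (dc c)) / L + dflux f (tp n c) (tp n (dc c)) (tp n (dc (dc c))) = \<mu> * biarea n c (dc (dc c))"
  shows "((\<lambda>t. (norm (tp n (dc (dc c)) t))\<^sup>2) has_integral (\<Sum>k\<in>modes n. (norm (dc (dc c) k))\<^sup>2)) {0..1}"
    "(\<Sum>k\<in>modes n. (norm (dc (dc c) k))\<^sup>2) \<le> (L\<^sup>2 * (M + \<bar>\<mu>\<bar>))\<^sup>2"
proof -
  define S where "S = (\<Sum>k\<in>modes n. (norm (dc (dc c) k))\<^sup>2)"
  define u where "u = tp n c"
  define v where "v = tp n (dc c)"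
  define w where "w = tp n (dc (dc c))"
  define A where "A = L * (M + \<bar>\<mu>\<bar>)"
  have u: "loop u v" unfolding u_def v_def by (rule loop_tp)
  have cw: "continuous_on {0..1} w" unfolding w_def by (rule continuous_on_tp)
  have M0: "M \<ge> 0" using M[of 0] by simp
  have iw: "((\<lambda>t. (norm (w t))\<^sup>2) has_integral S) {0..1}"
    using parseval_tp[of n "dc (dc c)" "dc (dc c)"] by (simp add: w_def S_def power2_norm_eq_inner)
  then show "((\<lambda>t. (norm (tp n (dc (dc c)) t))\<^sup>2) has_integral (\<Sum>k\<in>modes n. (norm (dc (dc c) k))\<^sup>2)) {0..1}"
    by (simp add: w_def S_def)
  have iv: "((\<lambda>t. (norm (v t))\<^sup>2) has_integral L\<^sup>2) {0..1}"
    using energy_integral[of n c] energy_nonneg[of n c] by (simp add: v_def L)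
  have id: "((\<lambda>t. f (u t) * (w t \<bullet> (\<i> * v t))) has_integral dflux f u v w) {0..1}"
    unfolding dflux_def by (intro integrable_integral integrable_continuous_real dflux_continuous[OF f u cw])
  have ib: "((\<lambda>t. w t \<bullet> (\<i> * v t)) has_integral biarea n c (dc (dc c))) {0..1}"
    unfolding w_def v_def by (rule biarea_integral)
  have "- S / L + dflux f u v w = \<mu> * biarea n c (dc (dc c))"
    using EL bienergy_second_derivative[of n c] by (simp add: S_def u_def v_def w_def)
  then have "S = L * (dflux f u v w - \<mu> * biarea n c (dc (dc c)))"
    using L(2) by (simp add: field_simps)
  moreover have "((\<lambda>t. L * (f (u t) * (w t \<bullet> (\<i> * v t)) - \<mu> * (w t \<bullet> (\<i> * v t)))) has_integral
      L * (dflux f u v w - \<mu> * biarea n c (dc (dc c)))) {0..1}"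
    by (intro has_integral_mult_right has_integral_diff id ib)
  ultimately have iS: "((\<lambda>t. L * (f (u t) * (w t \<bullet> (\<i> * v t)) - \<mu> * (w t \<bullet> (\<i> * v t)))) has_integral S) {0..1}"
    by simp
  \<comment> \<open>Young's inequality with weight A; the half of S that appears on the right is
    absorbed.\<close>
  have "((\<lambda>t. (norm (w t))\<^sup>2 / 2 + A\<^sup>2 / 2 * (norm (v t))\<^sup>2) has_integral S / 2 + A\<^sup>2 / 2 * L\<^sup>2) {0..1}"
    by (intro has_integral_add has_integral_divide has_integral_mult_right iw iv)
  from has_integral_le[OF iS this] have "S \<le> S / 2 + A\<^sup>2 / 2 * L\<^sup>2"
  proof this
    fix t
    have "\<bar>f (u t) - \<mu>\<bar> \<le> M + \<bar>\<mu>\<bar>" using M[of "u t"] by linarith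
    then have "\<bar>L * ((f (u t) - \<mu>) * (w t \<bullet> (\<i> * v t)))\<bar> \<le> L * ((M + \<bar>\<mu>\<bar>) * (norm (w t) * norm (v t)))"
      unfolding abs_mult using L(2) M0 norm_inner_times_i[of "w t" "v t"]
      by (intro mult_mono) auto
    also have "\<dots> = norm (w t) * (A * norm (v t))" by (simp add: A_def mult_ac)
    also have "\<dots> \<le> (norm (w t))\<^sup>2 / 2 + (A * norm (v t))\<^sup>2 / 2"
      using sum_squares_bound[of "norm (w t)" "A * norm (v t)"] by simp
    finally show "L * (f (u t) * (w t \<bullet> (\<i> * v t)) - \<mu> * (w t \<bullet> (\<i> * v t))) \<le> (norm (w t))\<^sup>2 / 2 + A\<^sup>2 / 2 * (norm (v t))\<^sup>2"
      by (simp add: left_diff_distrib power_mult_distrib)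
  qed
  then have "S \<le> A\<^sup>2 * L\<^sup>2" by simp
  also have "\<dots> = (L\<^sup>2 * (M + \<bar>\<mu>\<bar>))\<^sup>2" by (simp add: A_def power_mult_distrib power2_eq_square mult_ac)
  finally show "(\<Sum>k\<in>modes n. (norm (dc (dc c) k))\<^sup>2) \<le> (L\<^sup>2 * (M + \<bar>\<mu>\<bar>))\<^sup>2"
    by (simp add: S_def)
qed

section \<open>Compactness of the approximating curves\<close>

text \<open>The one-dimensional Sobolev embedding: the fundamental theorem of calculus followed by
  Cauchy-Schwarz on [s, t].\<close>

lemma holder_half_bound:
  fixes v w :: "real \<Rightarrow> complex"
  assumes dv: "\<And>t. (v has_vector_derivative w t) (at t)" and cw: "continuous_on UNIV w"
    and K: "K \<ge> 0" "integral {0..1} (\<lambda>t. (norm (w t))\<^sup>2) \<le> K\<^sup>2"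
    and st: "s \<in> {0..1}" "t \<in> {0..1}"
  shows "norm (v t - v s) \<le> K * sqrt \<bar>t - s\<bar>"
proof -
  have *: "norm (v t - v s) \<le> K * sqrt \<bar>t - s\<bar>" if "s \<le> t" "s \<in> {0..1}" "t \<in> {0..1}" for s t
  proof -
    have cw': "continuous_on S w" for S using cw continuous_on_subset by blast
    have "(w has_integral (v t - v s)) {s..t}"
      by (rule fundamental_theorem_of_calculus) (use that dv in \<open>auto intro: has_vector_derivative_at_within\<close>)
    then have "norm (v t - v s) = norm (integral {s..t} w)" by (simp add: integral_unique)
    also have "\<dots> \<le> integral {s..t} (\<lambda>t. norm (w t))"
      by (rule integral_norm_bound_integral) (auto intro!: integrable_continuous_real continuous_intros cw')
    finally have "(norm (v t - v s))\<^sup>2 \<le> (integral {s..t} (\<lambda>t. norm (w t)))\<^sup>2" by (rule power_mono) simp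
    also have "\<dots> \<le> (t - s) * integral {s..t} (\<lambda>t. (norm (w t))\<^sup>2)"
      by (rule integral_norm_Cauchy_Schwarz[OF cw' that(1)])
    also have "\<dots> \<le> (t - s) * K\<^sup>2"
    proof (rule mult_left_mono)
      have "integral {s..t} (\<lambda>t. (norm (w t))\<^sup>2) \<le> integral {0..1} (\<lambda>t. (norm (w t))\<^sup>2)"
        by (rule integral_subset_le) (use that in \<open>auto intro!: integrable_continuous_real continuous_intros cw'\<close>)
      then show "integral {s..t} (\<lambda>t. (norm (w t))\<^sup>2) \<le> K\<^sup>2" using K(2) by simp
    qed (use that in simp)
    also have "\<dots> = (K * sqrt \<bar>t - s\<bar>)\<^sup>2" using that by (simp add: power_mult_distrib)
    finally show ?thesis by (rule power2_le_imp_le) (use K in simp)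
  qed
  show ?thesis
    using *[of s t] *[of t s] st by (cases "s \<le> t") (auto simp: norm_minus_commute abs_minus_commute)
qed

text \<open>The velocity of a closed curve has mean zero, so v t is the average over s of v t - v
  s.\<close>

lemma loop_velocity_bound:
  assumes u: "loop u v" and h: "\<And>s t. s \<in> {0..1} \<Longrightarrow> t \<in> {0..1} \<Longrightarrow> norm (v t - v s) \<le> K * sqrt \<bar>t - s\<bar>"
    and K: "K \<ge> 0" and t: "t \<in> {0..1}"
  shows "norm (v t) \<le> K"
proof -
  have "(v has_integral (u 1 - u 0)) {0..1}" by (rule loop_has_integral[OF u]) simp
  then have "((\<lambda>s. v t - v s) has_integral (v t - 0)) {0..1}"
    using loopD(4)[OF u] has_integral_const_real[of "v t" 0 1] by (intro has_integral_diff) auto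
  then have "v t = integral {0..1} (\<lambda>s. v t - v s)" by (simp add: integral_unique)
  also have "norm \<dots> \<le> K * (1 - 0)"
  proof (rule integral_bound)
    show "continuous_on {0..1} (\<lambda>s. v t - v s)" by (intro continuous_intros loopD[OF u])
    show "norm (v t - v s) \<le> K" if s: "s \<in> {0..1}" for s
    proof -
      have "sqrt \<bar>t - s\<bar> \<le> 1" using s t by (intro real_le_lsqrt) auto
      then have "K * sqrt \<bar>t - s\<bar> \<le> K * 1" by (rule mult_left_mono) (rule K)
      then show ?thesis using h[OF s t] by simp
    qed
  qed simp
  finally show ?thesis by simp
qed

lemma loop_lipschitz:
  assumes u: "loop u v" and K: "\<And>t. t \<in> {0..1} \<Longrightarrow> norm (v t) \<le> K" and st: "s \<in> {0..1}" "t \<in> {0..1}"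
  shows "norm (u t - u s) \<le> K * \<bar>t - s\<bar>"
proof -
  have *: "norm (u t - u s) \<le> K * \<bar>t - s\<bar>" if "s \<le> t" "s \<in> {0..1}" "t \<in> {0..1}" for s t
  proof -
    have "(v has_integral (u t - u s)) {s..t}" by (rule loop_has_integral[OF u that(1)])
    then have "norm (u t - u s) = norm (integral {s..t} v)" by (simp add: integral_unique)
    also have "\<dots> \<le> K * (t - s)" by (rule integral_bound) (use that K in \<open>auto intro: loopD[OF u]\<close>)
    finally show ?thesis using that by simp
  qed
  show ?thesis
    using *[of s t] *[of t s] st by (cases "s \<le> t") (auto simp: norm_minus_commute abs_minus_commute)
qed

lemma loop_bounded_by:
  assumes u: "loop u v" and K: "\<And>t. t \<in> {0..1} \<Longrightarrow> norm (v t) \<le> K" and "norm (u 0) \<le> B" and t: "t \<in> {0..1}"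
  shows "norm (u t) \<le> B + K"
proof -
  have "norm (u t - u 0) \<le> K * \<bar>t - 0\<bar>" by (rule loop_lipschitz[OF u K]) (use t in auto)
  also have "\<dots> \<le> K * 1"
    using t order_trans[OF norm_ge_zero K[OF t]] by (intro mult_left_mono) auto
  finally show ?thesis using norm_triangle_sub[of "u t" "u 0"] assms(3) by simp
qed

text \<open>The Arzela-Ascoli theorem for the pair (u, v), so that one subsequence serves the curve
  and its velocity.\<close>

lemma c1_compactness:
  fixes u v :: "nat \<Rightarrow> real \<Rightarrow> complex"
  assumes l: "\<And>j. loop (u j) (v j)" and B: "\<And>j. norm (u j 0) \<le> B"
    and h: "\<And>j s t. s \<in> {0..1} \<Longrightarrow> t \<in> {0..1} \<Longrightarrow> norm (v j t - v j s) \<le> K * sqrt \<bar>t - s\<bar>" and K: "K \<ge> 0"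
  obtains r U V where "strict_mono (r :: nat \<Rightarrow> nat)" "continuous_on {0..1} U" "continuous_on {0..1} V"
    "\<And>t. t \<in> {0..1} \<Longrightarrow> (\<lambda>j. u (r j) t) \<longlonglongrightarrow> U t" "\<And>t. t \<in> {0..1} \<Longrightarrow> (\<lambda>j. v (r j) t) \<longlonglongrightarrow> V t"
proof -
  have vK: "norm (v j t) \<le> K" if "t \<in> {0..1}" for j t by (rule loop_velocity_bound[OF l h K that])
  have lip: "norm (u j t - u j s) \<le> K * \<bar>t - s\<bar>" if "s \<in> {0..1}" "t \<in> {0..1}" for j s t
    by (rule loop_lipschitz[OF l vK that])
  have uB: "norm (u j t) \<le> B + K" if "t \<in> {0..1}" for j t by (rule loop_bounded_by[OF l vK B that])
  define F where "F j t = (u j t, v j t)" for j t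
  obtain g r where g: "continuous_on {0..1} g" "strict_mono (r :: nat \<Rightarrow> nat)"
    "\<And>e. 0 < e \<Longrightarrow> \<exists>N. \<forall>n x. n \<ge> N \<and> x \<in> {0..1} \<longrightarrow> norm (F (r n) x - g x) < e"
  proof (rule Arzela_Ascoli[of "{0..1}" F "(B + K) + K"])
    show "compact {0..1::real}" by simp
    show "norm (F j t) \<le> (B + K) + K" if "t \<in> {0..1}" for j t
      unfolding F_def by (rule order_trans[OF norm_Pair_le add_mono[OF uB[OF that] vK[OF that]]])
    fix x e :: real assume x: "x \<in> {0..1}" and e: "0 < e"
    \<comment> \<open>Each component may vary by less than e/2: u is Lipschitz, which asks for
      distance d1, and v is Hoelder of exponent 1/2, which asks for d1^2.\<close>
    define d1 where "d1 = e / (2 * (K + 1))"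
    have d1: "d1 > 0" "K * d1 < e / 2" using e K by (auto simp: d1_def field_simps)
    show "\<exists>d>0. \<forall>n y. y \<in> {0..1} \<and> norm (x - y) < d \<longrightarrow> norm (F n x - F n y) < e"
    proof (intro exI[of _ "min d1 (d1\<^sup>2)"] conjI allI impI)
      show "0 < min d1 (d1\<^sup>2)" using d1 by simp
      fix n y assume "y \<in> {0..1} \<and> norm (x - y) < min d1 (d1\<^sup>2)"
      then have y: "y \<in> {0..1}" "\<bar>x - y\<bar> \<le> d1" "\<bar>x - y\<bar> \<le> d1\<^sup>2" by auto
      have "norm (u n x - u n y) \<le> K * d1"
        using lip[OF y(1) x] mult_left_mono[OF y(2) K] by (rule order_trans)
      moreover have "sqrt \<bar>x - y\<bar> \<le> d1" by (rule real_le_lsqrt) (use y d1 in auto)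
      then have "norm (v n x - v n y) \<le> K * d1"
        using h[OF y(1) x, of n] mult_left_mono[OF _ K] order_trans by blast
      moreover have "norm (F n x - F n y) \<le> norm (u n x - u n y) + norm (v n x - v n y)"
        by (simp add: F_def norm_Pair_le)
      ultimately show "norm (F n x - F n y) < e" using d1(2) by linarith
    qed
  qed blast
  have lim: "(\<lambda>j. F (r j) t) \<longlonglongrightarrow> g t" if "t \<in> {0..1}" for t
    unfolding LIMSEQ_def dist_norm using g(3) that by meson
  show ?thesis
  proof (rule that[of r "\<lambda>t. fst (g t)" "\<lambda>t. snd (g t)"])
    show "(\<lambda>j. u (r j) t) \<longlonglongrightarrow> fst (g t)" if "t \<in> {0..1}" for t
      using tendsto_fst[OF lim[OF that]] by (simp add: F_def)
    show "(\<lambda>j. v (r j) t) \<longlonglongrightarrow> snd (g t)" if "t \<in> {0..1}" for t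
      using tendsto_snd[OF lim[OF that]] by (simp add: F_def)
  qed (use g in \<open>auto intro!: continuous_intros\<close>)
qed

lemma has_vector_derivative_of_integral:
  fixes g :: "real \<Rightarrow> complex"
  assumes "continuous_on {0..1} g" "\<And>t. t \<in> {0..1} \<Longrightarrow> G t = a + integral {0..t} g" and t: "t \<in> {0..1}"
  shows "(G has_vector_derivative g t) (at t within {0..1})"
proof -
  have "((\<lambda>t. a + integral {0..t} g) has_vector_derivative 0 + g t) (at t within {0..1})"
    by (intro has_vector_derivative_add has_vector_derivative_const integral_has_vector_derivative assms)
  then show ?thesis
    by (intro has_vector_derivative_transform[OF t assms(2)]) simp_all
qed

text \<open>The relation between curve and velocity passes to the limit in integrated form and is
  differentiated afterwards.\<close>

lemma loop_limit_derivative: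
  assumes l: "\<And>j. loop (u j) (v j)" and K: "\<And>j t. t \<in> {0..1} \<Longrightarrow> norm (v j t) \<le> K"
    and V: "continuous_on {0..1} V"
    and lim: "\<And>t. t \<in> {0..1} \<Longrightarrow> (\<lambda>j. u j t) \<longlonglongrightarrow> U t" "\<And>t. t \<in> {0..1} \<Longrightarrow> (\<lambda>j. v j t) \<longlonglongrightarrow> V t"
    and t: "t \<in> {0..1}"
  shows "(U has_vector_derivative V t) (at t within {0..1})"
proof -
  have eq: "U t = U 0 + integral {0..t} V" if t: "t \<in> {0..1}" for t
  proof -
    have "(\<lambda>j. integral {0..t} (v j)) \<longlonglongrightarrow> integral {0..t} V"
      by (rule dominated_convergence(2)[where h="\<lambda>t. K"])
         (use t K lim(2) in \<open>auto intro!: integrable_continuous_real loopD[OF l]\<close>)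
    moreover have "integral {0..t} (v j) = u j t - u j 0" for j
      by (rule integral_unique, rule loop_has_integral[OF l]) (use t in simp)
    moreover have "(\<lambda>j. u j t - u j 0) \<longlonglongrightarrow> U t - U 0"
      by (intro tendsto_intros lim) (use t in auto)
    ultimately have "U t - U 0 = integral {0..t} V" by (simp add: LIMSEQ_unique)
    then show ?thesis by (simp add: algebra_simps)
  qed
  show ?thesis by (rule has_vector_derivative_of_integral[OF V eq t])
qed

section \<open>From a profile on the unit interval to a closed curve\<close>

lemma has_vector_derivative_within_union:
  assumes "(f has_vector_derivative D) (at x within S)" "(f has_vector_derivative D) (at x within T)"
  shows "(f has_vector_derivative D) (at x within (S \<union> T))"
  using assms unfolding has_vector_derivative_def has_derivative_within
  unfolding at_within_union by (elim conjE) (intro conjI filterlim_sup; assumption)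

text \<open>At an integer the one-sided derivatives come from adjacent periods and match because V 1
  = V 0.\<close>

lemma periodic_extension_has_vector_derivative:
  fixes U V :: "real \<Rightarrow> complex"
  assumes d: "\<And>t. t \<in> {0..1} \<Longrightarrow> (U has_vector_derivative V t) (at t within {0..1})"
    and "U 1 = U 0" "V 1 = V 0"
  shows "((\<lambda>t. U (frac t)) has_vector_derivative V (frac t)) (at t)"
proof -
  \<comment> \<open>The right endpoint is included: there \<open>frac t\<close> jumps to 0, and U 1
    = U 0 repairs the value.\<close>
  have P: "U (frac t) = U (t - of_int m)" if "t \<in> {of_int m..of_int m + 1}" for t m
  proof (cases "t = of_int m + 1")
    case True
    then have "frac t = 0" by (metis frac_eq_0_iff Ints_of_int of_int_1 of_int_add)
    then show ?thesis using True assms(2) by simp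
  next
    case False
    with that have "\<lfloor>t\<rfloor> = m" by (intro floor_unique) auto
    then show ?thesis by (simp add: frac_def)
  qed
  have dP: "((\<lambda>t. U (frac t)) has_vector_derivative V (t - of_int m)) (at t within {of_int m..of_int m + 1})"
    if t: "t \<in> {of_int m..of_int m + 1}" for t m
  proof -
    have im: "(\<lambda>t. t - real_of_int m) ` {of_int m..of_int m + 1} = {0..1}"
      by (auto simp: image_def intro!: bexI[of _ "x + real_of_int m" for x])
    have "((\<lambda>t. t - real_of_int m) has_vector_derivative 1) (at t within {of_int m..of_int m + 1})"
      by (auto intro!: derivative_eq_intros)
    from vector_diff_chain_within[OF this, of U "V (t - of_int m)"]
    have "(U \<circ> (\<lambda>t. t - real_of_int m) has_vector_derivative V (t - of_int m)) (at t within {of_int m..of_int m + 1})"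
      using d[of "t - of_int m"] t im by simp
    then show ?thesis
      by (rule has_vector_derivative_transform[OF t, rotated]) (simp add: P)
  qed
  define m where "m = \<lfloor>t\<rfloor>"
  have m: "of_int m \<le> t" "t < of_int m + 1" by (auto simp: m_def)
  show ?thesis
  proof (cases "t = of_int m")
    case False
    then have t: "of_int m < t" "t < of_int m + 1" using m by auto
    have "frac t = t - of_int m" by (simp add: frac_def m_def)
    then show ?thesis using dP[of t m] t by (simp add: at_within_Icc_at)
  next
    case True
    have f: "frac t = 0" using True by simp
    have "((\<lambda>t. U (frac t)) has_vector_derivative V 0) (at t within {of_int (m - 1)..of_int (m - 1) + 1})"
      using dP[of t "m - 1"] True assms(3) by simp
    moreover have "((\<lambda>t. U (frac t)) has_vector_derivative V 0) (at t within {of_int m..of_int m + 1})"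
      using dP[of t m] True by simp
    ultimately have "((\<lambda>t. U (frac t)) has_vector_derivative V 0)
        (at t within ({of_int (m - 1)..of_int (m - 1) + 1} \<union> {of_int m..of_int m + 1}))"
      by (rule has_vector_derivative_within_union)
    moreover have "{of_int (m - 1)..of_int (m - 1) + 1} \<union> {of_int m..of_int m + 1} = {t - 1..t + 1}"
      using True by auto
    ultimately have "((\<lambda>t. U (frac t)) has_vector_derivative V 0) (at t)"
      using at_within_Icc_at[of "t - 1" t "t + 1"] by simp
    then show ?thesis unfolding f .
  qed
qed

lemma integral_01_frac:
  "integral {0..1} (\<lambda>t::real. F t) = integral {0..1} (\<lambda>t. F (frac t))" for F :: "real \<Rightarrow> 'a::banach"
proof -
  \<comment> \<open>On [0,1] the functions t and \<open>frac t\<close> differ at t = 1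
    alone.\<close>
  have "negligible {1::real}" by simp
  then show ?thesis
  proof (rule integral_spike)
    fix t :: real assume "t \<in> {0..1} - {1}"
    then have "frac t = t" by (simp add: frac_eq)
    then show "F (frac t) = F t" by simp
  qed
qed

text \<open>The acceleration is a real multiple of i times the velocity, hence orthogonal to it, so
  the speed is constant and by the energy identity equal to L. The factor L in the equation is what
  the curvature formula at speed L requires.\<close>

theorem closed_curve_of_profile:
  fixes U V :: "real \<Rightarrow> complex" and f :: "complex \<Rightarrow> real"
  assumes f: "continuous_on UNIV f" and L: "L > 0"
    and dU: "\<And>t. t \<in> {0..1} \<Longrightarrow> (U has_vector_derivative V t) (at t within {0..1})"
    and dV: "\<And>t. t \<in> {0..1} \<Longrightarrow> (V has_vector_derivative (L * (f (U t) - \<mu>)) *\<^sub>R (\<i> * V t)) (at t within {0..1})"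
    and per: "U 1 = U 0" "V 1 = V 0"
    and area: "integral {0..1} (\<lambda>t. U t \<bullet> (\<i> * V t)) = 2 * \<tau>"
    and energy: "integral {0..1} (\<lambda>t. (norm (V t))\<^sup>2) = L\<^sup>2"
  shows "\<exists>u. C2_periodic u \<and> (\<forall>t. vd u t \<noteq> 0) \<and> area u = \<tau> \<and> (\<forall>t. curvature u t = f (u t) - \<mu>)"
proof -
  define u where "u t = U (frac t)" for t
  define v where "v t = V (frac t)" for t
  define w where "w t = (L * (f (u t) - \<mu>)) *\<^sub>R (\<i> * v t)" for t
  have du: "(u has_vector_derivative v t) (at t)" for t
    unfolding u_def[abs_def] v_def by (rule periodic_extension_has_vector_derivative[OF dU per])
  have dv: "(v has_vector_derivative w t) (at t)" for t
    unfolding u_def v_def[abs_def] w_def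
    by (rule periodic_extension_has_vector_derivative[OF dV]) (simp_all add: per)
  have cu: "continuous_on UNIV u" and cv: "continuous_on UNIV v"
    using has_vector_derivative_continuous[OF du] has_vector_derivative_continuous[OF dv]
    by (simp_all add: continuous_at_imp_continuous_on)
  have cw: "continuous_on UNIV w"
    unfolding w_def by (intro continuous_intros cv continuous_on_compose_UNIV[OF f] cu)
  have vdu: "vd u t = v t" for t unfolding vd_def using du by (rule vector_derivative_at)
  then have "vd u = v" by (rule ext)
  then have vdv: "vd (vd u) t = w t" for t unfolding vd_def using dv by (simp add: vector_derivative_at)
  have "u (t + 1) = u t" for t by (simp add: u_def frac_1_eq)
  then have C2: "C2_periodic u" unfolding C2_periodic_def using du dv cw by blast
  have "((\<lambda>t. v t \<bullet> v t) has_vector_derivative 0) (at t within UNIV)" for t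
  proof -
    have "((\<lambda>t. v t \<bullet> v t) has_vector_derivative (v t \<bullet> w t + w t \<bullet> v t)) (at t)"
      by (rule bounded_bilinear.has_vector_derivative[OF bounded_bilinear_inner dv dv])
    moreover have "v t \<bullet> w t + w t \<bullet> v t = 0"
      by (simp add: w_def inner_commute[of _ "v t"] inner_times_i)
    ultimately show ?thesis by simp
  qed
  then obtain C where C: "\<And>t. v t \<bullet> v t = C"
    using has_vector_derivative_zero_constant[of UNIV "\<lambda>t. v t \<bullet> v t"] by auto
  have "integral {0..1} (\<lambda>t. (norm (v t))\<^sup>2) = L\<^sup>2"
    using integral_01_frac[of "\<lambda>t. (norm (V t))\<^sup>2"] energy by (simp add: v_def)
  then have "C = L\<^sup>2" using C by (simp add: power2_norm_eq_inner)
  then have nv: "norm (v t) = L" for t using C[of t] L by (simp add: norm_eq_sqrt_inner)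
  have nz: "v t \<noteq> 0" for t using nv[of t] L by auto
  have ar: "area u = \<tau>"
    using integral_01_frac[of "\<lambda>t. U t \<bullet> (\<i> * V t)"] area by (simp add: area_def vdu u_def v_def)
  have cu: "curvature u t = f (u t) - \<mu>" for t
  proof -
    have "(\<i> * v t) \<bullet> w t = (L * (f (u t) - \<mu>)) * (norm (\<i> * v t))\<^sup>2"
      by (simp only: w_def inner_scaleR_right power2_norm_eq_inner)
    also have "\<dots> = (f (u t) - \<mu>) * L ^ 3" by (simp add: norm_mult nv power3_eq_cube power2_eq_square)
    finally show ?thesis using L by (simp add: curvature_def vdu vdv nv)
  qed
  show ?thesis using C2 nz ar cu vdu by auto
qed

section \<open>The limit of the minimisers\<close>

lemma single_mode:
  assumes "\<bar>k\<bar> \<le> int n"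
  shows "tp n (\<lambda>i. if i = k then a else 0) = (\<lambda>t. a * ee k t)"
    "tp n (dc (\<lambda>i. if i = k then a else 0)) = (\<lambda>t. 2 * pi * \<i> * of_int k * (a * ee k t))"
proof -
  have sum: "(\<Sum>i\<in>modes n. if i = k then F i else 0) = F k" for F :: "int \<Rightarrow> complex"
    using assms by (subst sum.delta) auto
  show "tp n (\<lambda>i. if i = k then a else 0) = (\<lambda>t. a * ee k t)"
  proof
    fix t
    have "tp n (\<lambda>i. if i = k then a else 0) t = (\<Sum>i\<in>modes n. if i = k then a * ee i t else 0)"
      unfolding tp_def by (rule sum.cong) auto
    then show "tp n (\<lambda>i. if i = k then a else 0) t = a * ee k t" by (simp only: sum)
  qed
  show "tp n (dc (\<lambda>i. if i = k then a else 0)) = (\<lambda>t. 2 * pi * \<i> * of_int k * (a * ee k t))"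
  proof
    fix t
    have "tp n (dc (\<lambda>i. if i = k then a else 0)) t = (\<Sum>i\<in>modes n. if i = k then 2 * pi * \<i> * of_int i * (a * ee i t) else 0)"
      unfolding tp_def dc_def by (rule sum.cong) auto
    then show "tp n (dc (\<lambda>i. if i = k then a else 0)) t = 2 * pi * \<i> * of_int k * (a * ee k t)" by (simp only: sum)
  qed
qed

text \<open>Second derivatives are bounded in L2 but are not shown to converge, so the equation is
  passed to the limit against fixed modes and the second derivative is regained from
  \<open>weak_derivative_is_derivative\<close>. The degree is \<open>Suc n\<close> so that the modes
  1 and -1 are always available.\<close>

theorem galerkin_limit:
  assumes f: "continuous_on UNIV f" and M: "\<And>p. \<bar>f p\<bar> \<le> M" and \<tau>: "\<tau> \<noteq> 0"
    and ar: "\<And>n. tarea (Suc n) (c n) = \<tau>"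
    and l: "\<And>n. sqrt (energy (Suc n) (c n)) \<le> l" and R: "\<And>n. norm (tp (Suc n) (c n) 0) \<le> R"
    and EL: "\<And>n d. bienergy (Suc n) (c n) d / sqrt (energy (Suc n) (c n)) +
        dflux f (tp (Suc n) (c n)) (tp (Suc n) (dc (c n))) (tp (Suc n) d) = \<mu> n * biarea (Suc n) (c n) d"
    and \<mu>: "\<And>n. \<bar>\<mu> n\<bar> \<le> \<mu>0"
  shows "\<exists>u \<mu>. C2_periodic u \<and> (\<forall>t. vd u t \<noteq> 0) \<and> area u = \<tau> \<and> (\<forall>t. curvature u t = f (u t) - \<mu>)"
proof -
  define u where "u n = tp (Suc n) (c n)" for n
  define v where "v n = tp (Suc n) (dc (c n))" for n
  define w where "w n = tp (Suc n) (dc (dc (c n)))" for n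
  define L where "L n = sqrt (energy (Suc n) (c n))" for n
  have lp: "loop (u n) (v n)" for n unfolding u_def v_def by (rule loop_tp)
  \<comment> \<open>The isoperimetric inequality keeps curves of area \<tau> from collapsing, so
    that L' is positive.\<close>
  define L0 where "L0 = sqrt (4 * pi * \<bar>\<tau>\<bar>)"
  have L0: "L0 > 0" "L0 \<le> L n" for n
    using \<tau> isoperimetric_tp[of "Suc n" "c n"] by (auto simp: L0_def L_def ar)
  have Lp: "L n > 0" for n using L0(1) L0(2)[of n] by linarith
  have M0: "M \<ge> 0" using M[of 0] by simp
  define K where "K = l\<^sup>2 * (M + \<mu>0)"
  have K: "K \<ge> 0" using M0 \<mu>[of 0] by (simp add: K_def)
  have S: "integral {0..1} (\<lambda>t. (norm (w n t))\<^sup>2) \<le> K\<^sup>2" for n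
  proof -
    have "integral {0..1} (\<lambda>t. (norm (w n t))\<^sup>2) \<le> ((L n)\<^sup>2 * (M + \<bar>\<mu> n\<bar>))\<^sup>2"
      using second_derivative_bound[OF f M L_def Lp EL[of n, folded L_def]] by (simp add: w_def integral_unique)
    also have "\<dots> \<le> K\<^sup>2"
      unfolding K_def using l[of n] Lp[of n] M0 \<mu>[of n]
      by (intro power_mono mult_mono add_mono) (auto simp: L_def)
    finally show ?thesis .
  qed
  have h: "norm (v n t - v n s) \<le> K * sqrt \<bar>t - s\<bar>" if "s \<in> {0..1}" "t \<in> {0..1}" for n s t
    by (rule holder_half_bound[OF _ _ K S[of n] that]) (simp_all add: v_def w_def tp_has_vector_derivative continuous_on_tp)
  obtain r U V where r: "strict_mono (r :: nat \<Rightarrow> nat)" and cUV: "continuous_on {0..1} U" "continuous_on {0..1} V"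
    and limr: "\<And>t. t \<in> {0..1} \<Longrightarrow> (\<lambda>j. u (r j) t) \<longlonglongrightarrow> U t" "\<And>t. t \<in> {0..1} \<Longrightarrow> (\<lambda>j. v (r j) t) \<longlonglongrightarrow> V t"
  proof (rule c1_compactness[of u v R K])
    show "norm (u j 0) \<le> R" for j using R by (simp add: u_def)
    show "norm (v j t - v j s) \<le> K * sqrt \<bar>t - s\<bar>" if "s \<in> {0..1}" "t \<in> {0..1}" for j s t by (rule h[OF that])
    show "loop (u j) (v j)" for j by (rule lp)
    show "0 \<le> K" by (rule K)
  qed (rule that)
  \<comment> \<open>A second extraction makes the energies and the multipliers converge as
    well.\<close>
  have "bounded (range (\<lambda>j. (L (r j), \<mu> (r j))))"
  proof (rule boundedI)
    fix y assume "y \<in> range (\<lambda>j. (L (r j), \<mu> (r j)))"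
    then obtain j where y: "y = (L (r j), \<mu> (r j))" by blast
    have "norm y \<le> \<bar>L (r j)\<bar> + \<bar>\<mu> (r j)\<bar>" unfolding y using norm_Pair_le[of "L (r j)" "\<mu> (r j)"] by simp
    then show "norm y \<le> l + \<mu>0" using l[of "r j"] Lp[of "r j"] \<mu>[of "r j"] by (simp add: L_def)
  qed
  then obtain s z where s: "strict_mono (s :: nat \<Rightarrow> nat)" and z: "((\<lambda>j. (L (r j), \<mu> (r j))) \<circ> s) \<longlonglongrightarrow> z"
    using bounded_imp_convergent_subsequence by blast
  define q where "q = r \<circ> s"
  have q: "strict_mono q" unfolding q_def by (rule strict_mono_o[OF r s])
  define L' where "L' = fst z"
  define \<mu>' where "\<mu>' = snd z"
  have Ll: "(\<lambda>j. L (q j)) \<longlonglongrightarrow> L'" and \<mu>l: "(\<lambda>j. \<mu> (q j)) \<longlonglongrightarrow> \<mu>'"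
    using tendsto_fst[OF z] tendsto_snd[OF z] by (simp_all add: o_def q_def L'_def \<mu>'_def)
  have L'0: "L' > 0"
    using LIMSEQ_le_const[OF Ll, of L0] L0 by force
  have limu: "(\<lambda>j. u (q j) t) \<longlonglongrightarrow> U t" and limv: "(\<lambda>j. v (q j) t) \<longlonglongrightarrow> V t" if "t \<in> {0..1}" for t
    using LIMSEQ_subseq_LIMSEQ[OF limr(1)[OF that] s] LIMSEQ_subseq_LIMSEQ[OF limr(2)[OF that] s]
    by (simp_all add: o_def q_def)
  have vK: "norm (v n t) \<le> K" if "t \<in> {0..1}" for n t by (rule loop_velocity_bound[OF lp h K that])
  have uB: "norm (u n t) \<le> R + K" if "t \<in> {0..1}" for n t
    by (rule loop_bounded_by[OF lp vK R[folded u_def] that])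
  have R0: "R \<ge> 0" using R[of 0] norm_ge_zero order_trans by blast
  have dU: "(U has_vector_derivative V t) (at t within {0..1})" if "t \<in> {0..1}" for t
    by (rule loop_limit_derivative[OF lp vK cUV(2) limu limv that])
  have per: "U 1 = U 0" "V 1 = V 0"
  proof -
    have "u n 1 = u n 0" "v n 1 = v n 0" for n using tp_plus_int[of "Suc n" _ 0 1] by (simp_all add: u_def v_def)
    then show "U 1 = U 0" "V 1 = V 0"
      using LIMSEQ_unique[OF limu[of 1]] limu[of 0] LIMSEQ_unique[OF limv[of 1]] limv[of 0] by auto
  qed
  have dfl: "(\<lambda>j. dflux h (u (q j)) (v (q j)) (\<phi> j)) \<longlonglongrightarrow> dflux h U V \<phi>'"
    if h: "continuous_on UNIV h" and c: "\<And>j. continuous_on {0..1} (\<phi> j)"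
      and b: "\<And>j t. t \<in> {0..1} \<Longrightarrow> norm (\<phi> j t) \<le> B" and lim: "\<And>t. t \<in> {0..1} \<Longrightarrow> (\<lambda>j. \<phi> j t) \<longlonglongrightarrow> \<phi>' t" for h \<phi> \<phi>' B
  proof (rule dflux_tendsto[OF h, where B="max B (R + K)"])
    show "continuous_on {0..1} (u (q j))" "continuous_on {0..1} (v (q j))" for j by (rule loopD[OF lp])+
    show "norm (u (q j) t) \<le> max B (R + K)" "norm (v (q j) t) \<le> max B (R + K)" "norm (\<phi> j t) \<le> max B (R + K)"
      if "t \<in> {0..1}" for j t using uB[OF that, of "q j"] vK[OF that, of "q j"] b[OF that, of j] R0 by auto
  qed (fact limu limv lim c)+
  \<comment> \<open>The limit equation to be proved is V' = g.\<close>
  define g where "g t = (L' * (f (U t) - \<mu>')) *\<^sub>R (\<i> * V t)" for t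
  have cg: "continuous_on {0..1} g" unfolding g_def
    by (intro continuous_intros continuous_on_compose_UNIV[OF f] cUV)
  have weak: "integral {0..1} (\<lambda>t. V t \<bullet> (2 * pi * \<i> * of_int k * (a * ee k t)) + (a * ee k t) \<bullet> g t) = 0" for k a
  proof -
    define \<phi> where "\<phi> t = a * ee k t" for t
    define \<psi> where "\<psi> t = 2 * pi * \<i> * of_int k * (a * ee k t)" for t
    have c\<phi>: "continuous_on {0..1} \<phi>" and c\<psi>: "continuous_on {0..1} \<psi>" unfolding \<phi>_def \<psi>_def by (intro continuous_intros)+
    define X where "X n = integral {0..1} (\<lambda>t. v n t \<bullet> \<psi> t)" for n
    have eq: "X n / L n + dflux f (u n) (v n) \<phi> = \<mu> n * dflux (\<lambda>_. 1) (u n) (v n) \<phi>" if "\<bar>k\<bar> \<le> int n" for n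
    proof -
      have k: "\<bar>k\<bar> \<le> int (Suc n)" using that by simp
      let ?d = "\<lambda>i. if i = k then a else 0"
      have "bienergy (Suc n) (c n) ?d = X n"
        using bienergy_integral[of "Suc n" "c n" ?d] by (simp only: single_mode[OF k] X_def v_def \<psi>_def integral_unique)
      moreover have "biarea (Suc n) (c n) ?d = dflux (\<lambda>_. 1) (u n) (v n) \<phi>"
        using biarea_integral[of "Suc n" ?d "c n"] by (simp add: single_mode[OF k] dflux_def v_def \<phi>_def integral_unique)
      moreover have "tp (Suc n) ?d = \<phi>" by (simp only: single_mode[OF k] \<phi>_def[abs_def])
      ultimately show ?thesis using EL[of n ?d] by (simp add: L_def u_def v_def)
    qed
    \<comment> \<open>Mode k is a legitimate test function once the degree reaches |k|.\<close>
    have ev: "eventually (\<lambda>j. \<bar>k\<bar> \<le> int (q j)) sequentially"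
    proof (rule eventually_sequentiallyI[of "nat \<bar>k\<bar>"])
      fix j assume "nat \<bar>k\<bar> \<le> j"
      then show "\<bar>k\<bar> \<le> int (q j)" using strict_mono_imp_increasing[OF q, of j] by linarith
    qed
    have Xl: "(\<lambda>j. X (q j)) \<longlonglongrightarrow> integral {0..1} (\<lambda>t. V t \<bullet> \<psi> t)"
      unfolding X_def
    proof (rule integral_tendsto_bounded)
      show "continuous_on {0..1} (\<lambda>t. v (q j) t \<bullet> \<psi> t)" for j by (intro continuous_intros loopD[OF lp] c\<psi>)
      show "\<bar>v (q j) t \<bullet> \<psi> t\<bar> \<le> K * norm (2 * pi * \<i> * of_int k * a)" if "t \<in> {0..1}" for j t
      proof -
        have "norm (\<psi> t) = norm (2 * pi * \<i> * of_int k * a)" by (simp add: \<psi>_def norm_mult)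
        then show ?thesis
          using Cauchy_Schwarz_ineq2[of "v (q j) t" "\<psi> t"] mult_right_mono[OF vK[OF that, of "q j"], of "norm (\<psi> t)"] by simp
      qed
      show "(\<lambda>j. v (q j) t \<bullet> \<psi> t) \<longlonglongrightarrow> V t \<bullet> \<psi> t" if "t \<in> {0..1}" for t by (intro tendsto_intros limv that)
    qed
    have b: "norm (\<phi> t) \<le> norm a" for t by (simp add: \<phi>_def norm_mult)
    have Yl: "(\<lambda>j. dflux h (u (q j)) (v (q j)) \<phi>) \<longlonglongrightarrow> dflux h U V \<phi>" if "continuous_on UNIV h" for h
      by (rule dfl[OF that c\<phi> b]) simp
    have limA: "(\<lambda>j. X (q j) / L (q j) + dflux f (u (q j)) (v (q j)) \<phi>) \<longlonglongrightarrow> integral {0..1} (\<lambda>t. V t \<bullet> \<psi> t) / L' + dflux f U V \<phi>"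
      by (intro tendsto_intros Xl Ll Yl f) (use L'0 in simp)
    have limB: "(\<lambda>j. \<mu> (q j) * dflux (\<lambda>_. 1) (u (q j)) (v (q j)) \<phi>) \<longlonglongrightarrow> \<mu>' * dflux (\<lambda>_. 1) U V \<phi>"
      by (intro tendsto_intros \<mu>l Yl continuous_intros)
    have evC: "eventually (\<lambda>j. X (q j) / L (q j) + dflux f (u (q j)) (v (q j)) \<phi> = \<mu> (q j) * dflux (\<lambda>_. 1) (u (q j)) (v (q j)) \<phi>) sequentially"
      using ev by eventually_elim (rule eq)
    have "integral {0..1} (\<lambda>t. V t \<bullet> \<psi> t) / L' + dflux f U V \<phi> = \<mu>' * dflux (\<lambda>_. 1) U V \<phi>"
      by (rule LIMSEQ_unique[OF iffD1[OF tendsto_cong[OF evC] limA] limB])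
    then have sum0: "integral {0..1} (\<lambda>t. V t \<bullet> \<psi> t) + L' * (dflux f U V \<phi> - \<mu>' * dflux (\<lambda>_. 1) U V \<phi>) = 0"
      using L'0 by (simp add: field_simps)
    have i1: "((\<lambda>t. V t \<bullet> \<psi> t) has_integral integral {0..1} (\<lambda>t. V t \<bullet> \<psi> t)) {0..1}"
      by (intro integrable_integral integrable_continuous_real continuous_intros cUV c\<psi>)
    have i2: "((\<lambda>t. h (U t) * (\<phi> t \<bullet> (\<i> * V t))) has_integral dflux h U V \<phi>) {0..1}" if "continuous_on UNIV h" for h
      unfolding dflux_def
      by (intro integrable_integral integrable_continuous_real continuous_intros continuous_on_compose_UNIV[OF that] cUV c\<phi>)
    have "((\<lambda>t. V t \<bullet> \<psi> t + L' * (f (U t) * (\<phi> t \<bullet> (\<i> * V t)) - \<mu>' * (1 * (\<phi> t \<bullet> (\<i> * V t))))) has_integral 0) {0..1}"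
      using has_integral_add[OF i1 has_integral_mult_right[OF has_integral_diff[OF i2[OF f]
          has_integral_mult_right[OF i2[OF continuous_on_const, of 1], of \<mu>']], of L']]
      by (simp only: sum0)
    moreover have "L' * (f (U t) * (\<phi> t \<bullet> (\<i> * V t)) - \<mu>' * (1 * (\<phi> t \<bullet> (\<i> * V t)))) = \<phi> t \<bullet> g t" for t
      by (simp add: g_def algebra_simps)
    ultimately show ?thesis by (simp add: \<phi>_def \<psi>_def integral_unique)
  qed
  obtain \<kappa> where \<kappa>: "\<And>t. t \<in> {0..1} \<Longrightarrow> V t = \<kappa> + integral {0..t} g"
    using weak_derivative_is_derivative[OF cUV(2) cg weak] by blast
  have dV: "(V has_vector_derivative g t) (at t within {0..1})" if "t \<in> {0..1}" for t
    by (rule has_vector_derivative_of_integral[OF cg \<kappa> that])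
  have area: "integral {0..1} (\<lambda>t. U t \<bullet> (\<i> * V t)) = 2 * \<tau>"
  proof -
    have "dflux (\<lambda>_. 1) (u n) (v n) (u n) = 2 * \<tau>" for n
      using biarea_integral[of "Suc n" "c n" "c n"] by (simp add: dflux_def u_def v_def integral_unique biarea_self ar)
    moreover have "(\<lambda>j. dflux (\<lambda>_. 1) (u (q j)) (v (q j)) (u (q j))) \<longlonglongrightarrow> dflux (\<lambda>_. 1) U V U"
      by (rule dfl[OF _ loopD(3)[OF lp] uB limu]) (auto intro: continuous_intros)
    ultimately have "dflux (\<lambda>_. 1) U V U = 2 * \<tau>" by (simp add: LIMSEQ_const_iff)
    then show ?thesis by (simp add: dflux_def)
  qed
  \<comment> \<open>The velocities converge pointwise and boundedly, so no energy is lost and L'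
    will be the speed of the limit.\<close>
  have energy: "integral {0..1} (\<lambda>t. (norm (V t))\<^sup>2) = L'\<^sup>2"
  proof -
    have "(\<lambda>j. integral {0..1} (\<lambda>t. (norm (v (q j) t))\<^sup>2)) \<longlonglongrightarrow> integral {0..1} (\<lambda>t. (norm (V t))\<^sup>2)"
    proof (rule integral_tendsto_bounded)
      show "continuous_on {0..1} (\<lambda>t. (norm (v (q j) t))\<^sup>2)" for j by (intro continuous_intros loopD[OF lp])
      show "\<bar>(norm (v (q j) t))\<^sup>2\<bar> \<le> K\<^sup>2" if "t \<in> {0..1}" for j t using vK[OF that, of "q j"] by (simp add: power_mono)
      show "(\<lambda>j. (norm (v (q j) t))\<^sup>2) \<longlonglongrightarrow> (norm (V t))\<^sup>2" if "t \<in> {0..1}" for t by (intro tendsto_intros limv that)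
    qed
    moreover have "integral {0..1} (\<lambda>t. (norm (v n t))\<^sup>2) = (L n)\<^sup>2" for n
      using energy_integral[of "Suc n" "c n"] energy_nonneg by (simp add: v_def L_def integral_unique)
    ultimately have "(\<lambda>j. (L (q j))\<^sup>2) \<longlonglongrightarrow> integral {0..1} (\<lambda>t. (norm (V t))\<^sup>2)" by simp
    from LIMSEQ_unique[OF this tendsto_power[OF Ll]] show ?thesis .
  qed
  show ?thesis
    using closed_curve_of_profile[OF f L'0 dU dV[unfolded g_def] per area energy] by blast
qed

section \<open>Existence of closed curves with prescribed curvature\<close>

text \<open>\<open>far\<close> prevents drift and \<open>int\<close> makes the energy bound
  inactive. R and l do not depend on n, which makes the multipliers bounded uniformly in the
  degree.\<close>

theorem closed_curve_of_coercive_galerkin: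
  assumes f: "continuous_on UNIV f" and M: "\<And>p. \<bar>f p\<bar> \<le> M" and \<tau>: "\<tau> \<noteq> 0"
    and c0: "\<And>n. c0 n \<in> admissible (Suc n) \<tau> l"
    and far: "\<And>n c. c \<in> admissible (Suc n) \<tau> l \<Longrightarrow> norm (tp (Suc n) c 0) \<ge> R \<Longrightarrow>
      lagrangian f (Suc n) c > lagrangian f (Suc n) (c0 n)"
    and int: "\<And>n c. c \<in> admissible (Suc n) \<tau> l \<Longrightarrow> lagrangian f (Suc n) c \<le> lagrangian f (Suc n) (c0 n) \<Longrightarrow>
      sqrt (energy (Suc n) c) < l"
  shows "\<exists>u \<mu>. C2_periodic u \<and> (\<forall>t. vd u t \<noteq> 0) \<and> area u = \<tau> \<and> (\<forall>t. curvature u t = f (u t) - \<mu>)"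
proof -
  have "\<forall>n. \<exists>c. c \<in> admissible (Suc n) \<tau> l \<and> (\<forall>d\<in>admissible (Suc n) \<tau> l. lagrangian f (Suc n) c \<le> lagrangian f (Suc n) d) \<and>
      norm (tp (Suc n) c 0) < R"
    by (rule allI, rule galerkin_minimizer[OF f c0 far]) blast+
  from choice[OF this] obtain c where c: "\<And>n. c n \<in> admissible (Suc n) \<tau> l"
    "\<And>n d. d \<in> admissible (Suc n) \<tau> l \<Longrightarrow> lagrangian f (Suc n) (c n) \<le> lagrangian f (Suc n) d"
    "\<And>n. norm (tp (Suc n) (c n) 0) < R" by blast
  let ?u = "\<lambda>n. tp (Suc n) (c n)" and ?v = "\<lambda>n. tp (Suc n) (dc (c n))" and ?E = "\<lambda>n. energy (Suc n) (c n)"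
  define \<mu> where "\<mu> n = (sqrt (?E n) + dflux f (?u n) (?v n) (?u n)) / (2 * \<tau>)" for n
  have le: "sqrt (?E n) \<le> l" for n using c(1)[of n] by (simp add: admissible_def)
  have l0: "0 \<le> l" using le[of 0] energy_nonneg[of "Suc 0" "c 0"] by (meson order_trans real_sqrt_ge_zero)
  have M0: "M \<ge> 0" using M[of 0] by simp
  have R0: "R \<ge> 0" using c(3)[of 0] norm_ge_zero[of "tp (Suc 0) (c 0) 0"] by linarith
  \<comment> \<open>The multiplier is explicit, and its \<open>dflux\<close> term is bounded because
    the minimiser starts within R of the origin and has length at most l.\<close>
  have \<mu>b: "\<bar>\<mu> n\<bar> \<le> (l + M * (R + l) * l) / (2 * \<bar>\<tau>\<bar>)" for n
  proof -
    have lenl: "len (?v n) \<le> l" using len_tp_le le order_trans by blast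
    have "\<bar>dflux f (?u n) (?v n) (?u n)\<bar> \<le> M * (R + l) * len (?v n)"
      unfolding len_def
    proof (rule dflux_bound[OF f loop_tp continuous_on_tp M])
      fix t :: real assume "t \<in> {0..1}"
      then have "norm (?u n t - ?u n 0) \<le> l"
        using loop_displacement[OF loop_tp] lenl order_trans by blast
      then show "norm (?u n t) \<le> R + l"
        using c(3)[of n] norm_triangle_sub[of "?u n t" "?u n 0"] by linarith
    qed
    also have "\<dots> \<le> M * (R + l) * l" by (rule mult_left_mono[OF lenl]) (use M0 R0 l0 in simp)
    finally have "\<bar>sqrt (?E n) + dflux f (?u n) (?v n) (?u n)\<bar> \<le> l + M * (R + l) * l"
      using le[of n] energy_nonneg[of "Suc n" "c n"] by (intro order_trans[OF abs_triangle_ineq] add_mono) auto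
    then show ?thesis unfolding \<mu>_def abs_divide using \<tau> by (simp add: divide_right_mono abs_mult)
  qed
  have int': "sqrt (energy (Suc n) (c n)) < l" for n by (rule int[OF c(1) c(2)[OF c0]])
  show ?thesis
  proof (rule galerkin_limit[OF f M \<tau> _ le _ _ \<mu>b])
    show "tarea (Suc n) (c n) = \<tau>" for n using c(1)[of n] by (simp add: admissible_def)
    show "norm (tp (Suc n) (c n) 0) \<le> R" for n using c(3)[of n] by simp
    show "bienergy (Suc n) (c n) d / sqrt (energy (Suc n) (c n)) +
        dflux f (tp (Suc n) (c n)) (tp (Suc n) (dc (c n))) (tp (Suc n) d) = \<mu> n * biarea (Suc n) (c n) d" for n d
      unfolding \<mu>_def by (rule galerkin_euler_lagrange[OF f c(1) c(2) int' \<tau>])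
  qed
qed

section \<open>Discs in the cone of favourable sign\<close>

lemma disc_in_cone:
  fixes \<omega> :: "complex set"
  assumes "\<omega> \<noteq> {}" "openin (top_of_set (sphere 0 1)) \<omega>" "0 < r"
  obtains q where "\<And>x. x \<in> cball q r \<Longrightarrow> \<exists>p\<in>\<omega>. \<exists>s>0. x = of_real s * p"
proof -
  obtain p0 where p0: "p0 \<in> \<omega>" using assms(1) by blast
  obtain T where T: "open T" "\<omega> = sphere 0 1 \<inter> T" using assms(2) by (auto simp: openin_open)
  then obtain e where e: "e > 0" "ball p0 e \<subseteq> T" using p0 open_contains_ball by blast
  have np0: "norm p0 = 1" using p0 T by simp
  \<comment> \<open>A point within r of S p0 has direction within 2 r / (S - r) of p0: one r for the
    displacement, one for the change of modulus. This S makes the quotient smaller than e.\<close>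
  define S where "S = 2 * r / e + r + 1"
  have S: "S > r" "2 * r / (S - r) < e" using assms(3) e
    by (auto simp: S_def field_simps add_pos_pos)
  show thesis
  proof (rule that[of "of_real S * p0"])
    fix x assume "x \<in> cball (of_real S * p0) r"
    then have d: "norm (x - of_real S * p0) \<le> r" by (simp add: dist_norm norm_minus_commute)
    have nS: "norm (of_real S * p0) = S" using S assms(3) np0 by (simp add: norm_mult)
    have nx: "\<bar>norm x - S\<bar> \<le> r" using norm_triangle_ineq3[of x "of_real S * p0"] d nS by simp
    then have xpos: "norm x \<ge> S - r" "norm x > 0" using S by auto
    define p where "p = x / of_real (norm x)"
    have "norm (x - of_real (norm x) * p0) \<le> norm (x - of_real S * p0) + norm (of_real (S - norm x) * p0)"
      using norm_triangle_ineq[of "x - of_real S * p0" "of_real (S - norm x) * p0"] by (simp add: algebra_simps)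
    also have "norm (of_real (S - norm x) * p0) = \<bar>S - norm x\<bar>" using np0 by (simp only: norm_mult norm_of_real mult_1_right)
    finally have n2: "norm (x - of_real (norm x) * p0) \<le> 2 * r" using d nx by (simp add: abs_minus_commute)
    have "p - p0 = (x - of_real (norm x) * p0) / of_real (norm x)"
      using xpos by (simp add: p_def field_simps)
    then have "norm (p - p0) = norm (x - of_real (norm x) * p0) / norm x" by (simp add: norm_divide)
    also have "\<dots> \<le> 2 * r / (S - r)" by (rule frac_le) (use n2 xpos S assms(3) in auto)
    also have "\<dots> < e" by (rule S)
    finally have "p \<in> T" using e by (auto simp: dist_norm norm_minus_commute)
    moreover have "norm p = 1" using xpos by (simp add: p_def norm_divide)
    ultimately have "p \<in> \<omega>" using T by simp
    moreover have "x = of_real (norm x) * p" using xpos by (simp add: p_def)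
    ultimately show "\<exists>p\<in>\<omega>. \<exists>s>0. x = of_real s * p" using xpos by blast
  qed
qed

text \<open>Compactness of the disc turns pointwise positivity into a lower bound m, which is the
  source of the energy gap.\<close>

lemma disc_with_sign:
  fixes h :: "complex \<Rightarrow> real"
  assumes h: "continuous_on UNIV h" and \<omega>: "\<omega> \<noteq> {}" "openin (top_of_set (sphere 0 1)) \<omega>" and r: "0 < r"
    and pos: "\<And>p s. p \<in> \<omega> \<Longrightarrow> s > 0 \<Longrightarrow> h (of_real s * p) > 0"
  obtains q m where "m > 0" "\<And>x. x \<in> cball q r \<Longrightarrow> m \<le> h x"
proof -
  obtain q where q: "\<And>x. x \<in> cball q r \<Longrightarrow> \<exists>p\<in>\<omega>. \<exists>s>0. x = of_real s * p"
    using disc_in_cone[OF \<omega> r] by blast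
  have "\<exists>x\<in>cball q r. \<forall>y\<in>cball q r. h x \<le> h y"
    by (rule continuous_attains_inf) (use r continuous_on_subset[OF h] in auto)
  then obtain x where x: "x \<in> cball q r" "\<And>y. y \<in> cball q r \<Longrightarrow> h x \<le> h y" by blast
  have "h x > 0" using q[OF x(1)] pos by blast
  with that[of "h x" q] x(2) show thesis by blast
qed

lemma holder_C0_imp_continuous:
  assumes "holder_C0 \<alpha> f" "0 < \<alpha>"
  shows "continuous_on UNIV f"
proof -
  obtain C where C: "\<And>p q. \<bar>f p - f q\<bar> \<le> C * dist p q powr \<alpha>"
    using assms by (auto simp: holder_C0_def)
  have "(f \<longlongrightarrow> f x) (at x)" for x
  proof -
    have "((\<lambda>y. C * dist y x powr \<alpha>) \<longlongrightarrow> C * dist x x powr \<alpha>) (at x)"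
      using assms(2) by (intro tendsto_intros tendsto_powr') auto
    then have "((\<lambda>y. C * dist y x powr \<alpha>) \<longlongrightarrow> 0) (at x)" by simp
    then have "((\<lambda>y. f y - f x) \<longlongrightarrow> 0) (at x)"
      by (rule Lim_null_comparison[rotated]) (simp add: C)
    then show ?thesis by (rule LIM_zero_cancel)
  qed
  then show ?thesis by (simp add: continuous_on_def tendsto_within_subset)
qed

lemma holder_C0_imp_bounded:
  assumes "holder_C0 \<alpha> f"
  obtains M where "M > 0" "\<And>p. \<bar>f p\<bar> \<le> M"
proof -
  obtain M where "M > 0" "\<forall>x\<in>range f. norm x \<le> M"
    using assms by (auto simp: holder_C0_def bounded_pos)
  then show ?thesis by (intro that[of M]) auto
qed

text \<open>The circle in the good cone beats every curve far from the origin, since out there the perturbation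
  contributes almost nothing and the isoperimetric inequality applies.\<close>

theorem prescribed_curvature_curve:
  fixes H h :: "complex \<Rightarrow> real"
  assumes H: "continuous_on UNIV H" "\<And>p. \<bar>H p\<bar> \<le> M1" and h: "continuous_on UNIV h" "\<And>p. \<bar>h p\<bar> \<le> M2"
    and \<epsilon>: "0 < \<epsilon>" and \<tau>: "\<tau> \<noteq> 0"
    and coercive: "\<And>u v. loop u v \<Longrightarrow> \<bar>flux h u v\<bar> \<le> len v / 2"
    and s: "s = 1 \<or> s = - 1" "\<tau> = - of_int s * \<bar>\<tau>\<bar>" and m: "m > 0"
    and disc: "\<And>x. x \<in> cball q (sqrt (\<bar>\<tau>\<bar> / pi)) \<Longrightarrow> m \<le> of_int s * h x"
    and l1: "sqrt (4 * pi * \<bar>\<tau>\<bar>) \<le> l1"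
    and \<epsilon>1: "2 * (\<epsilon> * M1 * (4 * l1)\<^sup>2) \<le> l1" and \<epsilon>2: "\<epsilon> * M1 * (4 * l1)\<^sup>2 \<le> \<bar>\<tau>\<bar> * m / 8"
    and far: "\<And>x. norm x \<ge> B \<Longrightarrow> \<bar>h x\<bar> \<le> \<eta>" and \<eta>: "\<eta> * (4 * l1)\<^sup>2 \<le> \<bar>\<tau>\<bar> * m / 8"
  shows "\<exists>u \<mu>. C2_periodic u \<and> (\<forall>t. vd u t \<noteq> 0) \<and> area u = \<tau> \<and> (\<forall>t. curvature u t = \<epsilon> * H (u t) + h (u t) - \<mu>)"
proof -
  let ?h = "\<lambda>n c. flux h (tp (Suc n) c) (tp (Suc n) (dc c))"
  define f where "f p = \<epsilon> * H p + h p" for p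
  \<comment> \<open>Coercivity gives a root of the energy of at most 2 l0 + 4 C - 2 \<delta>, which
    is less than 2 l1 + 2 l1.\<close>
  define l where "l = 4 * l1"
  define l0 where "l0 = sqrt (4 * pi * \<bar>\<tau>\<bar>)"
  \<comment> \<open>The gain of the comparison circle: its enclosed area |\<tau>| times the least
    favourable value m on its disc.\<close>
  define \<delta> where "\<delta> = \<bar>\<tau>\<bar> * m"
  define C where "C = \<epsilon> * M1 * l\<^sup>2"
  define r where "r = sqrt (\<bar>\<tau>\<bar> / pi)"
  have r: "r > 0" "pi * r\<^sup>2 = \<bar>\<tau>\<bar>" using \<tau> by (auto simp: r_def)
  have l0r: "l0 = 2 * pi * r"
  proof -
    have "4 * pi * \<bar>\<tau>\<bar> = (2 * pi * r)\<^sup>2" unfolding r(2)[symmetric] by (simp add: power2_eq_square)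
    then show ?thesis unfolding l0_def using r(1) by simp
  qed
  have \<delta>: "\<delta> > 0" using \<tau> m by (simp add: \<delta>_def)
  have l0: "l0 > 0" "l0 \<le> l1" using l1 l0r r by (auto simp: l0_def)
  have C: "2 * C \<le> l1" "C \<le> \<delta> / 8" using \<epsilon>1 \<epsilon>2 by (auto simp: C_def l_def \<delta>_def)
  have f: "continuous_on UNIV f" unfolding f_def by (intro continuous_intros H h)
  have fM: "\<bar>f p\<bar> \<le> \<epsilon> * M1 + M2" for p
  proof -
    have "\<bar>\<epsilon> * H p\<bar> \<le> \<epsilon> * M1" unfolding abs_mult using \<epsilon> H(2)[of p] by (auto intro: mult_mono)
    then show ?thesis unfolding f_def using h(2)[of p] by linarith
  qed
  have lag: "lagrangian f n c = sqrt (energy n c) + (\<epsilon> * flux H (tp n c) (tp n (dc c)) + flux h (tp n c) (tp n (dc c)))" for n c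
    unfolding lagrangian_def f_def
    by (subst flux_add) (auto intro!: continuous_intros H h loop_tp simp: flux_cmult)
  have len: "(len (tp n (dc c)))\<^sup>2 \<le> l\<^sup>2" if "c \<in> admissible n \<tau> l" for n c
    using that len_tp_le[of n c] len_nonneg by (intro power_mono) (auto simp: admissible_def)
  have F1: "\<bar>\<epsilon> * flux H (tp n c) (tp n (dc c))\<bar> \<le> C" if "c \<in> admissible n \<tau> l" for n c
  proof -
    have M10: "M1 \<ge> 0" using H(2)[of 0] by simp
    have "\<bar>flux H (tp n c) (tp n (dc c))\<bar> \<le> M1 * (len (tp n (dc c)))\<^sup>2"
      by (rule flux_bound_len[OF H(1) loop_tp]) (rule H(2))
    also have "\<dots> \<le> M1 * l\<^sup>2" by (rule mult_left_mono[OF len[OF that] M10])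
    finally show ?thesis unfolding abs_mult C_def using \<epsilon> by (simp add: mult.assoc)
  qed
  let ?L = "\<lambda>n. lagrangian f (Suc n)"
  define c0 where "c0 = (\<lambda>k::int. if k = 0 then q else if k = s then complex_of_real r else 0)"
  have circ: "tp n c0 = (\<lambda>t. q + r * ee s t)" "tp n (dc c0) = (\<lambda>t. 2 * pi * \<i> * of_int s * r * ee s t)"
    "sqrt (energy n c0) = l0" "tarea n c0 = \<tau>" if "n \<ge> 1" for n
  proof -
    have "tarea n c0 = - of_int s * (pi * r\<^sup>2)" using circle_tp(4)[OF that s(1) c0_def] by simp
    then show "tarea n c0 = \<tau>" using s(2) r(2) by metis
    show "sqrt (energy n c0) = l0" using circle_tp(3)[OF that s(1) c0_def] r(1) by (simp add: l0r)
  qed (rule circle_tp[OF that s(1) c0_def])+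
  have c0: "c0 \<in> admissible (Suc n) \<tau> l" for n
    using circ[of "Suc n"] l0 by (simp add: admissible_def l_def)
  have lag0: "?L n c0 \<le> l0 + C - \<delta>" for n
  proof -
    have n: "Suc n \<ge> 1" by simp
    have "?h n c0 \<le> - (pi * r\<^sup>2 * m)"
      unfolding circ(1,2)[OF n]
      by (rule flux_circle_le[OF h(1) s(1) r(1) less_imp_le[OF m]]) (rule disc, simp add: r_def)
    then have "?h n c0 \<le> - \<delta>" using r(2) by (simp add: \<delta>_def)
    then show ?thesis unfolding lag using F1[OF c0[of n]] circ(3)[of "Suc n"] by simp
  qed
  have far': "?L n c > ?L n c0"
    if c: "c \<in> admissible (Suc n) \<tau> l" and R: "norm (tp (Suc n) c 0) \<ge> B + l" for n c
  proof -
    have lenl: "len (tp (Suc n) (dc c)) \<le> l"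
      using c len_tp_le[of "Suc n" c] by (simp add: admissible_def)
    \<comment> \<open>A sample point of modulus at least B, which shows that \<eta> is
      nonnegative.\<close>
    have "\<bar>h (of_real \<bar>B\<bar>)\<bar> \<le> \<eta>" by (rule far) (simp add: norm_of_real)
    then have \<eta>0: "\<eta> \<ge> 0" using abs_ge_zero order_trans by blast
    have "\<bar>?h n c\<bar> \<le> \<eta> * (len (tp (Suc n) (dc c)))\<^sup>2"
    proof (rule flux_bound_len[OF h(1) loop_tp])
      fix x assume "norm (x - tp (Suc n) c 0) \<le> len (tp (Suc n) (dc c))"
      then have "norm x \<ge> B"
        using R lenl norm_triangle_ineq2[of "tp (Suc n) c 0" x] by (simp add: norm_minus_commute)
      then show "\<bar>h x\<bar> \<le> \<eta>" by (rule far)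
    qed
    also have "\<dots> \<le> \<eta> * l\<^sup>2" by (rule mult_left_mono[OF len[OF c] \<eta>0])
    also have "\<dots> \<le> \<delta> / 8" using \<eta> by (simp add: l_def \<delta>_def)
    finally have F2: "\<bar>?h n c\<bar> \<le> \<delta> / 8" .
    \<comment> \<open>A far curve has value at least l0 - C - \<delta>/8, the circle at most l0 + C
      - \<delta>, and 2 C <= \<delta>/4.\<close>
    have "l0 \<le> sqrt (energy (Suc n) c)"
      unfolding l0_def using isoperimetric_tp[of "Suc n" c] c by (simp add: admissible_def)
    then have "?L n c \<ge> l0 - C - \<delta> / 8" unfolding lag using F1[OF c] F2 by linarith
    then show ?thesis using lag0[of n] C(2) \<delta> by linarith
  qed
  have int: "sqrt (energy (Suc n) c) < l"
    if c: "c \<in> admissible (Suc n) \<tau> l" and le: "?L n c \<le> ?L n c0" for n c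
  proof -
    have "\<bar>?h n c\<bar> \<le> sqrt (energy (Suc n) c) / 2"
      using coercive[OF loop_tp[of "Suc n" c]] len_tp_le[of "Suc n" c] by linarith
    then have "sqrt (energy (Suc n) c) - C - sqrt (energy (Suc n) c) / 2 \<le> ?L n c"
      unfolding lag using F1[OF c] by linarith
    then show ?thesis using le lag0[of n] C(1) l0 \<delta> unfolding l_def by linarith
  qed
  show ?thesis
    using closed_curve_of_coercive_galerkin[OF f fM \<tau> c0 far' int] by (simp add: f_def)
qed

theorem theorem1p1p3:
  fixes H1 H2 :: "complex \<Rightarrow> real" and H2inf \<alpha> \<alpha>' :: real
    and \<omega>p \<omega>m :: "complex set"
  assumes "0 < \<alpha>" "\<alpha> < 1" "holder_C0 \<alpha> H1"
    and "\<And>p (m::int) (n::int). H1 (p + Complex (of_int m) (of_int n)) = H1 p"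
    and "(SUP p. \<bar>H1 p - mean_square H1\<bar>) < 2 * sqrt 2"
    and "0 < \<alpha>'" "\<alpha>' < 1" "holder_C0 \<alpha>' H2"
    and "(H2 \<longlongrightarrow> H2inf) at_infinity"
    and "lorentz21 (\<lambda>p. H2 p - H2inf) < ennreal ((2 / pi) powr (3/2))"
    and "\<omega>p \<noteq> {}" "openin (top_of_set (sphere 0 1)) \<omega>p"
    and "\<omega>m \<noteq> {}" "openin (top_of_set (sphere 0 1)) \<omega>m"
    and "\<And>p s. p \<in> \<omega>p \<Longrightarrow> s > 0 \<Longrightarrow> H2 (of_real s * p) - H2inf < 0"
    and "\<And>p s. p \<in> \<omega>m \<Longrightarrow> s > 0 \<Longrightarrow> H2 (of_real s * p) - H2inf > 0"
    and "ennreal (sqrt 2 / 4 * (SUP p. \<bar>H1 p - mean_square H1\<bar>))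
           + ennreal ((pi / 2) powr (3/2)) * lorentz21 (\<lambda>p. H2 p - H2inf) < 1"
  shows "\<forall>\<tau>0 \<tau>1. 0 < \<tau>0 \<and> \<tau>0 < \<tau>1 \<longrightarrow>
     (\<exists>\<epsilon>0. 0 < \<epsilon>0 \<and> \<epsilon>0 \<le> 1 \<and>
       (\<forall>\<epsilon> \<tau>. 0 < \<epsilon> \<and> \<epsilon> \<le> \<epsilon>0 \<and> \<tau>0 \<le> \<bar>\<tau>\<bar> \<and> \<bar>\<tau>\<bar> \<le> \<tau>1 \<longrightarrow>
         (\<exists>(u :: real \<Rightarrow> complex) (lam :: real). C2_periodic u \<and>
            (\<forall>t. vd u t \<noteq> 0) \<and> area u = \<tau> \<and>
            (\<forall>t. curvature u t = \<epsilon> * H1 (u t) + H2 (u t) - lam))))"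
proof (intro allI impI)
  fix \<tau>0 \<tau>1 :: real assume "0 < \<tau>0 \<and> \<tau>0 < \<tau>1"
  then have \<tau>01: "0 < \<tau>0" "\<tau>0 < \<tau>1" by auto
  define h where "h p = H2 p - H2inf" for p
  have cH: "continuous_on UNIV H1" by (rule holder_C0_imp_continuous[OF assms(3,1)])
  have ch: "continuous_on UNIV h" unfolding h_def
    by (intro continuous_intros holder_C0_imp_continuous[OF assms(8,6)])
  obtain M1 where M1: "M1 > 0" "\<And>p. \<bar>H1 p\<bar> \<le> M1" using holder_C0_imp_bounded[OF assms(3)] by blast
  obtain M2 where M2: "M2 > 0" "\<And>p. \<bar>H2 p\<bar> \<le> M2" using holder_C0_imp_bounded[OF assms(8)] by blast
  have hM: "\<bar>h p\<bar> \<le> M2 + \<bar>H2inf\<bar>" for p unfolding h_def using M2(2)[of p] by linarith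
  have hlim: "(h \<longlongrightarrow> 0) at_infinity" unfolding h_def using assms(9) by (rule LIM_zero)
  have coercive: "\<bar>flux h u v\<bar> \<le> len v / 2" if "loop u v" for u v
    by (rule flux_lorentz_half[OF ch hlim _ that]) (use assms(10) in \<open>simp add: h_def[abs_def]\<close>)
  \<comment> \<open>Uniformity in \<tau> comes from choosing everything at the ends of the range:
    the largest radius and length at \<tau>1, the smallest gap at \<tau>0.\<close>
  define r1 where "r1 = sqrt (\<tau>1 / pi)"
  have r1: "r1 > 0" using \<tau>01 by (simp add: r1_def)
  obtain qm mm where mm: "mm > 0" "\<And>x. x \<in> cball qm r1 \<Longrightarrow> mm \<le> h x"
    by (rule disc_with_sign[OF ch assms(13,14) r1]) (use assms(16) in \<open>auto simp: h_def\<close>)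
  have "continuous_on UNIV (\<lambda>p. - h p)" by (intro continuous_intros ch)
  then obtain qp mp where mp: "mp > 0" "\<And>x. x \<in> cball qp r1 \<Longrightarrow> mp \<le> - h x"
    by (rule disc_with_sign[OF _ assms(11,12) r1]) (use assms(15) in \<open>auto simp: h_def\<close>)
  define m where "m = min mm mp"
  have m: "m > 0" using mm mp by (simp add: m_def)
  define l1 where "l1 = sqrt (4 * pi * \<tau>1)"
  have l1: "l1 > 0" using \<tau>01 by (simp add: l1_def)
  define D where "D = M1 * (4 * l1)\<^sup>2"
  have D: "D > 0" using M1 l1 by (simp add: D_def)
  define \<eta> where "\<eta> = \<tau>0 * m / 8 / (4 * l1)\<^sup>2"
  have \<eta>: "\<eta> > 0" "\<eta> * (4 * l1)\<^sup>2 = \<tau>0 * m / 8" using \<tau>01 m l1 by (auto simp: \<eta>_def)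
  obtain B where B: "\<And>x. norm x \<ge> B \<Longrightarrow> \<bar>h x\<bar> < \<eta>"
    using tendstoD[OF hlim \<eta>(1)] by (auto simp: eventually_at_infinity)
  \<comment> \<open>The bound by l1 keeps minimisers strictly below the energy bound; the last one
    keeps the effect of \<epsilon> H1 within an eighth of the smallest gap.\<close>
  define \<epsilon>0 where "\<epsilon>0 = min 1 (min (l1 / (2 * D)) (\<tau>0 * m / (8 * D)))"
  have \<epsilon>0: "0 < \<epsilon>0" "\<epsilon>0 \<le> 1" "2 * (\<epsilon>0 * D) \<le> l1" "\<epsilon>0 * D \<le> \<tau>0 * m / 8"
  proof -
    show "0 < \<epsilon>0" "\<epsilon>0 \<le> 1" using D l1 \<tau>01 m by (auto simp: \<epsilon>0_def)
    have "\<epsilon>0 * D \<le> l1 / (2 * D) * D" by (rule mult_right_mono) (use D in \<open>auto simp: \<epsilon>0_def\<close>)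
    then show "2 * (\<epsilon>0 * D) \<le> l1" using D by simp
    have "\<epsilon>0 * D \<le> \<tau>0 * m / (8 * D) * D" by (rule mult_right_mono) (use D in \<open>auto simp: \<epsilon>0_def\<close>)
    then show "\<epsilon>0 * D \<le> \<tau>0 * m / 8" using D by simp
  qed
  have "\<exists>u lam. C2_periodic u \<and> (\<forall>t. vd u t \<noteq> 0) \<and> area u = \<tau> \<and> (\<forall>t. curvature u t = \<epsilon> * H1 (u t) + H2 (u t) - lam)"
    if \<epsilon>: "0 < \<epsilon>" "\<epsilon> \<le> \<epsilon>0" and \<tau>: "\<tau>0 \<le> \<bar>\<tau>\<bar>" "\<bar>\<tau>\<bar> \<le> \<tau>1" for \<epsilon> \<tau>
  proof -
    have \<tau>nz: "\<tau> \<noteq> 0" using \<tau> \<tau>01 by auto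
    have \<epsilon>D: "\<epsilon> * D \<le> \<epsilon>0 * D" using \<epsilon> D by simp
    have \<tau>m: "\<tau>0 * m / 8 \<le> \<bar>\<tau>\<bar> * m / 8" using \<tau> m by simp
    have rr: "sqrt (\<bar>\<tau>\<bar> / pi) \<le> r1" unfolding r1_def using \<tau> by (simp add: divide_right_mono)
    \<comment> \<open>Counterclockwise circles, s = 1, have negative area and gain where h > 0;
      positive \<tau> requires the clockwise circle and the cone where h < 0.\<close>
    define s :: int where "s = (if \<tau> > 0 then - 1 else 1)"
    define q where "q = (if \<tau> > 0 then qp else qm)"
    have s: "s = 1 \<or> s = - 1" "\<tau> = - of_int s * \<bar>\<tau>\<bar>" by (auto simp: s_def)
    have disc: "m \<le> of_int s * h x" if "x \<in> cball q (sqrt (\<bar>\<tau>\<bar> / pi))" for x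
    proof -
      have x: "x \<in> cball q r1" using that rr by auto
      show ?thesis
      proof (cases "\<tau> > 0")
        case True
        then show ?thesis using mp(2)[of x] x by (simp add: s_def q_def m_def)
      next
        case False
        then show ?thesis using mm(2)[of x] x by (simp add: s_def q_def m_def)
      qed
    qed
    have "\<exists>u \<mu>. C2_periodic u \<and> (\<forall>t. vd u t \<noteq> 0) \<and> area u = \<tau> \<and> (\<forall>t. curvature u t = \<epsilon> * H1 (u t) + h (u t) - \<mu>)"
    proof (rule prescribed_curvature_curve[OF cH M1(2) ch hM \<epsilon>(1) \<tau>nz coercive s m disc])
      show "sqrt (4 * pi * \<bar>\<tau>\<bar>) \<le> l1" unfolding l1_def using \<tau> by simp
      show "2 * (\<epsilon> * M1 * (4 * l1)\<^sup>2) \<le> l1" "\<epsilon> * M1 * (4 * l1)\<^sup>2 \<le> \<bar>\<tau>\<bar> * m / 8"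
        using \<epsilon>D \<epsilon>0(3,4) \<tau>m unfolding mult.assoc[of \<epsilon> M1] D_def[symmetric] by linarith+
      show "\<bar>h x\<bar> \<le> \<eta>" if "norm x \<ge> B" for x using B[OF that] by simp
      show "\<eta> * (4 * l1)\<^sup>2 \<le> \<bar>\<tau>\<bar> * m / 8" using \<eta>(2) \<tau>m by simp
    qed
    then obtain u \<mu> where "C2_periodic u" "\<forall>t. vd u t \<noteq> 0" "area u = \<tau>" "\<forall>t. curvature u t = \<epsilon> * H1 (u t) + h (u t) - \<mu>"
      by blast
    \<comment> \<open>The limit of H2 at infinity is absorbed into the multiplier.\<close>
    then show ?thesis by (intro exI[of _ u] exI[of _ "\<mu> + H2inf"]) (simp add: h_def)
  qed
  then show "\<exists>\<epsilon>0. 0 < \<epsilon>0 \<and> \<epsilon>0 \<le> 1 \<and>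
       (\<forall>\<epsilon> \<tau>. 0 < \<epsilon> \<and> \<epsilon> \<le> \<epsilon>0 \<and> \<tau>0 \<le> \<bar>\<tau>\<bar> \<and> \<bar>\<tau>\<bar> \<le> \<tau>1 \<longrightarrow>
         (\<exists>(u :: real \<Rightarrow> complex) (lam :: real). C2_periodic u \<and>
            (\<forall>t. vd u t \<noteq> 0) \<and> area u = \<tau> \<and>
            (\<forall>t. curvature u t = \<epsilon> * H1 (u t) + H2 (u t) - lam)))"
    using \<epsilon>0(1,2) by blast
qed

end
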